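(* Let $X,Y\subset\mathbb{R}^n$ be subanalytic sets, and let $x_0\in\overline{X}$ and $y_0\in\overline{Y}$. If the germs $(X,x_0)$ and $(Y,y_0)$ are bi-Lipschitz homeomorphic, then the germs at the origin $(C(X,x_0),0)$ and $(C(Y,y_0),0)$ of their tangent cones are also bi-Lipschitz homeomorphic.
   Context: All sets are equipped with the Euclidean metric $\|x-y\|$ of the ambient space. A bi-Lipschitz homeomorphism between two sets is a bijection $h$ such that, for some $K>0$, $\frac1K\|x-y\|\le\|h(x)-h(y)\|\le K\|x-y\|$ for all $x,y$ in its domain; it is not assumed to be subanalytic. Tangent cone: let $A\subset\mathbb{R}^n$ and $x_0\in\overline{A}$. A vector $v\in\mathbb{R}^n$ is a tangent vector of $A$ at $x_0$ if there are a sequence of points $\{x_i\}\subset A\setminus\{x_0\}$ tending to $x_0$ and a sequence of positive real numbers $\{t_i\}$ such that $\lim_{i\to\infty}\frac{1}{t_i}(x_i-x_0)=v$. The tangent cone $C(A,x_0)$ is the set of all tangent vectors of $A$ at $x_0$. Germs $(A,a)$ and $(B,b)$ are bi-Lipschitz homeomorphic if there are open neighborhoods $U$ of $a$ and $V$ of $b$ and a bi-Lipschitz homeomorphism $h:(A\cap U)\cup\{a\}\to(B\cap V)\cup\{b\}$ with $h(a)=b$ and $h(A\cap U)=B\cap V$. *)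

theory Defs
  imports "HOL-Analysis.Analysis"
begin

text \<open>
  Subanalytic subsets of \<open>\<real>\<^sup>n\<close> are locally projections from \<open>\<real>\<^sup>n \<times> \<real>\<^sup>m\<close>, where \<open>m\<close> is not
  bounded in advance and so cannot be the size of a type. Analytic functions and semianalytic
  sets are therefore defined on \<open>\<real>\<^sup>I\<close> for a finite index set \<open>I\<close>, whose points are the
  extensional functions on \<open>I\<close>, with the topology \<^term>\<open>powertop_real I\<close>.
\<close>

text \<open>
  In \<open>real_analytic_at\<close>, \<open>\<alpha>\<close> ranges over the multi-indices in \<open>\<nat>\<^sup>I\<close>.
\<close>

definition real_analytic_at :: "'i set \<Rightarrow> (('i \<Rightarrow> real) \<Rightarrow> real) \<Rightarrow> ('i \<Rightarrow> real) \<Rightarrow> bool" where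
  "real_analytic_at I f a \<longleftrightarrow>
     (\<exists>r>0. \<exists>c :: ('i \<Rightarrow> nat) \<Rightarrow> real.
        \<forall>x \<in> topspace (powertop_real I). (\<forall>i\<in>I. \<bar>x i - a i\<bar> < r) \<longrightarrow>
          ((\<lambda>\<alpha>. c \<alpha> * (\<Prod>i\<in>I. (x i - a i) ^ \<alpha> i)) has_sum f x) (I \<rightarrow>\<^sub>E UNIV))"

definition real_analytic_on :: "'i set \<Rightarrow> (('i \<Rightarrow> real) \<Rightarrow> real) \<Rightarrow> ('i \<Rightarrow> real) set \<Rightarrow> bool" where
  "real_analytic_on I f U \<longleftrightarrow> (\<forall>a\<in>U. real_analytic_at I f a)"

text \<open>
  Each pair \<open>(E, P)\<close> of finite sets of analytic functions describes the set where all \<open>f \<in> E\<close>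
  vanish and all \<open>g \<in> P\<close> are positive. The local description is required at every point of the
  ambient space, not only at the points of \<open>A\<close>.
\<close>

definition semianalytic :: "'i set \<Rightarrow> ('i \<Rightarrow> real) set \<Rightarrow> bool" where
  "semianalytic I A \<longleftrightarrow>
     A \<subseteq> topspace (powertop_real I) \<and>
     (\<forall>a \<in> topspace (powertop_real I).
        \<exists>U D. openin (powertop_real I) U \<and> a \<in> U \<and> finite D \<and>
          (\<forall>(E, P)\<in>D. finite E \<and> finite P \<and> (\<forall>f \<in> E \<union> P. real_analytic_on I f U)) \<and>
          A \<inter> U = (\<Union>(E, P)\<in>D. {x\<in>U. (\<forall>f\<in>E. f x = 0) \<and> (\<forall>g\<in>P. 0 < g x)}))"

text \<open>
  \<open>\<real>\<^sup>n \<times> \<real>\<^sup>m\<close> is \<open>\<real>\<^sup>I\<close> for the disjoint union \<open>I\<close> of \<open>'n\<close> and \<open>{..<m}\<close>; \<open>base_proj\<close> is the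
  projection to the first factor.
\<close>

definition base_proj :: "('n + nat \<Rightarrow> real) \<Rightarrow> real ^ 'n::finite" where
  "base_proj z = (\<chi> i. z (Inl i))"

definition subanalytic :: "(real ^ 'n::finite) set \<Rightarrow> bool" where
  "subanalytic X \<longleftrightarrow>
     (\<forall>a. \<exists>U m. \<exists>A :: ('n + nat \<Rightarrow> real) set.
        open U \<and> a \<in> U \<and>
        semianalytic (UNIV <+> {..<m}) A \<and>
        compactin (powertop_real (UNIV <+> {..<m})) (powertop_real (UNIV <+> {..<m}) closure_of A) \<and>
        X \<inter> U = base_proj ` A)"

definition tangent_cone :: "'a::real_normed_vector set \<Rightarrow> 'a \<Rightarrow> 'a set" where
  "tangent_cone A x0 =
     {v. \<exists>(x :: nat \<Rightarrow> 'a) (t :: nat \<Rightarrow> real).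
           (\<forall>i. x i \<in> A - {x0}) \<and> x \<longlonglongrightarrow> x0 \<and> (\<forall>i. 0 < t i) \<and>
           (\<lambda>i. (1 / t i) *\<^sub>R (x i - x0)) \<longlonglongrightarrow> v}"

definition bilipschitz_homeo ::
  "'a::real_normed_vector set \<Rightarrow> 'b::real_normed_vector set \<Rightarrow> ('a \<Rightarrow> 'b) \<Rightarrow> bool" where
  "bilipschitz_homeo S T h \<longleftrightarrow>
     bij_betw h S T \<and>
     (\<exists>K>0. \<forall>x\<in>S. \<forall>y\<in>S. (1 / K) * norm (x - y) \<le> norm (h x - h y) \<and>
                           norm (h x - h y) \<le> K * norm (x - y))"

definition germs_bilipschitz_homeomorphic ::
  "'a::real_normed_vector set \<Rightarrow> 'a \<Rightarrow> 'b::real_normed_vector set \<Rightarrow> 'b \<Rightarrow> bool" where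
  "germs_bilipschitz_homeomorphic A a B b \<longleftrightarrow>
     (\<exists>U V h. open U \<and> a \<in> U \<and> open V \<and> b \<in> V \<and>
        bilipschitz_homeo ((A \<inter> U) \<union> {a}) ((B \<inter> V) \<union> {b}) h \<and>
        h a = b \<and> h ` (A \<inter> U) = B \<inter> V)"

end

theory Submission
  imports Defs "HOL-Computational_Algebra.Polynomial"
begin

text \<open>
  Let \<open>h\<close> be the given homeomorphism of germs. The maps \<open>v \<mapsto> k (h (x\<^sub>0 + v / k) - y\<^sub>0)\<close> are
  equi-Lipschitz, and any cluster point of them maps \<open>C(X, x\<^sub>0)\<close> onto \<open>C(Y, y\<^sub>0)\<close> with the same
  constant, provided that each tangent vector \<open>v\<close> of \<open>X\<close> and \<open>Y\<close> is realised at all small scales: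
  the distance from \<open>x\<^sub>0 + t v\<close> to \<open>X\<close> is \<open>o(t)\<close> as \<open>t \<rightarrow> 0\<close>. This is the only place where
  subanalyticity enters.

  Intersecting with a thin cone around \<open>v\<close> and lifting to a semianalytic set, the proviso reduces to
  the following: if a set of sign conditions on analytic functions of \<open>(t, w)\<close> has solutions with
  \<open>t > 0\<close> arbitrarily close to the origin, then it has one for every small \<open>t > 0\<close>. The
  variables \<open>w\<close> are eliminated one at a time. As only the sign for \<open>t > 0\<close> matters, one may divide by
  powers of \<open>t\<close>; after a linear change of \<open>w\<close> the Weierstrass preparation theorem turns all functions
  into polynomials in the last variable, which is then removed by quantifier elimination for real
  polynomials in one variable.
\<close>

section \<open>Convergent power series\<close>

text \<open>The scales are \<open>1 / k\<close> for all \<open>k\<close> because the cluster point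
  is taken once for all tangent vectors: every vector has to be realised along the same scales. The
  definition of the tangent cone only provides each \<open>v\<close> with a sequence of scales of
  its own, and for general sets no more is true. As \<open>h\<close> is defined on \<open>X\<close>
  only, the rescaled map is evaluated at a chosen sequence \<open>\<xi> v\<close> of points of
  \<open>X\<close> with \<open>k (\<xi> v k - x0)\<close> tending to \<open>v\<close>. For
  surjectivity the blow-ups of the inverse are put into the same bounded family, so that both limits
  can be taken along a common subsequence.

  In the reduction the scale \<open>t\<close> becomes one more variable, tied to the point by an
  affine equation, and the thin cone is a strict quadratic inequality; both join the analytic sign
  conditions. The projection then needs no separate treatment, as the variables that are projected
  away are among the eliminated \<open>w\<close>. Each elimination leaves finitely many functions of
  the remaining variables, hence finitely many sign patterns, and one of these recurs arbitrarily
  close to the origin.\<close>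

definition monomial :: "'i set \<Rightarrow> ('i \<Rightarrow> nat) \<Rightarrow> ('i \<Rightarrow> real) \<Rightarrow> real" where
  "monomial I \<alpha> x = (\<Prod>i\<in>I. x i ^ \<alpha> i)"

definition polydisc :: "'i set \<Rightarrow> ('i \<Rightarrow> real) \<Rightarrow> ('i \<Rightarrow> real) set" where
  "polydisc I \<rho> = {x. \<forall>i\<in>I. \<bar>x i\<bar> \<le> \<rho> i}"

text \<open>
  \<open>pexp I \<rho> M f\<close>: on the closed polydisc, \<open>f\<close> is a power series of weighted \<open>\<ell>\<^sup>1\<close>-norm at most \<open>M\<close>.
  The exponents \<open>\<alpha> s\<close> may repeat, so that sums, products and substitutions require no regrouping.
\<close>

definition pexp :: "'i set \<Rightarrow> ('i \<Rightarrow> real) \<Rightarrow> real \<Rightarrow> (('i \<Rightarrow> real) \<Rightarrow> real) \<Rightarrow> bool" where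
  "pexp I \<rho> M f \<longleftrightarrow> (\<forall>i\<in>I. 0 < \<rho> i) \<and>
     (\<exists>c \<alpha>. (\<exists>M'\<le>M. ((\<lambda>s::nat. \<bar>c s\<bar> * monomial I (\<alpha> s) \<rho>) has_sum M') UNIV) \<and>
        (\<forall>x\<in>polydisc I \<rho>. ((\<lambda>s. c s * monomial I (\<alpha> s) x) has_sum f x) UNIV))"

lemma monomial_nonneg: "(\<And>i. i \<in> I \<Longrightarrow> 0 \<le> x i) \<Longrightarrow> 0 \<le> monomial I \<alpha> x"
  by (simp add: monomial_def prod_nonneg)

lemma abs_monomial: "\<bar>monomial I \<alpha> x\<bar> = monomial I \<alpha> (\<lambda>i. \<bar>x i\<bar>)"
  by (simp add: monomial_def abs_prod power_abs)

lemma monomial_mono: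
  "(\<And>i. i \<in> I \<Longrightarrow> 0 \<le> x i) \<Longrightarrow> (\<And>i. i \<in> I \<Longrightarrow> x i \<le> y i) \<Longrightarrow> monomial I \<alpha> x \<le> monomial I \<alpha> y"
  unfolding monomial_def by (intro prod_mono) (auto intro: power_mono)

lemma abs_monomial_le: "x \<in> polydisc I \<rho> \<Longrightarrow> \<bar>monomial I \<alpha> x\<bar> \<le> monomial I \<alpha> \<rho>"
  unfolding abs_monomial by (rule monomial_mono) (auto simp: polydisc_def)

lemma monomial_cong: "(\<And>i. i \<in> I \<Longrightarrow> x i = y i) \<Longrightarrow> monomial I \<alpha> x = monomial I \<alpha> y"
  by (simp add: monomial_def)

lemma monomial_add: "monomial I (\<lambda>i. \<alpha> i + \<beta> i) x = monomial I \<alpha> x * monomial I \<beta> x"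
  by (simp add: monomial_def power_add prod.distrib)

lemma monomial_insert:
  "finite I \<Longrightarrow> i \<notin> I \<Longrightarrow> monomial (insert i I) \<alpha> x = monomial I \<alpha> x * x i ^ \<alpha> i"
  by (simp add: monomial_def mult.commute)

lemma monomial_zero: "monomial I (\<lambda>_. 0) x = 1"
  by (simp add: monomial_def)

text \<open>An arbitrary countable index set is embedded into the naturals by
  \<open>to_nat_on\<close>; naturals outside the image get the coefficient 0. The auxiliary
  \<open>F\<close>, taken as \<open>abs\<close> and as the identity, treats norm and value
  together.\<close>

lemma pexpI_countable:
  fixes c :: "'k \<Rightarrow> real" and \<alpha> :: "'k \<Rightarrow> 'i \<Rightarrow> nat"
  assumes pos: "\<And>i. i \<in> I \<Longrightarrow> 0 < \<rho> i" and A: "countable A"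
    and M: "((\<lambda>s. \<bar>c s\<bar> * monomial I (\<alpha> s) \<rho>) has_sum M') A" and le: "M' \<le> M"
    and f: "\<And>x. x \<in> polydisc I \<rho> \<Longrightarrow> ((\<lambda>s. c s * monomial I (\<alpha> s) x) has_sum f x) A"
  shows "pexp I \<rho> M f"
proof -
  let ?h = "to_nat_on A"
  let ?g = "inv_into A ?h"
  have inj: "inj_on ?h A" using A by (rule inj_on_to_nat_on)
  define c' where "c' = (\<lambda>n. if n \<in> ?h ` A then c (?g n) else 0)"
  define \<alpha>' where "\<alpha>' = (\<lambda>n. \<alpha> (?g n))"
  have *: "((\<lambda>n. F (c' n) * monomial I (\<alpha>' n) x) has_sum S) UNIV \<longleftrightarrow>
        ((\<lambda>s. F (c s) * monomial I (\<alpha> s) x) has_sum S) A" if "F 0 = 0" for F :: "real \<Rightarrow> real" and x S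
  proof -
    have "((\<lambda>n. F (c' n) * monomial I (\<alpha>' n) x) has_sum S) UNIV \<longleftrightarrow>
       ((\<lambda>n. F (c' n) * monomial I (\<alpha>' n) x) has_sum S) (?h ` A)"
      by (rule has_sum_cong_neutral) (auto simp: c'_def that)
    also have "\<dots> \<longleftrightarrow> ((\<lambda>s. F (c s) * monomial I (\<alpha> s) x) has_sum S) A"
      by (subst has_sum_reindex[OF inj], rule has_sum_cong)
         (auto simp: c'_def \<alpha>'_def inv_into_f_f[OF inj])
    finally show ?thesis .
  qed
  have "((\<lambda>n. \<bar>c' n\<bar> * monomial I (\<alpha>' n) \<rho>) has_sum M') UNIV"
    using M *[of abs] by simp
  moreover have "((\<lambda>n. c' n * monomial I (\<alpha>' n) x) has_sum f x) UNIV" if "x \<in> polydisc I \<rho>" for x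
    using f[OF that] *[of "\<lambda>x. x"] by simp
  ultimately show ?thesis unfolding pexp_def using pos le by blast
qed

lemma pexp_pos: "pexp I \<rho> M f \<Longrightarrow> i \<in> I \<Longrightarrow> 0 < \<rho> i"
  by (simp add: pexp_def)

lemma pexpE:
  assumes "pexp I \<rho> M f"
  obtains c \<alpha> M' where "M' \<le> M" "((\<lambda>s::nat. \<bar>c s\<bar> * monomial I (\<alpha> s) \<rho>) has_sum M') UNIV"
    "\<And>x. x \<in> polydisc I \<rho> \<Longrightarrow> ((\<lambda>s. c s * monomial I (\<alpha> s) x) has_sum f x) UNIV"
  using assms by (auto simp: pexp_def)

lemma pexp_mono: "pexp I \<rho> M f \<Longrightarrow> M \<le> N \<Longrightarrow> pexp I \<rho> N f"
  unfolding pexp_def by (meson order_trans)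

lemma has_sum_abs_le:
  fixes f g :: "'a \<Rightarrow> real"
  assumes "(f has_sum a) A" "(g has_sum b) A" "\<And>x. x \<in> A \<Longrightarrow> \<bar>f x\<bar> \<le> g x"
  shows "\<bar>a\<bar> \<le> b"
proof -
  have "a \<le> b" by (rule has_sum_mono[OF assms(1,2)]) (use assms(3) in force)
  moreover have "- a \<le> b"
    by (rule has_sum_mono[OF _ assms(2), of "\<lambda>x. - f x"])
       (use assms(1,3) in \<open>force simp: has_sum_uminus\<close>)+
  ultimately show ?thesis by simp
qed

lemma pexp_bound:
  assumes "pexp I \<rho> M f" "x \<in> polydisc I \<rho>" shows "\<bar>f x\<bar> \<le> M"
proof -
  obtain c \<alpha> M' where *: "M' \<le> M" "((\<lambda>s::nat. \<bar>c s\<bar> * monomial I (\<alpha> s) \<rho>) has_sum M') UNIV"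
    "\<And>x. x \<in> polydisc I \<rho> \<Longrightarrow> ((\<lambda>s. c s * monomial I (\<alpha> s) x) has_sum f x) UNIV"
    using assms(1) by (rule pexpE) blast
  have "\<bar>f x\<bar> \<le> M'"
    by (rule has_sum_abs_le[OF *(3)[OF assms(2)] *(2)])
       (use abs_monomial_le[OF assms(2)] in \<open>auto simp: abs_mult intro!: mult_left_mono\<close>)
  with * show ?thesis by simp
qed

text \<open>Points are functions on the whole index type, but only coordinates in \<open>I\<close>
  enter the monomials. This is used whenever a coordinate is overwritten after its variable has been
  eliminated.\<close>

lemma pexp_dep:
  assumes "pexp I \<rho> M f" "x \<in> polydisc I \<rho>" "\<And>i. i \<in> I \<Longrightarrow> x i = y i"
  shows "f x = f y"
proof -
  obtain c \<alpha> M' where *: "\<And>x. x \<in> polydisc I \<rho> \<Longrightarrow> ((\<lambda>s::nat. c s * monomial I (\<alpha> s) x) has_sum f x) UNIV"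
    using assms(1) by (rule pexpE) blast
  have "y \<in> polydisc I \<rho>" using assms(2,3) by (simp add: polydisc_def)
  moreover have "monomial I (\<alpha> s) x = monomial I (\<alpha> s) y" for s
    by (rule monomial_cong) (rule assms)
  ultimately show ?thesis using *[OF assms(2)] *[of y] has_sum_unique by fastforce
qed

lemma pexp_shrink:
  assumes "pexp I \<rho> M f" "\<And>i. i \<in> I \<Longrightarrow> 0 < \<rho>' i" "\<And>i. i \<in> I \<Longrightarrow> \<rho>' i \<le> \<rho> i"
  shows "pexp I \<rho>' M f"
proof -
  obtain c \<alpha> M' where *: "M' \<le> M" "((\<lambda>s::nat. \<bar>c s\<bar> * monomial I (\<alpha> s) \<rho>) has_sum M') UNIV"
    "\<And>x. x \<in> polydisc I \<rho> \<Longrightarrow> ((\<lambda>s. c s * monomial I (\<alpha> s) x) has_sum f x) UNIV"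
    using assms(1) by (rule pexpE) blast
  have le: "\<bar>c s\<bar> * monomial I (\<alpha> s) \<rho>' \<le> \<bar>c s\<bar> * monomial I (\<alpha> s) \<rho>" for s
    using assms(2,3) by (intro mult_left_mono monomial_mono) (auto intro: less_imp_le)
  have nn: "0 \<le> \<bar>c s\<bar> * monomial I (\<alpha> s) \<rho>'" for s
    using assms(2) by (intro mult_nonneg_nonneg monomial_nonneg) (auto intro: less_imp_le)
  have "(\<lambda>s. \<bar>c s\<bar> * monomial I (\<alpha> s) \<rho>') summable_on UNIV"
    by (rule summable_on_comparison_test[OF has_sum_imp_summable[OF *(2)]]) (use le nn in auto)
  then obtain M'' where M'': "((\<lambda>s. \<bar>c s\<bar> * monomial I (\<alpha> s) \<rho>') has_sum M'') UNIV"
    by (auto simp: summable_on_def)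
  have "M'' \<le> M'" by (rule has_sum_mono[OF M'' *(2)]) (use le in auto)
  have sub: "polydisc I \<rho>' \<subseteq> polydisc I \<rho>"
    using assms(3) by (fastforce simp: polydisc_def)
  show ?thesis
    by (rule pexpI_countable[OF assms(2) _ M'']) (use \<open>M'' \<le> M'\<close> *(1,3) sub in auto)
qed

lemma pexp_const:
  assumes "\<And>i. i \<in> I \<Longrightarrow> 0 < \<rho> i" shows "pexp I \<rho> \<bar>a\<bar> (\<lambda>_. a)"
  by (rule pexpI_countable[where A="{()}" and c="\<lambda>_. a" and \<alpha>="\<lambda>_ _. 0" and M'="\<bar>a\<bar>"])
     (auto simp: assms monomial_zero intro!: has_sum_finiteI)

lemma pexp_var:
  assumes "\<And>i. i \<in> I \<Longrightarrow> 0 < \<rho> i" "i \<in> I" "finite I"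
  shows "pexp I \<rho> (\<rho> i) (\<lambda>x. x i)"
proof -
  have "monomial I (\<lambda>j. if j = i then 1 else 0) x = x i" for x
    using assms(2,3) by (simp add: monomial_def if_distrib[of "\<lambda>n. x _ ^ n"] prod.delta' cong: if_cong)
  then show ?thesis
    by (intro pexpI_countable[where A="{()}" and c="\<lambda>_. 1" and \<alpha>="\<lambda>_ j. if j = i then 1 else 0" and M'="\<rho> i"])
       (auto simp: assms intro!: has_sum_finiteI)
qed

text \<open>Most closure properties below rest on this. Expanding each \<open>f k\<close> gives a
  family indexed by pairs \<open>(k, s)\<close>; it is absolutely summable because the norms of the
  \<open>f k\<close> are dominated by the summable \<open>M\<close>, so the order of summation is
  immaterial.\<close>

lemma pexp_has_sum:
  fixes f :: "'k \<Rightarrow> ('i \<Rightarrow> real) \<Rightarrow> real"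
  assumes pos: "\<And>i. i \<in> I \<Longrightarrow> 0 < \<rho> i" and A: "countable A"
    and f: "\<And>k. k \<in> A \<Longrightarrow> pexp I \<rho> (M k) (f k)" and M: "(M has_sum S) A"
    and F: "\<And>x. x \<in> polydisc I \<rho> \<Longrightarrow> ((\<lambda>k. f k x) has_sum F x) A"
  shows "pexp I \<rho> S F"
proof -
  have "\<forall>k\<in>A. \<exists>c \<alpha> M'. M' \<le> M k \<and> ((\<lambda>s::nat. \<bar>c s\<bar> * monomial I (\<alpha> s) \<rho>) has_sum M') UNIV \<and>
    (\<forall>x\<in>polydisc I \<rho>. ((\<lambda>s. c s * monomial I (\<alpha> s) x) has_sum f k x) UNIV)"
    using f unfolding pexp_def by blast
  from bchoice[OF this] obtain c where "\<forall>k\<in>A. \<exists>\<alpha> M'. M' \<le> M k \<and>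
      ((\<lambda>s::nat. \<bar>c k s\<bar> * monomial I (\<alpha> s) \<rho>) has_sum M') UNIV \<and>
    (\<forall>x\<in>polydisc I \<rho>. ((\<lambda>s. c k s * monomial I (\<alpha> s) x) has_sum f k x) UNIV)" ..
  from bchoice[OF this] obtain \<alpha> where "\<forall>k\<in>A. \<exists>M'. M' \<le> M k \<and>
      ((\<lambda>s::nat. \<bar>c k s\<bar> * monomial I (\<alpha> k s) \<rho>) has_sum M') UNIV \<and>
    (\<forall>x\<in>polydisc I \<rho>. ((\<lambda>s. c k s * monomial I (\<alpha> k s) x) has_sum f k x) UNIV)" ..
  from bchoice[OF this] obtain M' where le: "\<And>k. k \<in> A \<Longrightarrow> M' k \<le> M k"
    and M': "\<And>k. k \<in> A \<Longrightarrow> ((\<lambda>s::nat. \<bar>c k s\<bar> * monomial I (\<alpha> k s) \<rho>) has_sum M' k) UNIV"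
    and fx: "\<And>k x. k \<in> A \<Longrightarrow> x \<in> polydisc I \<rho> \<Longrightarrow> ((\<lambda>s. c k s * monomial I (\<alpha> k s) x) has_sum f k x) UNIV"
    by auto
  have mnn: "0 \<le> monomial I \<beta> \<rho>" for \<beta> using pos by (intro monomial_nonneg) (auto intro: less_imp_le)
  have M'nn: "0 \<le> M' k" if "k \<in> A" for k
    by (rule has_sum_nonneg[OF M'[OF that]]) (use mnn in auto)
  have "M' summable_on A"
    by (rule summable_on_comparison_test[OF has_sum_imp_summable[OF M]]) (use le M'nn in auto)
  then obtain S' where S': "(M' has_sum S') A" by (auto simp: summable_on_def)
  have "S' \<le> S" by (rule has_sum_mono[OF S' M le])
  have sm: "(\<lambda>(k,s). \<bar>c k s\<bar> * monomial I (\<alpha> k s) \<rho>) summable_on (Sigma A (\<lambda>_. UNIV))"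
    by (rule summable_on_SigmaI[where g = M']) (use M' \<open>M' summable_on A\<close> mnn in auto)
  have 1: "((\<lambda>(k,s). \<bar>c k s\<bar> * monomial I (\<alpha> k s) \<rho>) has_sum S') (Sigma A (\<lambda>_. UNIV))"
    by (rule has_sum_SigmaI[where g = M']) (use M' S' sm in auto)
  have 2: "((\<lambda>(k,s). c k s * monomial I (\<alpha> k s) x) has_sum F x) (Sigma A (\<lambda>_. UNIV))"
    if x: "x \<in> polydisc I \<rho>" for x
  proof (rule has_sum_SigmaI[where g = "\<lambda>k. f k x"])
    have "(\<lambda>ks. norm ((\<lambda>(k,s). c k s * monomial I (\<alpha> k s) x) ks)) summable_on (Sigma A (\<lambda>_. UNIV))"
      by (rule Infinite_Sum.abs_summable_on_comparison_test'[OF sm])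
         (use abs_monomial_le[OF x] in \<open>auto simp: abs_mult intro!: mult_left_mono\<close>)
    then show "(\<lambda>(k,s). c k s * monomial I (\<alpha> k s) x) summable_on (Sigma A (\<lambda>_. UNIV))"
      by (rule Infinite_Sum.abs_summable_summable)
  qed (use fx F x in auto)
  show ?thesis
  proof (rule pexpI_countable[OF pos, where A = "Sigma A (\<lambda>_. UNIV :: nat set)" and c = "\<lambda>(k,s). c k s"
          and \<alpha> = "\<lambda>(k,s). \<alpha> k s" and M' = S'])
    show "((\<lambda>ks. \<bar>case ks of (k, s) \<Rightarrow> c k s\<bar> * monomial I (case ks of (k, s) \<Rightarrow> \<alpha> k s) \<rho>)
        has_sum S') (Sigma A (\<lambda>_. UNIV))"
      using 1 by (simp add: case_prod_unfold)
    show "((\<lambda>ks. (case ks of (k, s) \<Rightarrow> c k s) * monomial I (case ks of (k, s) \<Rightarrow> \<alpha> k s) x)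
        has_sum F x) (Sigma A (\<lambda>_. UNIV))" if "x \<in> polydisc I \<rho>" for x
      using 2[OF that] by (simp add: case_prod_unfold)
    show "countable (Sigma A (\<lambda>_. UNIV :: nat set))" by (rule countable_SIGMA[OF A]) simp
    show "S' \<le> S" by fact
  qed
qed

lemma pexp_sum:
  assumes "finite A" "\<And>k. k \<in> A \<Longrightarrow> pexp I \<rho> (M k) (f k)" "\<And>i. i \<in> I \<Longrightarrow> 0 < \<rho> i"
  shows "pexp I \<rho> (sum M A) (\<lambda>x. \<Sum>k\<in>A. f k x)"
  by (rule pexp_has_sum[OF assms(3) countable_finite[OF assms(1)] assms(2) has_sum_finite has_sum_finite])
     (use assms(1) in auto)

lemma pexp_add:
  assumes "pexp I \<rho> M f" "pexp I \<rho> N g"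
  shows "pexp I \<rho> (M + N) (\<lambda>x. f x + g x)"
proof -
  have "pexp I \<rho> (\<Sum>b\<in>UNIV. if b then M else N) (\<lambda>x. \<Sum>b\<in>UNIV. (if b then f else g) x)"
    by (rule pexp_sum) (use assms pexp_pos in auto)
  then show ?thesis by (simp add: UNIV_bool add.commute)
qed

lemma pexp_nonneg: assumes "pexp I \<rho> M f" shows "0 \<le> M"
proof -
  have "(\<lambda>_. 0) \<in> polydisc I \<rho>" using pexp_pos[OF assms] by (force simp: polydisc_def)
  from pexp_bound[OF assms this] show ?thesis by simp
qed

text \<open>The weighted norm is submultiplicative: multiplying \<open>g\<close> by a single term of
  \<open>f\<close> scales its norm by the weight of that term, and these products are summed over
  the terms.\<close>

lemma pexp_mult:
  assumes f: "pexp I \<rho> M f" and g: "pexp I \<rho> N g"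
  shows "pexp I \<rho> (M * N) (\<lambda>x. f x * g x)"
proof -
  obtain c \<alpha> M' where 1: "M' \<le> M" "((\<lambda>s::nat. \<bar>c s\<bar> * monomial I (\<alpha> s) \<rho>) has_sum M') UNIV"
    "\<And>x. x \<in> polydisc I \<rho> \<Longrightarrow> ((\<lambda>s. c s * monomial I (\<alpha> s) x) has_sum f x) UNIV"
    using f by (rule pexpE) blast
  have pos: "\<And>i. i \<in> I \<Longrightarrow> 0 < \<rho> i" using f by (rule pexp_pos)
  have N0: "0 \<le> N" using g by (rule pexp_nonneg)
  have *: "pexp I \<rho> (\<bar>c s\<bar> * monomial I (\<alpha> s) \<rho> * N) (\<lambda>x. c s * monomial I (\<alpha> s) x * g x)" for s
  proof -
    obtain d \<beta> N' where 2: "N' \<le> N" "((\<lambda>s::nat. \<bar>d s\<bar> * monomial I (\<beta> s) \<rho>) has_sum N') UNIV"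
      "\<And>x. x \<in> polydisc I \<rho> \<Longrightarrow> ((\<lambda>s. d s * monomial I (\<beta> s) x) has_sum g x) UNIV"
      using g by (rule pexpE) blast
    have mnn: "0 \<le> \<bar>c s\<bar> * monomial I (\<alpha> s) \<rho>"
      using pos by (intro mult_nonneg_nonneg monomial_nonneg) (auto intro: less_imp_le)
    show ?thesis
    proof (rule pexpI_countable[where A = UNIV and c = "\<lambda>r. c s * d r" and \<alpha> = "\<lambda>r i. \<alpha> s i + \<beta> r i"])
      show "((\<lambda>r. \<bar>c s * d r\<bar> * monomial I (\<lambda>i. \<alpha> s i + \<beta> r i) \<rho>) has_sum \<bar>c s\<bar> * monomial I (\<alpha> s) \<rho> * N') UNIV"
        using has_sum_cmult_right[OF 2(2), of "\<bar>c s\<bar> * monomial I (\<alpha> s) \<rho>"]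
        by (simp add: monomial_add abs_mult mult_ac)
      show "\<bar>c s\<bar> * monomial I (\<alpha> s) \<rho> * N' \<le> \<bar>c s\<bar> * monomial I (\<alpha> s) \<rho> * N"
        using 2(1) mnn by (rule mult_left_mono)
      show "((\<lambda>r. c s * d r * monomial I (\<lambda>i. \<alpha> s i + \<beta> r i) x) has_sum c s * monomial I (\<alpha> s) x * g x) UNIV"
        if "x \<in> polydisc I \<rho>" for x
        using has_sum_cmult_right[OF 2(3)[OF that], of "c s * monomial I (\<alpha> s) x"]
        by (simp add: monomial_add mult_ac)
    qed (use pos in auto)
  qed
  have "pexp I \<rho> (M' * N) (\<lambda>x. f x * g x)"
    by (rule pexp_has_sum[where A = UNIV and f = "\<lambda>s x. c s * monomial I (\<alpha> s) x * g x", OF pos _ *])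
       (use 1 in \<open>auto intro!: has_sum_cmult_left\<close>)
  then show ?thesis by (rule pexp_mono) (use 1(1) N0 in \<open>auto intro: mult_right_mono\<close>)
qed

lemma pexp_cmult: "pexp I \<rho> M f \<Longrightarrow> pexp I \<rho> (\<bar>a\<bar> * M) (\<lambda>x. a * f x)"
  by (rule pexp_mult[OF pexp_const]) (rule pexp_pos)

lemma pexp_uminus: "pexp I \<rho> M f \<Longrightarrow> pexp I \<rho> M (\<lambda>x. - f x)"
  using pexp_cmult[of I \<rho> M f "-1"] by simp

lemma pexp_diff: "pexp I \<rho> M f \<Longrightarrow> pexp I \<rho> N g \<Longrightarrow> pexp I \<rho> (M + N) (\<lambda>x. f x - g x)"
  using pexp_add[OF _ pexp_uminus, of I \<rho> M f N g] by simp

lemma pexp_prod: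
  assumes "finite A" "\<And>k. k \<in> A \<Longrightarrow> pexp I \<rho> (M k) (f k)" "\<And>i. i \<in> I \<Longrightarrow> 0 < \<rho> i"
  shows "pexp I \<rho> (prod M A) (\<lambda>x. \<Prod>k\<in>A. f k x)"
  using assms(1,2)
proof (induction A)
  case empty
  then show ?case using pexp_const[OF assms(3), where a = 1] by simp
next
  case (insert k A)
  then show ?case using pexp_mult[of I \<rho> "M k" "f k" "prod M A"] by simp
qed

lemma pexp_power: "pexp I \<rho> M f \<Longrightarrow> pexp I \<rho> (M ^ k) (\<lambda>x. f x ^ k)"
  using pexp_prod[of "{..<k}" I \<rho> "\<lambda>_. M" "\<lambda>_. f"] by (simp add: pexp_pos)

text \<open>In a monomial of \<open>f\<close> each factor \<open>x i\<close> is replaced by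
  \<open>g i\<close>, of norm at most \<open>\<sigma> i\<close>, so the norm of the result is at
  most the weight of the monomial on the polydisc of \<open>\<sigma>\<close>.\<close>

lemma pexp_compose:
  assumes f: "pexp I \<sigma> M f" and fin: "finite I" and pos: "\<And>j. j \<in> J \<Longrightarrow> 0 < \<rho> j"
    and g: "\<And>i. i \<in> I \<Longrightarrow> pexp J \<rho> (\<sigma> i) (g i)"
  shows "pexp J \<rho> M (\<lambda>x. f (\<lambda>i. g i x))"
proof -
  obtain c \<alpha> M' where 1: "M' \<le> M" "((\<lambda>s::nat. \<bar>c s\<bar> * monomial I (\<alpha> s) \<sigma>) has_sum M') UNIV"
    "\<And>x. x \<in> polydisc I \<sigma> \<Longrightarrow> ((\<lambda>s. c s * monomial I (\<alpha> s) x) has_sum f x) UNIV"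
    using f by (rule pexpE) blast
  have *: "pexp J \<rho> (\<bar>c s\<bar> * monomial I (\<alpha> s) \<sigma>) (\<lambda>x. c s * monomial I (\<alpha> s) (\<lambda>i. g i x))" for s
    unfolding monomial_def by (intro pexp_cmult pexp_prod pexp_power fin g pos)
  have in_pd: "(\<lambda>i. g i x) \<in> polydisc I \<sigma>" if "x \<in> polydisc J \<rho>" for x
    using pexp_bound[OF g that] by (auto simp: polydisc_def)
  have "pexp J \<rho> M' (\<lambda>x. f (\<lambda>i. g i x))"
    by (rule pexp_has_sum[OF pos _ * 1(2)]) (use 1 in_pd in auto)
  then show ?thesis using 1(1) by (rule pexp_mono)
qed

lemma pexp_superset:
  assumes "pexp I \<rho> M f" "finite J" "I \<subseteq> J" "\<And>j. j \<in> J \<Longrightarrow> 0 < \<rho> j"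
  shows "pexp J \<rho> M f"
  by (rule pexp_compose[OF assms(1), of J \<rho> "\<lambda>i x. x i", OF finite_subset[OF assms(3,2)] assms(4)])
     (use assms(2,3,4) in \<open>auto intro!: pexp_var\<close>)

section \<open>Expansion in powers of one variable\<close>

lemma has_sum_fibers:
  fixes f :: "'a \<Rightarrow> real"
  assumes f: "(f has_sum S) UNIV" and g: "\<And>j. (f has_sum g j) {s. h s = j}"
  shows "(g has_sum S) UNIV"
proof -
  have bij: "bij_betw snd (Sigma UNIV (\<lambda>j. {s. h s = j})) UNIV"
    by (rule bij_betwI[where g = "\<lambda>s. (h s, s)"]) auto
  have "((\<lambda>p. f (snd p)) has_sum S) (Sigma UNIV (\<lambda>j. {s. h s = j}))"
    using f by (subst has_sum_reindex_bij_betw[OF bij])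
  then show ?thesis by (rule has_sum_Sigma') (use g in simp)
qed

lemma has_sum_shift:
  fixes f :: "nat \<Rightarrow> real"
  assumes "(f has_sum S) UNIV"
  shows "((\<lambda>j. f (j + e)) has_sum (S - (\<Sum>j<e. f j))) UNIV"
proof -
  have "(f has_sum (S - (\<Sum>j<e. f j))) (UNIV - {..<e})"
    by (rule has_sum_Diff[OF assms]) (auto intro: has_sum_finite)
  moreover have "UNIV - {..<e} = (\<lambda>j. j + e) ` UNIV"
    by (auto simp: image_iff) (metis le_add_diff_inverse2 not_less)
  ultimately have "(f has_sum (S - (\<Sum>j<e. f j))) ((\<lambda>j. j + e) ` UNIV)" by simp
  then show ?thesis by (subst (asm) has_sum_reindex) (auto simp: inj_on_def comp_def)
qed

lemma pexp_summable:
  assumes "\<And>k. k \<in> A \<Longrightarrow> pexp I \<rho> (M k) (f k)" "M summable_on A" "x \<in> polydisc I \<rho>"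
  shows "(\<lambda>k. f k x) summable_on A"
proof (rule Infinite_Sum.abs_summable_summable, rule Infinite_Sum.abs_summable_on_comparison_test'[OF assms(2)])
  show "norm (f k x) \<le> M k" if "k \<in> A" for k
    using pexp_bound[OF assms(1)[OF that] assms(3)] by simp
qed

text \<open>Terms are collected by their exponent at \<open>i\<close>. A fibre stays summable when
  the factor \<open>\<rho> i ^ j\<close> is removed, since that factor is positive and constant on
  the fibre.\<close>

lemma pexp_split:
  assumes f: "pexp (insert i I) \<rho> M f" and I: "finite I" "i \<notin> I"
  obtains a N S where "\<And>j. pexp I \<rho> (N j) (a j)" "((\<lambda>j. N j * \<rho> i ^ j) has_sum S) UNIV" "S \<le> M"
    "\<And>x. x \<in> polydisc (insert i I) \<rho> \<Longrightarrow> ((\<lambda>j. a j x * x i ^ j) has_sum f x) UNIV"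
proof -
  obtain c \<alpha> S where 1: "S \<le> M" "((\<lambda>s::nat. \<bar>c s\<bar> * monomial (insert i I) (\<alpha> s) \<rho>) has_sum S) UNIV"
    "\<And>x. x \<in> polydisc (insert i I) \<rho> \<Longrightarrow> ((\<lambda>s. c s * monomial (insert i I) (\<alpha> s) x) has_sum f x) UNIV"
    using f by (rule pexpE) blast
  have pos: "\<And>j. j \<in> I \<Longrightarrow> 0 < \<rho> j" "0 < \<rho> i" using pexp_pos[OF f] by auto
  define B where "B = (\<lambda>j. {s. \<alpha> s i = j})"
  define N where "N = (\<lambda>j. infsum (\<lambda>s. \<bar>c s\<bar> * monomial I (\<alpha> s) \<rho>) (B j))"
  define a where "a = (\<lambda>j x. infsum (\<lambda>s. c s * monomial I (\<alpha> s) x) (B j))"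
  have mon: "monomial (insert i I) (\<alpha> s) x = monomial I (\<alpha> s) x * x i ^ j" if "s \<in> B j" for s x j
    using that by (simp add: B_def monomial_insert[OF I])
  have sumN: "(\<lambda>s. \<bar>c s\<bar> * monomial I (\<alpha> s) \<rho>) summable_on B j" for j
  proof -
    have "(\<lambda>s. \<bar>c s\<bar> * monomial (insert i I) (\<alpha> s) \<rho>) summable_on B j"
      by (rule summable_on_subset[OF has_sum_imp_summable[OF 1(2)]]) simp
    then have "(\<lambda>s. \<bar>c s\<bar> * monomial I (\<alpha> s) \<rho> * \<rho> i ^ j) summable_on B j"
      by (rule summable_on_cong[THEN iffD1, rotated]) (simp add: mon)
    then show ?thesis using pos(2) by (subst (asm) summable_on_cmult_left') auto
  qed
  have hN: "((\<lambda>s. \<bar>c s\<bar> * monomial I (\<alpha> s) \<rho>) has_sum N j) (B j)" for j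
    unfolding N_def by (rule has_sum_infsum[OF sumN])
  have ha: "((\<lambda>s. c s * monomial I (\<alpha> s) x) has_sum a j x) (B j)" if "x \<in> polydisc I \<rho>" for j x
    unfolding a_def
  proof (rule has_sum_infsum, rule Infinite_Sum.abs_summable_summable,
      rule Infinite_Sum.abs_summable_on_comparison_test'[OF sumN])
    show "norm (c s * monomial I (\<alpha> s) x) \<le> \<bar>c s\<bar> * monomial I (\<alpha> s) \<rho>" for s
      using abs_monomial_le[OF that] by (simp add: abs_mult mult_left_mono)
  qed
  show thesis
  proof (rule that)
    show "pexp I \<rho> (N j) (a j)" for j
      by (rule pexpI_countable[OF pos(1) _ hN order_refl ha]) auto
    show "((\<lambda>j. N j * \<rho> i ^ j) has_sum S) UNIV"
    proof (rule has_sum_fibers[OF 1(2), where h = "\<lambda>s. \<alpha> s i"])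
      show "((\<lambda>s. \<bar>c s\<bar> * monomial (insert i I) (\<alpha> s) \<rho>) has_sum N j * \<rho> i ^ j) {s. \<alpha> s i = j}" for j
        using has_sum_cmult_left[OF hN[of j], of "\<rho> i ^ j"]
        by (subst has_sum_cong[where g = "\<lambda>s. \<bar>c s\<bar> * monomial I (\<alpha> s) \<rho> * \<rho> i ^ j"])
           (auto simp: mon B_def)
    qed
    show "S \<le> M" by fact
    show "((\<lambda>j. a j x * x i ^ j) has_sum f x) UNIV" if x: "x \<in> polydisc (insert i I) \<rho>" for x
    proof (rule has_sum_fibers[OF 1(3)[OF x], where h = "\<lambda>s. \<alpha> s i"])
      have "x \<in> polydisc I \<rho>" using x by (simp add: polydisc_def)
      then show "((\<lambda>s. c s * monomial (insert i I) (\<alpha> s) x) has_sum a j x * x i ^ j) {s. \<alpha> s i = j}" for j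
        using has_sum_cmult_left[OF ha[of x j], of "x i ^ j"]
        by (subst has_sum_cong[where g = "\<lambda>s. c s * monomial I (\<alpha> s) x * x i ^ j"])
           (auto simp: mon B_def)
    qed
  qed
qed

lemma pexp_unsplit:
  assumes a: "\<And>j. pexp I \<rho> (N j) (a j)" and S: "((\<lambda>j. N j * \<rho> i ^ j) has_sum S) UNIV"
    and I: "finite I" and pos: "0 < \<rho> i"
    and f: "\<And>x. x \<in> polydisc (insert i I) \<rho> \<Longrightarrow> ((\<lambda>j::nat. a j x * x i ^ j) has_sum f x) UNIV"
  shows "pexp (insert i I) \<rho> S f"
proof (rule pexp_has_sum[OF _ _ _ S f])
  have *: "0 < \<rho> j" if "j \<in> insert i I" for j using that pos pexp_pos[OF a] by auto
  then show "0 < \<rho> j" if "j \<in> insert i I" for j using that .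
  show "pexp (insert i I) \<rho> (N j * \<rho> i ^ j) (\<lambda>x. a j x * x i ^ j)" for j
    by (intro pexp_mult pexp_power pexp_var pexp_superset[OF a] *) (use I in auto)
qed auto

lemma monomial_const_or_scale:
  assumes "finite I" "0 < l" "l \<le> 1" "\<And>i. i \<in> I \<Longrightarrow> 0 < \<rho> i" "\<exists>i\<in>I. \<alpha> i \<noteq> 0"
  shows "monomial I \<alpha> (\<lambda>i. l * \<rho> i) \<le> l * monomial I \<alpha> \<rho>"
proof -
  have "monomial I \<alpha> (\<lambda>i. l * \<rho> i) = l ^ (\<Sum>i\<in>I. \<alpha> i) * monomial I \<alpha> \<rho>"
    by (simp add: monomial_def power_mult_distrib prod.distrib power_sum)
  moreover have "l ^ (\<Sum>i\<in>I. \<alpha> i) \<le> l ^ 1"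
  proof (rule power_decreasing)
    show "1 \<le> (\<Sum>i\<in>I. \<alpha> i)" using assms(1,5) by (metis One_nat_def Suc_leI sum_eq_0_iff gr0I)
  qed (use assms in auto)
  moreover have "0 \<le> monomial I \<alpha> \<rho>"
    using assms(4) by (intro monomial_nonneg) (auto intro: less_imp_le)
  ultimately show ?thesis by (simp add: mult_right_mono)
qed

text \<open>The terms with zero exponent vector add up to the value 0 at the origin and may be
  dropped; every other monomial gains at least one factor \<open>l\<close>. This makes the lower
  coefficients small in the preparation theorem.\<close>

lemma pexp_scale:
  assumes f: "pexp I \<rho> M f" and I: "finite I" and f0: "f (\<lambda>_. 0) = 0" and l: "0 < l" "l \<le> 1"
  shows "pexp I (\<lambda>i. l * \<rho> i) (l * M) f"
proof -
  obtain c \<alpha> S where 1: "S \<le> M" "((\<lambda>s::nat. \<bar>c s\<bar> * monomial I (\<alpha> s) \<rho>) has_sum S) UNIV"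
    "\<And>x. x \<in> polydisc I \<rho> \<Longrightarrow> ((\<lambda>s. c s * monomial I (\<alpha> s) x) has_sum f x) UNIV"
    using f by (rule pexpE) blast
  have pos: "\<And>i. i \<in> I \<Longrightarrow> 0 < \<rho> i" using f by (rule pexp_pos)
  have z: "(\<lambda>_. 0) \<in> polydisc I \<rho>" using pos by (force simp: polydisc_def)
  define d where "d = (\<lambda>s. if \<exists>i\<in>I. \<alpha> s i \<noteq> 0 then c s else 0)"
  have d: "d s * monomial I (\<alpha> s) x = c s * monomial I (\<alpha> s) x - c s * monomial I (\<alpha> s) (\<lambda>_. 0)" for s x
    using I by (auto simp: d_def monomial_def)
  have mnn: "0 \<le> monomial I (\<alpha> s) \<rho>" "0 \<le> monomial I (\<alpha> s) (\<lambda>i. l * \<rho> i)" for s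
    by (rule monomial_nonneg, use pos l in \<open>simp add: less_imp_le\<close>)+
  have le: "\<bar>d s\<bar> * monomial I (\<alpha> s) (\<lambda>i. l * \<rho> i) \<le> l * (\<bar>c s\<bar> * monomial I (\<alpha> s) \<rho>)" for s
  proof (cases "\<exists>i\<in>I. \<alpha> s i \<noteq> 0")
    case True
    have "monomial I (\<alpha> s) (\<lambda>i. l * \<rho> i) \<le> l * monomial I (\<alpha> s) \<rho>"
      by (rule monomial_const_or_scale[OF I l pos True])
    then have "\<bar>c s\<bar> * monomial I (\<alpha> s) (\<lambda>i. l * \<rho> i) \<le> \<bar>c s\<bar> * (l * monomial I (\<alpha> s) \<rho>)"
      by (rule mult_left_mono) simp
    then show ?thesis using True by (simp add: d_def mult.left_commute)
  next
    case False
    then show ?thesis using mnn[of s] l by (simp add: d_def)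
  qed
  have hs: "((\<lambda>s. l * (\<bar>c s\<bar> * monomial I (\<alpha> s) \<rho>)) has_sum l * S) UNIV"
    by (rule has_sum_cmult_right[OF 1(2)])
  have "(\<lambda>s. \<bar>d s\<bar> * monomial I (\<alpha> s) (\<lambda>i. l * \<rho> i)) summable_on UNIV"
    by (rule summable_on_comparison_test[OF has_sum_imp_summable[OF hs]]) (use le mnn in auto)
  then obtain T where T: "((\<lambda>s. \<bar>d s\<bar> * monomial I (\<alpha> s) (\<lambda>i. l * \<rho> i)) has_sum T) UNIV"
    by (auto simp: summable_on_def)
  have "T \<le> l * S" by (rule has_sum_mono[OF T hs]) (use le in auto)
  also have "\<dots> \<le> l * M" using 1(1) l by simp
  finally have TM: "T \<le> l * M" .
  show ?thesis
  proof (rule pexpI_countable[OF _ _ T TM])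
    fix x assume "x \<in> polydisc I (\<lambda>i. l * \<rho> i)"
    moreover have "l * \<rho> i \<le> \<rho> i" if "i \<in> I" for i
      using mult_right_mono[OF l(2), of "\<rho> i"] pos[OF that] by simp
    ultimately have x: "x \<in> polydisc I \<rho>"
      by (fastforce simp: polydisc_def)
    show "((\<lambda>s. d s * monomial I (\<alpha> s) x) has_sum f x) UNIV"
      using has_sum_add[OF 1(3)[OF x] has_sum_uminusI[OF 1(3)[OF z]]] f0 by (simp add: d)
  qed (use pos l in auto)
qed

section \<open>Signs and zeros of power series near the origin\<close>

lemma power_series_sgn:
  fixes a :: "nat \<Rightarrow> real"
  assumes r: "0 < r" and F: "\<And>u. \<bar>u\<bar> \<le> r \<Longrightarrow> (\<lambda>j. a j * u ^ j) sums F u"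
    and m: "a m \<noteq> 0" "\<And>j. j < m \<Longrightarrow> a j = 0"
  shows "\<forall>\<^sub>F u in at_right 0. sgn (F u) = sgn (a m)"
proof -
  \<comment> \<open>\<open>G\<close> is the series after division by \<open>u ^ m\<close>. It is
    continuous at 0 with the nonzero value \<open>a m\<close>, and \<open>u ^ m\<close> is positive
    for \<open>u > 0\<close>.\<close>
  define G where "G = (\<lambda>u. \<Sum>j. a (j + m) * u ^ j)"
  have FG: "F u = u ^ m * G u" if "\<bar>u\<bar> \<le> r" "0 < u" for u
  proof -
    have "(\<lambda>j. a (j + m) * u ^ (j + m)) sums F u"
      using F[OF that(1)] m(2) by (subst sums_iff_shift[of _ m]) simp
    then have "(\<lambda>j. a (j + m) * u ^ (j + m) / u ^ m) sums (F u / u ^ m)" by (rule sums_divide)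
    then have "(\<lambda>j. a (j + m) * u ^ j) sums (F u / u ^ m)" using that by (simp add: power_add)
    then have "G u = F u / u ^ m" by (simp add: G_def sums_iff)
    with that show ?thesis by simp
  qed
  have "summable (\<lambda>j. a (j + m) * r ^ j)"
  proof -
    have "summable (\<lambda>j. a (j + m) * r ^ (j + m))"
      using F[of r] r by (subst summable_iff_shift) (auto simp: sums_iff)
    then have "summable (\<lambda>j. a (j + m) * r ^ (j + m) / r ^ m)" by (rule summable_divide)
    then show ?thesis using r by (simp add: power_add)
  qed
  then have "isCont G 0" unfolding G_def by (rule isCont_powser) (use r in auto)
  then have "(G \<longlongrightarrow> G 0) (at_right 0)"
    by (auto simp: isCont_def intro: filterlim_mono at_le)
  moreover have "G 0 = a m" unfolding G_def by (subst powser_zero) simp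
  ultimately have "((\<lambda>u. sgn (G u)) \<longlongrightarrow> sgn (a m)) (at_right 0)"
    using tendsto_sgn[of G "G 0" "at_right 0"] m(1) by simp
  \<comment> \<open>\<open>sgn\<close> takes only the values -1, 0 and 1 here, and the limit is not
    0, so a distance below 1 forces equality.\<close>
  then have "\<forall>\<^sub>F u in at_right 0. dist (sgn (G u)) (sgn (a m)) < 1" by (rule tendstoD) simp
  moreover have "\<forall>\<^sub>F u in at_right 0. u < r" "\<forall>\<^sub>F u in at_right (0::real). 0 < u"
    using r by (auto intro: eventually_at_right_less order_tendstoD tendsto_ident_at)
  ultimately show ?thesis
  proof eventually_elim
    case (elim u)
    then have "F u = u ^ m * G u" using FG by simp
    moreover have "sgn (G u) = sgn (a m)" using elim(1) m(1)
      by (auto simp: sgn_if dist_real_def split: if_splits)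
    ultimately show ?case using elim by (simp add: sgn_mult)
  qed
qed

lemma power_series_eventually_sgn:
  fixes a :: "nat \<Rightarrow> real"
  assumes r: "0 < r" and F: "\<And>u. \<bar>u\<bar> \<le> r \<Longrightarrow> (\<lambda>j. a j * u ^ j) sums F u"
  shows "\<exists>s. (\<forall>\<^sub>F u in at_right 0. sgn (F u) = s) \<and> (a n \<noteq> 0 \<longrightarrow> s \<noteq> 0)"
proof (cases "\<forall>j. a j = 0")
  case True
  have "\<forall>\<^sub>F u in at_right 0. u < r \<and> 0 < (u::real)"
    using r by (intro eventually_conj order_tendstoD(2)[OF tendsto_ident_at] eventually_at_right_less)
  then have "\<forall>\<^sub>F u in at_right 0. sgn (F u) = 0"
  proof eventually_elim
    case (elim u)
    then have "(\<lambda>_. 0) sums F u" using F[of u] True by simp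
    from sums_unique2[OF this sums_zero] show ?case by simp
  qed
  then show ?thesis using True by blast
next
  case False
  define m where "m = (LEAST j. a j \<noteq> 0)"
  have "a m \<noteq> 0" unfolding m_def using False by (metis (mono_tags, lifting) LeastI)
  moreover have "a j = 0" if "j < m" for j using that not_less_Least unfolding m_def by blast
  ultimately show ?thesis
    using power_series_sgn[OF r F, of m] by (intro exI[of _ "sgn (a m)"]) (simp add: sgn_zero_iff)
qed

text \<open>Induction on the variables: each \<open>g\<close> has a coefficient that does not vanish
  identically, these coefficients have a common nonzero point by the induction hypothesis, and over
  that point each \<open>g\<close> is a nontrivial power series in the last variable. The point
  found later becomes the direction of the linear change of variables.\<close>

lemma pexp_common_nonzero:
  assumes "finite I" "finite G" "\<And>i. i \<in> I \<Longrightarrow> 0 < \<rho>' i" "\<And>i. i \<in> I \<Longrightarrow> 0 < \<rho> i"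
    and "\<And>g. g \<in> G \<Longrightarrow> \<exists>M. pexp I \<rho> M g"
    and "\<And>g. g \<in> G \<Longrightarrow> \<exists>x\<in>polydisc I \<rho>. g x \<noteq> 0"
  shows "\<exists>x. (\<forall>i\<in>I. 0 < x i \<and> x i \<le> \<rho>' i \<and> x i \<le> \<rho> i) \<and> (\<forall>g\<in>G. g x \<noteq> 0)"
  using assms
proof (induction I arbitrary: G rule: finite_induct)
  case empty
  have "g x \<noteq> 0" if gG: "g \<in> G" for g x
  proof -
    obtain M where M: "pexp {} \<rho> M g" using empty.prems(4)[OF gG] ..
    obtain z where "z \<in> polydisc {} \<rho>" "g z \<noteq> 0" using empty.prems(5)[OF gG] ..
    then show ?thesis using pexp_dep[OF M, of z x] by simp
  qed
  then show ?case by simp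
next
  case (insert i I)
  have "\<forall>g\<in>G. \<exists>a. (\<forall>j. \<exists>N. pexp I \<rho> N (a j)) \<and>
    (\<forall>x\<in>polydisc (insert i I) \<rho>. ((\<lambda>j::nat. a j x * x i ^ j) has_sum g x) UNIV)"
  proof
    fix g assume "g \<in> G"
    then obtain M where M: "pexp (insert i I) \<rho> M g" using insert.prems(4) by blast
    show "\<exists>a. (\<forall>j. \<exists>N. pexp I \<rho> N (a j)) \<and>
      (\<forall>x\<in>polydisc (insert i I) \<rho>. ((\<lambda>j::nat. a j x * x i ^ j) has_sum g x) UNIV)"
      by (rule pexp_split[OF M insert.hyps]) blast
  qed
  from bchoice[OF this] obtain a where a: "\<And>g j. g \<in> G \<Longrightarrow> \<exists>N. pexp I \<rho> N (a g j)"
    and g: "\<And>g x. g \<in> G \<Longrightarrow> x \<in> polydisc (insert i I) \<rho> \<Longrightarrow> ((\<lambda>j. a g j x * x i ^ j) has_sum g x) UNIV"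
    by blast
  have "\<exists>j. \<exists>x\<in>polydisc I \<rho>. a g j x \<noteq> 0" if gG: "g \<in> G" for g
  proof (rule ccontr)
    assume *: "\<not> ?thesis"
    obtain x where x: "x \<in> polydisc (insert i I) \<rho>" "g x \<noteq> 0" using insert.prems(5)[OF gG] ..
    then have "a g j x = 0" for j using * by (auto simp: polydisc_def)
    then have "((\<lambda>_. 0) has_sum g x) (UNIV :: nat set)" using g[OF gG x(1)] by simp
    then have "g x = 0" by (rule has_sum_unique) simp
    with x show False by simp
  qed
  then obtain J where J: "\<And>g. g \<in> G \<Longrightarrow> \<exists>x\<in>polydisc I \<rho>. a g (J g) x \<noteq> 0" by metis
  have "\<exists>x. (\<forall>i\<in>I. 0 < x i \<and> x i \<le> \<rho>' i \<and> x i \<le> \<rho> i) \<and> (\<forall>g\<in>(\<lambda>g. a g (J g)) ` G. g x \<noteq> 0)"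
    by (rule insert.IH) (use insert.prems a J in auto)
  then obtain x where x: "\<And>k. k \<in> I \<Longrightarrow> 0 < x k \<and> x k \<le> \<rho>' k \<and> x k \<le> \<rho> k"
    and ax: "\<And>g. g \<in> G \<Longrightarrow> a g (J g) x \<noteq> 0" by blast
  have xI: "x \<in> polydisc I \<rho>" using x by (force simp: polydisc_def)
  have "\<forall>\<^sub>F u in at_right 0. g (x(i := u)) \<noteq> 0" if gG: "g \<in> G" for g
  proof -
    have "(\<lambda>j. a g j x * u ^ j) sums g (x(i := u))" if u: "\<bar>u\<bar> \<le> \<rho> i" for u
    proof -
      have "x(i := u) \<in> polydisc (insert i I) \<rho>" using u xI by (auto simp: polydisc_def)
      from g[OF gG this] have "((\<lambda>j. a g j (x(i := u)) * u ^ j) has_sum g (x(i := u))) UNIV" by simp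
      moreover have "a g j (x(i := u)) = a g j x" for j
      proof -
        obtain N where "pexp I \<rho> N (a g j)" using a[OF gG] ..
        from pexp_dep[OF this xI, of "x(i := u)"] insert.hyps(2) show ?thesis by force
      qed
      ultimately show ?thesis by (simp add: has_sum_imp_sums)
    qed
    from power_series_eventually_sgn[of "\<rho> i" "\<lambda>j. a g j x" _ "J g", OF _ this]
    obtain s where "\<forall>\<^sub>F u in at_right 0. sgn (g (x(i := u))) = s" "s \<noteq> 0"
      using ax[OF gG] insert.prems(3) by auto
    then show ?thesis by (auto elim!: eventually_mono)
  qed
  then have "\<forall>\<^sub>F u in at_right 0. \<forall>g\<in>G. g (x(i := u)) \<noteq> 0"
    using insert.prems(1) by (simp add: eventually_ball_finite)
  moreover have "\<forall>\<^sub>F u in at_right 0. u < \<rho> i" "\<forall>\<^sub>F u in at_right 0. u < \<rho>' i" "\<forall>\<^sub>F u in at_right (0::real). 0 < u"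
    using insert.prems(2,3)[of i] by (auto intro: eventually_at_right_less order_tendstoD tendsto_ident_at)
  ultimately have "\<forall>\<^sub>F u in at_right 0. (\<forall>g\<in>G. g (x(i := u)) \<noteq> 0) \<and> 0 < u \<and> u < \<rho> i \<and> u < \<rho>' i"
    by eventually_elim simp
  then obtain u where "\<forall>g\<in>G. g (x(i := u)) \<noteq> 0" "0 < u" "u < \<rho> i" "u < \<rho>' i"
    using eventually_happens'[OF trivial_limit_at_right_real] by blast
  then show ?case using x insert.hyps(2) by (intro exI[of _ "x(i := u)"]) (simp del: fun_upd_apply, simp)
qed

lemma pexp_set_zero:
  assumes f: "pexp (insert i I) \<rho> M f" and I: "finite I"
  shows "pexp I \<rho> M (\<lambda>x. f (x(i := 0)))"
proof -
  have pos: "0 < \<rho> j" if "j \<in> insert i I" for j using pexp_pos[OF f that] .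
  have "pexp I \<rho> M (\<lambda>x. f (\<lambda>j. if j = i then 0 else x j))"
  proof (rule pexp_compose[OF f])
    show "pexp I \<rho> (\<rho> j) (\<lambda>x. if j = i then 0 else x j)" if j: "j \<in> insert i I" for j
    proof (cases "j = i")
      case True
      have "pexp I \<rho> \<bar>0\<bar> (\<lambda>_. 0)" by (rule pexp_const) (use pos in auto)
      then have "pexp I \<rho> (\<rho> i) (\<lambda>_. 0)" by (rule pexp_mono) (use pos[of i] in simp)
      then show ?thesis using True by simp
    next
      case False
      then show ?thesis using j I pos by (simp add: pexp_var)
    qed
  qed (use I pos in auto)
  then show ?thesis by (simp add: fun_upd_def)
qed

section \<open>Division by powers of a variable and Weierstrass preparation\<close>

lemma pexp_taylor:
  assumes f: "pexp (insert y I) \<rho> M f" and I: "finite I" "y \<notin> I"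
  obtains a q where "\<And>e. pexp I \<rho> (M / \<rho> y ^ e) (a e)" "\<And>e. pexp (insert y I) \<rho> (M / \<rho> y ^ e) (q e)"
    "\<And>x. x \<in> polydisc (insert y I) \<rho> \<Longrightarrow> ((\<lambda>j. a j x * x y ^ j) has_sum f x) UNIV"
    "\<And>e x. x \<in> polydisc (insert y I) \<rho> \<Longrightarrow> q e x = a e x + x y * q (Suc e) x"
    "\<And>e x. x \<in> polydisc (insert y I) \<rho> \<Longrightarrow> f x = x y ^ e * q e x + (\<Sum>j<e. a j x * x y ^ j)"
proof -
  let ?P = "polydisc (insert y I) \<rho>"
  obtain a N S where a: "\<And>j. pexp I \<rho> (N j) (a j)" and S: "((\<lambda>j. N j * \<rho> y ^ j) has_sum S) UNIV" "S \<le> M"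
    and fx: "\<And>x. x \<in> ?P \<Longrightarrow> ((\<lambda>j. a j x * x y ^ j) has_sum f x) UNIV"
    by (rule pexp_split[OF f I]) blast
  have pos: "0 < \<rho> y" using pexp_pos[OF f] by simp
  have N0: "0 \<le> N j * \<rho> y ^ j" for j using pexp_nonneg[OF a[of j]] pos by simp
  have Nj: "N j \<le> M / \<rho> y ^ j" for j
  proof -
    have "(\<Sum>k\<in>{j}. N k * \<rho> y ^ k) \<le> S"
      by (rule has_sum_mono_neutral[OF has_sum_finite S(1)]) (use N0 in auto)
    then show ?thesis using S(2) pos by (simp add: field_simps)
  qed
  \<comment> \<open>\<open>T e\<close> is the norm of the tail from \<open>e\<close> on, divided by
    \<open>\<rho> y ^ e\<close>; as the full norm is at most \<open>M\<close>, this yields the bound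
    for \<open>q e\<close>.\<close>
  define T where "T = (\<lambda>e. (S - (\<Sum>j<e. N j * \<rho> y ^ j)) / \<rho> y ^ e)"
  have T: "((\<lambda>j. N (j + e) * \<rho> y ^ j) has_sum T e) UNIV" for e
    using has_sum_cmult_left[OF has_sum_shift[OF S(1), of e], of "1 / \<rho> y ^ e"] pos
    by (simp add: power_add T_def)
  have TM: "T e \<le> M / \<rho> y ^ e" for e unfolding T_def
    by (rule divide_right_mono)
       (use S(2) sum_nonneg[of "{..<e}" "\<lambda>j. N j * \<rho> y ^ j"] N0 pos in auto)
  define q where "q = (\<lambda>e x. infsum (\<lambda>j. a (j + e) x * x y ^ j) UNIV)"
  have sm: "(\<lambda>j. a (j + e) x * x y ^ j) summable_on UNIV" if x: "x \<in> ?P" for e x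
  proof (rule pexp_summable[OF _ has_sum_imp_summable[OF T[of e]] x])
    show "pexp (insert y I) \<rho> (N (j + e) * \<rho> y ^ j) (\<lambda>x. a (j + e) x * x y ^ j)" for j
      by (intro pexp_mult pexp_power pexp_var pexp_superset[OF a]) (use I pexp_pos[OF f] in auto)
  qed
  have qx: "((\<lambda>j. a (j + e) x * x y ^ j) has_sum q e x) UNIV"
    if "x \<in> ?P" for e x
    unfolding q_def using sm[OF that] by (rule has_sum_infsum)
  show thesis
  proof (rule that)
    show "pexp (insert y I) \<rho> (M / \<rho> y ^ e) (q e)" for e
      by (rule pexp_mono[OF pexp_unsplit[OF a T I(1) pos qx] TM])
    show "pexp I \<rho> (M / \<rho> y ^ j) (a j)" for j
      using pexp_mono[OF a Nj] .
    fix x e assume x: "x \<in> ?P"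
    show "((\<lambda>j. a j x * x y ^ j) has_sum f x) UNIV" by (rule fx[OF x])
    have "((\<lambda>j. a (j + e) x * x y ^ (j + e)) has_sum f x - (\<Sum>j<e. a j x * x y ^ j)) UNIV"
      by (rule has_sum_shift[OF fx[OF x]])
    moreover have "((\<lambda>j. a (j + e) x * x y ^ (j + e)) has_sum x y ^ e * q e x) UNIV"
      using has_sum_cmult_right[OF qx[OF x, of e], of "x y ^ e"] by (simp add: power_add mult_ac)
    ultimately have "f x - (\<Sum>j<e. a j x * x y ^ j) = x y ^ e * q e x" by (rule has_sum_unique)
    then show "f x = x y ^ e * q e x + (\<Sum>j<e. a j x * x y ^ j)" by simp
    have "((\<lambda>j. a (j + Suc e) x * x y ^ Suc j) has_sum q e x - a e x) UNIV"
      using has_sum_shift[OF qx[OF x, of e], of 1] by simp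
    moreover have "((\<lambda>j. a (j + Suc e) x * x y ^ Suc j) has_sum x y * q (Suc e) x) UNIV"
      using has_sum_cmult_right[OF qx[OF x, of "Suc e"], of "x y"] by (simp add: mult_ac)
    ultimately have "q e x - a e x = x y * q (Suc e) x" by (rule has_sum_unique)
    then show "q e x = a e x + x y * q (Suc e) x" by simp
  qed
qed

text \<open>\<open>m\<close> is the least \<open>j\<close> whose coefficient \<open>a j\<close> is
  not identically zero, and \<open>h\<close> is the tail \<open>q m\<close>; on the hyperplane
  \<open>x i = 0\<close> this tail reduces to \<open>a m\<close>.\<close>

lemma pexp_factor_out:
  assumes f: "pexp (insert i I) \<rho> M f" and I: "finite I" "i \<notin> I"
    and nz: "\<exists>x\<in>polydisc (insert i I) \<rho>. f x \<noteq> 0"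
  obtains m h N where "pexp (insert i I) \<rho> N h"
    "\<And>x. x \<in> polydisc (insert i I) \<rho> \<Longrightarrow> f x = x i ^ m * h x"
    "\<exists>x\<in>polydisc (insert i I) \<rho>. h (x(i := 0)) \<noteq> 0"
proof -
  let ?P = "polydisc (insert i I) \<rho>"
  obtain a q where a: "\<And>e. pexp I \<rho> (M / \<rho> i ^ e) (a e)"
    and q: "\<And>e. pexp (insert i I) \<rho> (M / \<rho> i ^ e) (q e)"
    and fx: "\<And>x. x \<in> ?P \<Longrightarrow> ((\<lambda>j. a j x * x i ^ j) has_sum f x) UNIV"
    and qa: "\<And>e x. x \<in> ?P \<Longrightarrow> q e x = a e x + x i * q (Suc e) x"
    and eq: "\<And>e x. x \<in> ?P \<Longrightarrow> f x = x i ^ e * q e x + (\<Sum>j<e. a j x * x i ^ j)"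
    by (rule pexp_taylor[OF f I]) blast
  have pos: "0 < \<rho> i" using pexp_pos[OF f] by simp
  have pdI: "x \<in> polydisc I \<rho>" if "x \<in> ?P" for x
    using that by (simp add: polydisc_def)
  obtain z where z: "z \<in> ?P" "f z \<noteq> 0" using nz by blast
  define P where "P = (\<lambda>j. \<exists>x\<in>polydisc I \<rho>. a j x \<noteq> 0)"
  have "\<exists>j. P j"
  proof (rule ccontr)
    assume "\<not> ?thesis"
    then have "a j z = 0" for j using pdI[OF z(1)] by (auto simp: P_def)
    then have "((\<lambda>_. 0) has_sum f z) (UNIV :: nat set)" using fx[OF z(1)] by simp
    then have "f z = 0" by (rule has_sum_unique) simp
    with z show False by simp
  qed
  define m where "m = (LEAST j. P j)"
  have Pm: "P m" unfolding m_def using \<open>\<exists>j. P j\<close> by (rule LeastI_ex)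
  have zero: "a j x = 0" if "j < m" "x \<in> ?P" for j x
    using not_less_Least[of j P] that pdI by (auto simp: m_def P_def)
  show thesis
  proof (rule that[OF q[of m]])
    show "f x = x i ^ m * q m x" if x: "x \<in> ?P" for x
      using eq[OF x, of m] zero[OF _ x] by simp
    obtain x where x: "x \<in> polydisc I \<rho>" "a m x \<noteq> 0" using Pm by (auto simp: P_def)
    have x0: "x(i := 0) \<in> ?P" using x(1) pos I by (auto simp: polydisc_def)
    have "q m (x(i := 0)) = a m (x(i := 0))" using qa[OF x0, of m] by simp
    also have "\<dots> = a m x" by (rule pexp_dep[OF a x(1), symmetric]) (use I in auto)
    finally show "\<exists>x\<in>?P. q m (x(i := 0)) \<noteq> 0"
      using x x0 by (intro bexI[of _ "x(i := 0)"]) auto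
  qed
qed

lemma has_sum_finite_sum:
  fixes f :: "'a \<Rightarrow> 'b \<Rightarrow> real"
  assumes "finite A" "\<And>k. k \<in> A \<Longrightarrow> (f k has_sum g k) B"
  shows "((\<lambda>x. \<Sum>k\<in>A. f k x) has_sum (\<Sum>k\<in>A. g k)) B"
  using assms by (induction A rule: finite_induct) (auto intro: has_sum_add)

text \<open>
  The cofactor is found as the Neumann series of \<open>q = 1 - T (h q)\<close>, where \<open>T\<close> truncates at
  \<open>y ^ e\<close> and divides by it; the bound on \<open>h\<close> makes this a contraction with factor 1/4.
\<close>

lemma pexp_monic_multiple:
  assumes h: "pexp (insert y I) \<rho> (\<rho> y ^ e / 4) h" and I: "finite I" "y \<notin> I"
  shows "\<exists>r. (\<forall>j<e. \<exists>N. pexp I \<rho> N (r j)) \<and>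
    (\<forall>x\<in>polydisc (insert y I) \<rho>. \<exists>q>0. (x y ^ e + h x) * q = x y ^ e + (\<Sum>j<e. r j x * x y ^ j))"
proof -
  define D where "D = polydisc (insert y I) \<rho>"
  have pos: "0 < \<rho> i" if "i \<in> insert y I" for i using pexp_pos[OF h that] .
  have sy: "0 < \<rho> y" using pos by simp
  define P where "P = (\<lambda>(k::nat) q. pexp (insert y I) \<rho> ((1/4)^k) q)"
  \<comment> \<open>\<open>q\<close> is the k-th term of the Neumann series, and
    \<open>h * q\<close> is divided by \<open>y ^ e\<close>: minus the quotient is the next term
    \<open>q'\<close>, and the remainder is a polynomial in \<open>y\<close> with coefficients
    \<open>r j\<close>. Each division gains
    \<open>(\<rho> y ^ e / 4) / \<rho> y ^ e = 1/4\<close>.\<close>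
  define Q where "Q = (\<lambda>(k::nat) q q' r. (\<forall>j<e. pexp I \<rho> (\<rho> y ^ e / 4 * (1/4)^k / \<rho> y ^ j) (r j)) \<and>
      (\<forall>x\<in>D. h x * q x = - (x y ^ e * q' x) + (\<Sum>j<e. r j x * x y ^ j)))"
  have step: "\<exists>q'. P (Suc k) q' \<and> (\<exists>r. Q k q q' r)" if "P k q" for k q
  proof -
    have "pexp (insert y I) \<rho> (\<rho> y ^ e / 4 * (1/4)^k) (\<lambda>x. h x * q x)"
      using h that unfolding P_def by (rule pexp_mult)
    then obtain q1 r where
      q1: "pexp (insert y I) \<rho> (\<rho> y ^ e / 4 * (1/4)^k / \<rho> y ^ e) q1"
      and r: "\<And>j. pexp I \<rho> (\<rho> y ^ e / 4 * (1/4)^k / \<rho> y ^ j) (r j)"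
      and eq: "\<And>x. x \<in> D \<Longrightarrow> h x * q x = x y ^ e * q1 x + (\<Sum>j<e. r j x * x y ^ j)"
      unfolding D_def by (rule pexp_taylor[OF _ I]) blast
    have "P (Suc k) (\<lambda>x. - q1 x)"
      using pexp_uminus[OF q1] sy by (simp add: P_def)
    moreover have "Q k q (\<lambda>x. - q1 x) r" using r eq by (simp add: Q_def)
    ultimately show ?thesis by blast
  qed
  have P0: "P 0 (\<lambda>_. 1)" using pexp_const[of "insert y I" \<rho> 1] pos by (simp add: P_def)
  obtain q where q: "\<And>k. P k (q k)" "\<And>k. \<exists>r. Q k (q k) (q (Suc k)) r" and q0: "q 0 = (\<lambda>_. 1)"
  proof -
    have "\<exists>q. \<forall>k. (P k (q k) \<and> (k = 0 \<longrightarrow> q k = (\<lambda>_. 1))) \<and> (\<exists>r. Q k (q k) (q (Suc k)) r)"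
      by (rule dependent_nat_choice) (use P0 step in auto)
    then show thesis using that by blast
  qed
  obtain r where r: "\<And>k. Q k (q k) (q (Suc k)) (r k)" using q(2) by metis
  have geo: "((\<lambda>k. (1/4)^k) has_sum (4/3::real)) UNIV"
    by (rule sums_nonneg_imp_has_sum) (use geometric_sums[of "1/4::real"] in auto)
  define R where "R = (\<lambda>j x. infsum (\<lambda>k. r k j x) UNIV)"
  have rB: "pexp I \<rho> (\<rho> y ^ e / 4 * (1/4)^k / \<rho> y ^ j) (r k j)" if "j < e" for k j
    using r that by (simp add: Q_def)
  have geo': "((\<lambda>k. \<rho> y ^ e / 4 * (1/4)^k / \<rho> y ^ j) has_sum (\<rho> y ^ e / 4 / \<rho> y ^ j * (4/3))) UNIV" for j
    using has_sum_cmult_right[OF geo, of "\<rho> y ^ e / 4 / \<rho> y ^ j"] by simp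
  have hR: "((\<lambda>k. r k j x) has_sum R j x) UNIV" if "j < e" "x \<in> polydisc I \<rho>" for j x
    unfolding R_def
    by (rule has_sum_infsum, rule pexp_summable[OF rB[OF that(1)] has_sum_imp_summable[OF geo'] that(2)])
  have "\<forall>j<e. \<exists>N. pexp I \<rho> N (R j)"
  proof (intro allI impI exI)
    fix j assume "j < e"
    show "pexp I \<rho> (\<rho> y ^ e / 4 / \<rho> y ^ j * (4/3)) (R j)"
    proof (rule pexp_has_sum[where A = UNIV and f = "\<lambda>k. r k j"])
      show "pexp I \<rho> (\<rho> y ^ e / 4 * (1/4)^k / \<rho> y ^ j) (r k j)" for k by (rule rB[OF \<open>j < e\<close>])
      show "((\<lambda>k. r k j x) has_sum R j x) UNIV" if "x \<in> polydisc I \<rho>" for x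
        by (rule hR[OF \<open>j < e\<close> that])
    qed (use pos geo' in auto)
  qed
  moreover have "\<exists>t>0. (x y ^ e + h x) * t = x y ^ e + (\<Sum>j<e. R j x * x y ^ j)" if x: "x \<in> D" for x
  proof -
    have xI: "x \<in> polydisc I \<rho>" using x by (simp add: D_def polydisc_def)
    have "(\<lambda>k. q k x) summable_on UNIV"
      using pexp_summable[of UNIV "insert y I" \<rho> "\<lambda>k. (1/4)^k" q x] q(1) has_sum_imp_summable[OF geo] x
      by (simp add: P_def D_def)
    then obtain t where t: "((\<lambda>k. q k x) has_sum t) UNIV" by (auto simp: summable_on_def)
    have t1: "((\<lambda>k. q (Suc k) x) has_sum (t - 1)) UNIV"
      using has_sum_shift[OF t, of 1] q0 by simp
    \<comment> \<open>The terms after the initial 1 add up to at most 1/4 + 1/16 + ... = 1/3 in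
      absolute value, so the cofactor \<open>t\<close> is positive and leaves signs
      unchanged.\<close>
    have "\<bar>t - 1\<bar> \<le> 4/3 - 1"
    proof (rule has_sum_abs_le[OF t1])
      show "((\<lambda>k. (1/4) ^ Suc k) has_sum (4/3 - 1 :: real)) UNIV"
        using has_sum_shift[OF geo, of 1] by simp
      show "\<bar>q (Suc k) x\<bar> \<le> (1/4) ^ Suc k" for k
        using pexp_bound[of "insert y I" \<rho> "(1/4) ^ Suc k" "q (Suc k)" x] q(1)[of "Suc k"] x
        unfolding P_def D_def by blast
    qed
    then have "1 - t \<le> 1/3" by linarith
    then have "0 < t" by simp
    have "((\<lambda>k. h x * q k x) has_sum h x * t) UNIV" by (rule has_sum_cmult_right[OF t])
    moreover have "h x * q k x = - (x y ^ e) * q (Suc k) x + (\<Sum>j<e. r k j x * x y ^ j)" for k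
      using r[of k] x by (simp add: Q_def)
    moreover have "((\<lambda>k. - (x y ^ e) * q (Suc k) x + (\<Sum>j<e. r k j x * x y ^ j)) has_sum
        (- (x y ^ e) * (t - 1) + (\<Sum>j<e. R j x * x y ^ j))) UNIV"
      by (intro has_sum_add has_sum_cmult_right t1 has_sum_finite_sum has_sum_cmult_left hR xI) auto
    ultimately have "h x * t = - (x y ^ e) * (t - 1) + (\<Sum>j<e. R j x * x y ^ j)"
      using has_sum_unique by fastforce
    then have "(x y ^ e + h x) * t = x y ^ e + (\<Sum>j<e. R j x * x y ^ j)"
      by (simp add: algebra_simps)
    with \<open>0 < t\<close> show ?thesis by blast
  qed
  ultimately show ?thesis unfolding D_def by blast
qed

lemma eventually_at_right_0_le:
  assumes "finite A" "\<And>i. i \<in> A \<Longrightarrow> 0 < (\<rho> i :: real)"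
  shows "\<forall>\<^sub>F d in at_right 0. 0 < d \<and> (\<forall>i\<in>A. d \<le> \<rho> i)"
proof -
  have "\<forall>\<^sub>F d in at_right 0. d \<le> \<rho> i" if "i \<in> A" for i
    using order_tendstoD(2)[OF tendsto_ident_at assms(2)[OF that]] by (rule eventually_mono) simp
  then show ?thesis
    using assms(1) by (intro eventually_conj eventually_ball_finite) (auto intro: eventually_at_right_less)
qed

lemma finite_positive_lower_bound:
  assumes "finite A" "\<And>i. i \<in> A \<Longrightarrow> 0 < (\<rho> i :: real)"
  obtains d where "0 < d" "\<And>i. i \<in> A \<Longrightarrow> d \<le> \<rho> i"
  using eventually_happens'[OF trivial_limit_at_right_real eventually_at_right_0_le[of A \<rho>]] assms by blast

text \<open>Let \<open>e\<close> be the order of vanishing of \<open>f\<close> along the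
  \<open>y\<close>-axis, finite by \<open>nz\<close>, and \<open>A\<close> the leading coefficient
  there. Then \<open>f = A (y ^ e + h)\<close>, and on a suitable polydisc \<open>h\<close> is small
  enough for \<open>pexp_monic_multiple\<close>. The data \<open>c\<close>, \<open>e\<close>,
  \<open>r\<close> do not depend on \<open>d\<close>, so that finitely many functions can share one
  polydisc.\<close>

lemma pexp_weierstrass:
  assumes f: "pexp (insert y I) \<rho> M f" and I: "finite I" "y \<notin> I"
    and nz: "\<bar>u\<bar> \<le> \<rho> y" "f ((\<lambda>_. 0)(y := u)) \<noteq> 0"
  obtains c e r where "\<forall>\<^sub>F d in at_right 0. (\<forall>j<e. \<exists>N. pexp I (\<lambda>_. d) N (r j)) \<and>
    (\<forall>x\<in>polydisc (insert y I) (\<lambda>_. d). sgn (f x) = sgn (c * (x y ^ e + (\<Sum>j<e. r j x * x y ^ j))))"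
proof -
  let ?P = "polydisc (insert y I) \<rho>"
  let ?z = "\<lambda>_. 0 :: real"
  obtain a q where a: "\<And>e. pexp I \<rho> (M / \<rho> y ^ e) (a e)"
    and q: "\<And>e. pexp (insert y I) \<rho> (M / \<rho> y ^ e) (q e)"
    and fx: "\<And>x. x \<in> ?P \<Longrightarrow> ((\<lambda>j. a j x * x y ^ j) has_sum f x) UNIV"
    and eq: "\<And>e x. x \<in> ?P \<Longrightarrow> f x = x y ^ e * q e x + (\<Sum>j<e. a j x * x y ^ j)"
    by (rule pexp_taylor[OF f I]) blast
  have pos: "0 < \<rho> i" if "i \<in> insert y I" for i using pexp_pos[OF f that] .
  have posy: "0 < \<rho> y" using pos by simp
  have zI: "?z \<in> polydisc I \<rho>" using pos by (force simp: polydisc_def)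
  have zu: "?z(y := u) \<in> ?P" using pos nz(1) I by (force simp: polydisc_def)
  have "\<exists>j. a j ?z \<noteq> 0"
  proof (rule ccontr)
    assume "\<not> ?thesis"
    then have "a j (?z(y := u)) = 0" for j
      using pexp_dep[OF a[of j] zI, of "?z(y := u)"] I(2) by force
    then have "((\<lambda>_. 0) has_sum f (?z(y := u))) (UNIV :: nat set)" using fx[OF zu] by simp
    then have "f (?z(y := u)) = 0" by (rule has_sum_unique) simp
    with nz show False by simp
  qed
  define e where "e = (LEAST j. a j ?z \<noteq> 0)"
  have ae: "a e ?z \<noteq> 0" unfolding e_def using \<open>\<exists>j. a j ?z \<noteq> 0\<close> by (rule LeastI_ex)
  have zero: "a j ?z = 0" if "j < e" for j using not_less_Least that unfolding e_def by blast
  define A where "A = a e ?z"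
  define K where "K = \<bar>1 / A\<bar> * (M / \<rho> y ^ Suc e)"
  have K: "pexp (insert y I) \<rho> K (\<lambda>x. 1 / A * q (Suc e) x)" unfolding K_def by (rule pexp_cmult[OF q])
  have K0: "0 \<le> K" using K by (rule pexp_nonneg)
  \<comment> \<open>The radius \<open>s\<close> for \<open>y\<close> is fixed first: it bounds the
    part of \<open>h\<close> divisible by \<open>y ^ (e + 1)\<close> by \<open>s ^ e / 8\<close>.
    The factor \<open>l\<close> for the other radii depends on \<open>s\<close>.\<close>
  define s where "s = min (\<rho> y) (1 / (8 * (K + 1)))"
  have s: "0 < s" "s \<le> \<rho> y" "s * K \<le> 1/8"
  proof -
    show "0 < s" "s \<le> \<rho> y" using posy K0 by (auto simp: s_def)
    have "s * K \<le> 1 / (8 * (K + 1)) * K" using K0 by (intro mult_right_mono) (auto simp: s_def)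
    also have "\<dots> \<le> 1/8" using K0 by (simp add: field_simps)
    finally show "s * K \<le> 1/8" .
  qed
  \<comment> \<open>Coefficients of \<open>f / A - y ^ e\<close>: subtracting 1 at
    \<open>j = e\<close> makes all those with \<open>j \<le> e\<close> vanish at the origin, so that
    \<open>pexp_scale\<close> applies to them.\<close>
  define b where "b = (\<lambda>j x. 1 / A * a j x - (if j = e then 1 else 0))"
  define B where "B = (\<lambda>j. \<bar>1 / A\<bar> * (M / \<rho> y ^ j) + (if j = e then 1 else 0))"
  have b: "pexp I \<rho> (B j) (b j)" for j
  proof -
    have "pexp I \<rho> \<bar>if j = e then 1 else 0\<bar> (\<lambda>_. if j = e then 1 else 0)"
      by (rule pexp_const) (use pos in auto)
    from pexp_diff[OF pexp_cmult[OF a[of j], of "1 / A"] this] show ?thesis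
      by (simp add: b_def B_def)
  qed
  have b0: "b j ?z = 0" if "j < Suc e" for j
    using that zero[of j] ae by (auto simp: b_def A_def less_Suc_eq)
  define C where "C = (\<Sum>j<Suc e. B j * s ^ j)"
  have C0: "0 \<le> C" unfolding C_def
    by (rule sum_nonneg) (use pexp_nonneg[OF b] s in auto)
  \<comment> \<open>\<open>C\<close> bounds the lower part of \<open>h\<close> before the other
    radii are shrunk; this \<open>l\<close> brings it down to \<open>s ^ e / 8\<close>, and the two
    eighths make up the required quarter.\<close>
  define l where "l = min 1 (s ^ e / (8 * (C + 1)))"
  have l: "0 < l" "l \<le> 1" "l * C \<le> s ^ e / 8"
  proof -
    show "0 < l" "l \<le> 1" using s C0 by (auto simp: l_def)
    have "l * C \<le> s ^ e / (8 * (C + 1)) * C" using C0 by (intro mult_right_mono) (auto simp: l_def)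
    also have "\<dots> \<le> s ^ e / 8" using C0 s by (simp add: field_simps)
    finally show "l * C \<le> s ^ e / 8" .
  qed
  define \<sigma> where "\<sigma> = (\<lambda>i. l * \<rho> i)(y := s)"
  have \<sigma>y: "\<sigma> y = s" by (simp add: \<sigma>_def)
  have \<sigma>pos: "0 < \<sigma> i" if "i \<in> insert y I" for i using that pos l s by (auto simp: \<sigma>_def)
  have \<sigma>le: "\<sigma> i \<le> \<rho> i" if "i \<in> insert y I" for i
    using that mult_right_mono[OF l(2), of "\<rho> i"] pos[OF that] s by (auto simp: \<sigma>_def)
  have sub: "polydisc (insert y I) \<sigma> \<subseteq> ?P"
    using \<sigma>le by (force simp: polydisc_def)
  define h where "h = (\<lambda>x. x y ^ Suc e * (1 / A * q (Suc e) x) + (\<Sum>j<Suc e. b j x * x y ^ j))"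
  have fh: "f x = A * (x y ^ e + h x)" if x: "x \<in> ?P" for x
  proof -
    have "(\<Sum>j<Suc e. b j x * x y ^ j) = (\<Sum>j<Suc e. 1 / A * (a j x * x y ^ j) - (if j = e then x y ^ e else 0))"
      by (rule sum.cong) (auto simp: b_def algebra_simps)
    also have "\<dots> = 1 / A * (\<Sum>j<Suc e. a j x * x y ^ j) - x y ^ e"
      by (simp add: sum_subtractf sum_distrib_left del: sum.lessThan_Suc)
    finally have b_sum: "(\<Sum>j<Suc e. b j x * x y ^ j) = 1 / A * (\<Sum>j<Suc e. a j x * x y ^ j) - x y ^ e" .
    have "A * (p + (Y * (1 / A * Q) + (1 / A * V - p))) = Y * Q + V" for p Y Q V
      using ae by (simp add: A_def field_simps)
    then have "A * (x y ^ e + h x) = x y ^ Suc e * q (Suc e) x + (\<Sum>j<Suc e. a j x * x y ^ j)"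
      unfolding h_def b_sum .
    then show ?thesis using eq[OF x, of "Suc e"] by simp
  qed
  have "pexp (insert y I) \<sigma> (s ^ Suc e * K + (\<Sum>j<Suc e. l * B j * s ^ j)) h"
    unfolding h_def
  proof (intro pexp_add pexp_mult pexp_sum)
    show "pexp (insert y I) \<sigma> (s ^ Suc e) (\<lambda>x. x y ^ Suc e)"
      using pexp_power[OF pexp_var[of "insert y I" \<sigma> y, OF \<sigma>pos], of "Suc e"] I \<sigma>y by simp
    show "pexp (insert y I) \<sigma> K (\<lambda>x. 1 / A * q (Suc e) x)"
      by (rule pexp_shrink[OF K \<sigma>pos \<sigma>le])
    show "pexp (insert y I) \<sigma> (s ^ j) (\<lambda>x. x y ^ j)" for j
      using pexp_power[OF pexp_var[of "insert y I" \<sigma> y, OF \<sigma>pos], of j] I \<sigma>y by simp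
    show "pexp (insert y I) \<sigma> (l * B j) (b j)" if "j \<in> {..<Suc e}" for j
    proof (rule pexp_superset[OF _ _ _ \<sigma>pos])
      have "pexp I (\<lambda>i. l * \<rho> i) (l * B j) (b j)"
        by (rule pexp_scale[OF b I(1) b0 l(1,2)]) (use that in simp)
      then show "pexp I \<sigma> (l * B j) (b j)"
        by (rule pexp_shrink) (use \<sigma>pos I(2) in \<open>auto simp: \<sigma>_def\<close>)
    qed (use I in auto)
  qed (use \<sigma>pos in auto)
  then have "pexp (insert y I) \<sigma> (\<sigma> y ^ e / 4) h"
  proof (rule pexp_mono)
    have "s ^ Suc e * K + (\<Sum>j<Suc e. l * B j * s ^ j) = s ^ e * (s * K) + l * C"
      by (simp add: C_def sum_distrib_left mult_ac del: sum.lessThan_Suc)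
    also have "\<dots> \<le> s ^ e * (1/8) + s ^ e / 8"
      using s l by (intro add_mono mult_left_mono) auto
    finally show "s ^ Suc e * K + (\<Sum>j<Suc e. l * B j * s ^ j) \<le> \<sigma> y ^ e / 4" using \<sigma>y by simp
  qed
  from pexp_monic_multiple[OF this I] obtain r where r: "\<And>j. j < e \<Longrightarrow> \<exists>N. pexp I \<sigma> N (r j)"
    and rq: "\<And>x. x \<in> polydisc (insert y I) \<sigma> \<Longrightarrow>
      \<exists>q>0. (x y ^ e + h x) * q = x y ^ e + (\<Sum>j<e. r j x * x y ^ j)" by blast
  have sg: "sgn (f x) = sgn (A * (x y ^ e + (\<Sum>j<e. r j x * x y ^ j)))"
    if x: "x \<in> polydisc (insert y I) \<sigma>" for x
  proof -
    obtain t where "0 < t" and t: "(x y ^ e + h x) * t = x y ^ e + (\<Sum>j<e. r j x * x y ^ j)"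
      using rq[OF x] by blast
    show ?thesis unfolding t[symmetric] using \<open>0 < t\<close> fh x sub by (auto simp: sgn_mult)
  qed
  have "\<forall>\<^sub>F d in at_right 0. 0 < d \<and> (\<forall>i\<in>insert y I. d \<le> \<sigma> i)"
    by (rule eventually_at_right_0_le) (use I \<sigma>pos in auto)
  then show thesis
  proof (rule that[OF eventually_mono])
    fix d assume d: "0 < d \<and> (\<forall>i\<in>insert y I. d \<le> \<sigma> i)"
    have "\<exists>N. pexp I (\<lambda>_. d) N (r j)" if "j < e" for j
      using r[OF that] d by (auto intro: pexp_shrink)
    moreover have "polydisc (insert y I) (\<lambda>_. d) \<subseteq> polydisc (insert y I) \<sigma>"
      using d by (force simp: polydisc_def)
    ultimately show "(\<forall>j<e. \<exists>N. pexp I (\<lambda>_. d) N (r j)) \<and>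
      (\<forall>x\<in>polydisc (insert y I) (\<lambda>_. d). sgn (f x) = sgn (A * (x y ^ e + (\<Sum>j<e. r j x * x y ^ j))))"
      using sg by blast
  qed
qed

section \<open>Sign vectors of real polynomials with parameters\<close>

text \<open>\<open>P\<close> and \<open>Q\<close> stand for one family specialised at two parameter
  values; with \<open>P = Q\<close> the relation says that two points lie in the same sign
  cell.\<close>

definition agree :: "'j set \<Rightarrow> ('j \<Rightarrow> real poly) \<Rightarrow> real \<Rightarrow> ('j \<Rightarrow> real poly) \<Rightarrow> real \<Rightarrow> bool" where
  "agree J P u Q v \<longleftrightarrow> (\<forall>j\<in>J. sgn (poly (P j) u) = sgn (poly (Q j) v))"

text \<open>
  If the family is closed under derivatives then, by Thom's lemma, each sign vector is attained on a
  point or an open interval. Two families are compared through the order in which their sign vectors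
  occur in \<open>[-r, r]\<close>.
\<close>

definition convex_cells :: "real \<Rightarrow> 'j set \<Rightarrow> ('j \<Rightarrow> real poly) \<Rightarrow> bool" where
  "convex_cells r J P \<longleftrightarrow>
     (\<forall>a b c. -r \<le> a \<longrightarrow> a < b \<longrightarrow> b < c \<longrightarrow> c \<le> r \<longrightarrow> agree J P a P c \<longrightarrow> agree J P a P b)"

definition matched :: "real \<Rightarrow> 'j set \<Rightarrow> ('j \<Rightarrow> real poly) \<Rightarrow> ('j \<Rightarrow> real poly) \<Rightarrow> bool" where
  "matched r J P Q \<longleftrightarrow>
     (\<forall>u\<in>{-r..r}. \<exists>v\<in>{-r..r}. agree J P u Q v) \<and>
     (\<forall>u\<in>{-r..r}. \<forall>u'\<in>{-r..r}. \<forall>v\<in>{-r..r}. \<forall>v'\<in>{-r..r}.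
        agree J P u Q v \<longrightarrow> agree J P u' Q v' \<longrightarrow> u < u' \<longrightarrow> \<not> agree J P u P u' \<longrightarrow> v < v')"

lemma agree_refl: "agree J P u P u"
  by (simp add: agree_def)

lemma agree_sym: "agree J P u Q v \<Longrightarrow> agree J Q v P u"
  by (simp add: agree_def)

lemma agree_trans: "agree J P u Q v \<Longrightarrow> agree J Q v S w \<Longrightarrow> agree J P u S w"
  by (simp add: agree_def)

lemma agree_insert:
  "agree (insert A J) P u Q v \<longleftrightarrow> sgn (poly (P A) u) = sgn (poly (Q A) v) \<and> agree J P u Q v"
  by (auto simp: agree_def)

lemma agreeD: "agree J P u Q v \<Longrightarrow> j \<in> J \<Longrightarrow> sgn (poly (P j) u) = sgn (poly (Q j) v)"
  by (simp add: agree_def)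

lemma matched_ex: "matched r J P Q \<Longrightarrow> u \<in> {-r..r} \<Longrightarrow> \<exists>v\<in>{-r..r}. agree J P u Q v"
  unfolding matched_def by blast

lemma matched_less:
  "matched r J P Q \<Longrightarrow> agree J P u Q v \<Longrightarrow> agree J P u' Q v' \<Longrightarrow> u < u' \<Longrightarrow> \<not> agree J P u P u' \<Longrightarrow>
   u \<in> {-r..r} \<Longrightarrow> u' \<in> {-r..r} \<Longrightarrow> v \<in> {-r..r} \<Longrightarrow> v' \<in> {-r..r} \<Longrightarrow> v < v'"
  unfolding matched_def by blast

lemma convex_cellsD:
  "convex_cells r J P \<Longrightarrow> agree J P a P c \<Longrightarrow> -r \<le> a \<Longrightarrow> c \<le> r \<Longrightarrow> a \<le> b \<Longrightarrow> b \<le> c \<Longrightarrow> agree J P a P b"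
  using agree_refl unfolding convex_cells_def by (metis order_le_less)

section \<open>Real polynomials on intervals\<close>

lemma poly_eq_0_if_zero_on_interval:
  fixes p :: "real poly"
  assumes "a < b" "\<And>x. a < x \<Longrightarrow> x < b \<Longrightarrow> poly p x = 0"
  shows "p = 0"
proof (rule ccontr)
  assume "p \<noteq> 0"
  then have "finite {x. poly p x = 0}" by (rule poly_roots_finite)
  moreover have "{a<..<b} \<subseteq> {x. poly p x = 0}" using assms(2) by auto
  ultimately show False using assms(1) infinite_Ioo finite_subset by blast
qed

lemma poly_mono_on_interval:
  fixes p :: "real poly"
  assumes "a \<le> b" "\<And>x. a \<le> x \<Longrightarrow> x \<le> b \<Longrightarrow> 0 \<le> poly (pderiv p) x"
  shows "poly p a \<le> poly p b"
  by (rule DERIV_nonneg_imp_nondecreasing[OF assms(1)]) (use assms(2) poly_DERIV in blast)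

lemma poly_strict_mono_on_interval:
  fixes p :: "real poly"
  assumes "a < b" "\<And>x. a < x \<Longrightarrow> x < b \<Longrightarrow> 0 < poly (pderiv p) x"
  shows "poly p a < poly p b"
  by (rule DERIV_pos_imp_increasing_open[OF assms(1)])
     (use assms(2) poly_DERIV in \<open>blast, auto intro: continuous_intros\<close>)

lemma poly_sgn_const:
  fixes p :: "real poly"
  assumes "a < u" "u < b" "a < v" "v < b" "p \<noteq> 0 \<Longrightarrow> (\<And>x. a < x \<Longrightarrow> x < b \<Longrightarrow> poly p x \<noteq> 0)"
  shows "sgn (poly p u) = sgn (poly p v)"
proof (rule ccontr)
  assume ne: "\<not> ?thesis"
  then have p: "p \<noteq> 0" by auto
  have *: False if "x < y" "a < x" "y < b" "sgn (poly p x) \<noteq> sgn (poly p y)" for x y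
  proof -
    have nz: "poly p x \<noteq> 0" "poly p y \<noteq> 0" using assms(5)[OF p] that by auto
    have "\<exists>z. x < z \<and> z < y \<and> poly p z = 0"
    proof (cases "poly p x < 0")
      case True
      then show ?thesis using poly_IVT_pos[OF that(1), of p] nz that(4) by (auto simp: sgn_if split: if_splits)
    next
      case False
      then show ?thesis using poly_IVT_neg[OF that(1), of p] nz that(4) by (auto simp: sgn_if split: if_splits)
    qed
    then show False using assms(5)[OF p] that by force
  qed
  show False using *[of u v] *[of v u] ne assms by (cases u v rule: linorder_cases) auto
qed

text \<open>If \<open>p\<close> vanishes at \<open>u\<close>, then \<open>q\<close> changes sign
  between \<open>w1\<close> and \<open>w2\<close>. If \<open>p\<close> is positive at
  \<open>u\<close>, then \<open>q\<close> is positive at \<open>w2\<close>, and either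
  \<open>v\<close> itself serves or \<open>q\<close> takes half its value at \<open>w2\<close>
  strictly between \<open>v\<close> and \<open>w2\<close>. The negative case is symmetric.\<close>

lemma sgn_attained:
  fixes p q :: "real poly"
  assumes "poly p z1 < poly p u" "poly p u < poly p z2" "w1 < v" "v < w2"
    and "sgn (poly p z1) = sgn (poly q w1)" "sgn (poly p z2) = sgn (poly q w2)"
  shows "\<exists>w. w1 < w \<and> w < w2 \<and> sgn (poly q w) = sgn (poly p u)"
proof -
  consider "poly p u = 0" | "0 < poly p u" | "poly p u < 0" by linarith
  then show ?thesis
  proof cases
    case 1
    with assms have "poly q w1 < 0" "0 < poly q w2" by (auto simp: sgn_if split: if_splits)
    then show ?thesis using poly_IVT_pos[of w1 w2 q] assms(3,4) 1 by force
  next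
    case 2
    with assms have q2: "0 < poly q w2" by (auto simp: sgn_if split: if_splits)
    show ?thesis
    proof (cases "0 < poly q v")
      case True then show ?thesis using 2 assms(3,4) by (auto simp: sgn_if intro!: exI[of _ v])
    next
      case False
      then obtain w where "v < w" "w < w2" "poly (q - [:poly q w2 / 2:]) w = 0"
        using poly_IVT_pos[of v w2 "q - [:poly q w2 / 2:]"] q2 assms(4) by auto
      then show ?thesis using 2 q2 assms(3) by (auto simp: sgn_if intro!: exI[of _ w])
    qed
  next
    case 3
    with assms have q1: "poly q w1 < 0" by (auto simp: sgn_if split: if_splits)
    show ?thesis
    proof (cases "poly q v < 0")
      case True then show ?thesis using 3 assms(3,4) by (auto simp: sgn_if intro!: exI[of _ v])
    next
      case False
      then obtain w where "w1 < w" "w < v" "poly (q - [:poly q w1 / 2:]) w = 0"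
        using poly_IVT_pos[of w1 v "q - [:poly q w1 / 2:]"] q1 assms(3) by auto
      then show ?thesis using 3 q1 assms(4) by (auto simp: sgn_if intro!: exI[of _ w])
    qed
  qed
qed

section \<open>Extending matched families by one polynomial\<close>

definition is_root :: "'j set \<Rightarrow> ('j \<Rightarrow> real poly) \<Rightarrow> real \<Rightarrow> bool" where
  "is_root J P u \<longleftrightarrow> (\<exists>j\<in>J. P j \<noteq> 0 \<and> poly (P j) u = 0)"

lemma finite_is_root: "finite J \<Longrightarrow> finite {u. is_root J P u}"
proof -
  assume "finite J"
  then have "finite (\<Union>j\<in>{j\<in>J. P j \<noteq> 0}. {u. poly (P j) u = 0})"
    by (auto intro: poly_roots_finite)
  then show ?thesis by (rule finite_subset[rotated]) (auto simp: is_root_def)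
qed

text \<open>By convexity of the cells, two distinct points with the same signs enclose an interval
  with these signs; a nonzero polynomial would vanish on all of it.\<close>

lemma is_root_unique:
  assumes c: "convex_cells r J P" and "-r \<le> u" "u \<le> r" "-r \<le> w" "w \<le> r"
    and "is_root J P u" "agree J P u P w"
  shows "u = w"
proof (rule ccontr)
  assume "u \<noteq> w"
  obtain j where j: "j \<in> J" "P j \<noteq> 0" "poly (P j) u = 0" using assms(6) by (auto simp: is_root_def)
  have "poly (P j) x = 0" if "min u w < x" "x < max u w" for x
  proof -
    have "agree J P u P x"
    proof (cases "u < w")
      case True
      then show ?thesis using that assms by (intro convex_cellsD[OF c assms(7)]) auto
    next
      case False
      have "agree J P w P x"
        using that assms False by (intro convex_cellsD[OF c agree_sym[OF assms(7)]]) auto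
      then show ?thesis using assms(7) agree_trans by blast
    qed
    from agreeD[OF this j(1)] j(3) show ?thesis by (simp add: sgn_zero_iff)
  qed
  then have "P j = 0" using \<open>u \<noteq> w\<close> by (intro poly_eq_0_if_zero_on_interval[of "min u w" "max u w"]) auto
  with j show False by simp
qed

lemma matched_eq_0:
  assumes m: "matched r J P Q" and r: "0 < r" and j: "j \<in> J" "Q j = 0"
  shows "P j = 0"
proof (rule poly_eq_0_if_zero_on_interval)
  show "-r < r" using r by simp
  fix x assume "-r < x" "x < r"
  then obtain v where "agree J P x Q v" using m unfolding matched_def by (meson atLeastAtMost_iff less_imp_le)
  from agreeD[OF this j(1)] j(2) show "poly (P j) x = 0" by (simp add: sgn_zero_iff)
qed

lemma is_root_agree:
  assumes "matched r J P Q" "0 < r" "agree J P u Q v" "is_root J P u"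
  shows "is_root J Q v"
proof -
  obtain j where j: "j \<in> J" "P j \<noteq> 0" "poly (P j) u = 0" using assms(4) by (auto simp: is_root_def)
  have "Q j \<noteq> 0" using matched_eq_0[OF assms(1,2) j(1)] j(2) by blast
  moreover have "poly (Q j) v = 0" using agreeD[OF assms(3) j(1)] j(3) by (simp add: sgn_zero_iff)
  ultimately show ?thesis using j(1) by (auto simp: is_root_def)
qed

text \<open>The inductive step of Thom's lemma: on a cell the derivative of \<open>P A\<close> has
  constant sign, so \<open>P A\<close> is monotone there and its sign cannot change between two
  points where it is the same.\<close>

lemma convex_cells_insert:
  assumes c: "convex_cells r J P" and d: "d \<in> J" "P d = pderiv (P A)"
  shows "convex_cells r (insert A J) P"
  unfolding convex_cells_def
proof (intro allI impI)
  fix a b c' assume h: "-r \<le> a" "a < b" "b < c'" "c' \<le> r" "agree (insert A J) P a P c'"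
  have cell: "agree J P a P x" if "a \<le> x" "x \<le> c'" for x
    using convex_cellsD[OF c _ h(1,4) that] h(5) by (simp add: agree_insert)
  have ds: "sgn (poly (pderiv (P A)) a) = sgn (poly (pderiv (P A)) x)" if "a \<le> x" "x \<le> c'" for x
    using agreeD[OF cell[OF that] d(1)] d(2) by simp
  have ac: "sgn (poly (P A) a) = sgn (poly (P A) c')" using h by (simp add: agree_insert)
  have "sgn (poly (P A) a) = sgn (poly (P A) b)"
  proof (cases "0 \<le> poly (pderiv (P A)) a")
    case True
    have nn: "0 \<le> poly (pderiv (P A)) x" if "a \<le> x" "x \<le> c'" for x
      using ds[OF that] True by (auto simp: sgn_if split: if_splits)
    have "poly (P A) a \<le> poly (P A) b" "poly (P A) b \<le> poly (P A) c'"
      using h nn by (auto intro!: poly_mono_on_interval)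
    then show ?thesis using ac by (auto simp: sgn_if split: if_splits)
  next
    case False
    have nn: "0 \<le> poly (pderiv (- P A)) x" if "a \<le> x" "x \<le> c'" for x
      using ds[OF that] False by (auto simp: sgn_if pderiv_minus split: if_splits)
    have "poly (- P A) a \<le> poly (- P A) b" "poly (- P A) b \<le> poly (- P A) c'"
      by (rule poly_mono_on_interval; use h nn in force)+
    then show ?thesis using ac by (auto simp: sgn_if split: if_splits)
  qed
  then show "agree (insert A J) P a P b" using cell h by (simp add: agree_insert)
qed

text \<open>Both points lie in one cell of \<open>J\<close> and are separated by the sign of
  \<open>P A\<close> alone. The derivative belongs to \<open>J\<close> and has the same sign on the
  matched cells, so \<open>P A\<close> and \<open>Q A\<close> are monotone in the same direction and
  the order carries over.\<close>

lemma order_on_cell: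
  assumes cP: "convex_cells r J P" and cQ: "convex_cells r J Q"
    and d: "d \<in> J" "P d = pderiv (P A)" "Q d = pderiv (Q A)"
    and b: "u \<in> {-r..r}" "u' \<in> {-r..r}" "v \<in> {-r..r}" "v' \<in> {-r..r}"
    and ag: "agree (insert A J) P u Q v" "agree (insert A J) P u' Q v'" and lt: "u < u'"
    and J: "agree J P u P u'" and n: "sgn (poly (P A) u) \<noteq> sgn (poly (P A) u')"
  shows "v < v'"
proof (rule ccontr)
  assume "\<not> v < v'"
  have A1: "sgn (poly (P A) u) = sgn (poly (Q A) v)" and A2: "sgn (poly (P A) u') = sgn (poly (Q A) v')"
    and J1: "agree J P u Q v" and J2: "agree J P u' Q v'" using ag by (auto simp: agree_insert)
  have vv: "v' < v" using \<open>\<not> v < v'\<close> A1 A2 n by (cases "v = v'") auto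
  have Jv: "agree J Q v' Q v" using J1 J2 J agree_sym agree_trans by metis
  have cellP: "agree J P u P x" if "u \<le> x" "x \<le> u'" for x
    using convex_cellsD[OF cP J _ _ that] b by simp
  have cellQ: "agree J Q v' Q x" if "v' \<le> x" "x \<le> v" for x
    using convex_cellsD[OF cQ Jv _ _ that] b by simp
  have dP: "sgn (poly (pderiv (P A)) x) = sgn (poly (pderiv (P A)) u)" if "u \<le> x" "x \<le> u'" for x
    using agreeD[OF cellP[OF that] d(1)] d(2) by simp
  have dQ: "sgn (poly (pderiv (Q A)) x) = sgn (poly (pderiv (P A)) u)" if "v' \<le> x" "x \<le> v" for x
    using agreeD[OF cellQ[OF that] d(1)] agreeD[OF J1 d(1)] agreeD[OF Jv d(1)] d(2,3) by simp
  show False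
  proof (cases "0 \<le> poly (pderiv (P A)) u")
    case True
    have "poly (P A) u \<le> poly (P A) u'"
      using lt True dP by (intro poly_mono_on_interval) (force simp: sgn_if split: if_splits)+
    moreover have "poly (Q A) v' \<le> poly (Q A) v"
      using vv True dQ by (intro poly_mono_on_interval) (force simp: sgn_if split: if_splits)+
    ultimately show False using n A1 A2 by (auto simp: sgn_if split: if_splits)
  next
    case False
    have "poly (- P A) u \<le> poly (- P A) u'"
      using lt False dP by (intro poly_mono_on_interval) (force simp: sgn_if pderiv_minus split: if_splits)+
    moreover have "poly (- Q A) v' \<le> poly (- Q A) v"
      using vv False dQ by (intro poly_mono_on_interval) (force simp: sgn_if pderiv_minus split: if_splits)+
    ultimately show False using n A1 A2 by (auto simp: sgn_if split: if_splits)
  qed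
qed

text \<open>If \<open>u\<close> is a root, \<open>root\<close> compares the signs directly.
  Otherwise \<open>u\<close> lies between consecutive roots \<open>z1\<close> and \<open>z2\<close>,
  which exist because the end points are roots; their partners \<open>w1\<close>, \<open>w2\<close>
  enclose a root-free interval around \<open>v0\<close>. There the signs of \<open>J\<close> are
  constant, while \<open>P A\<close> is constant or strictly monotone between \<open>z1\<close> and
  \<open>z2\<close>, so its sign at \<open>u\<close> is attained by \<open>Q A\<close> as
  well.\<close>

lemma exists_on_cell:
  assumes r: "0 < r" and fin: "finite J"
    and ends: "is_root J P (-r)" "is_root J P r"
    and cQ: "convex_cells r J Q"
    and mPQ: "matched r J P Q" and mQP: "matched r J Q P"
    and d: "d \<in> J" "P d = pderiv (P A)" "Q d = pderiv (Q A)"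
    and root: "\<And>u v. u \<in> {-r..r} \<Longrightarrow> v \<in> {-r..r} \<Longrightarrow> agree J P u Q v \<Longrightarrow> is_root J P u \<Longrightarrow>
       sgn (poly (P A) u) = sgn (poly (Q A) v)"
    and u: "u \<in> {-r..r}"
  shows "\<exists>v\<in>{-r..r}. agree (insert A J) P u Q v"
proof -
  have ex: "\<exists>v\<in>{-r..r}. agree J P u Q v" if "u \<in> {-r..r}" for u
    using mPQ that by (rule matched_ex)
  have exQ: "\<exists>v\<in>{-r..r}. agree J Q u P v" if "u \<in> {-r..r}" for u
    using mQP that by (rule matched_ex)
  have ordP: "v < v'" if "u \<in> {-r..r}" "u' \<in> {-r..r}" "v \<in> {-r..r}" "v' \<in> {-r..r}"
    "agree J P u Q v" "agree J P u' Q v'" "u < u'" "\<not> agree J P u P u'" for u u' v v'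
    by (rule matched_less[OF mPQ that(5-8,1-4)])
  have ordQ: "v < v'" if "u \<in> {-r..r}" "u' \<in> {-r..r}" "v \<in> {-r..r}" "v' \<in> {-r..r}"
    "agree J Q u P v" "agree J Q u' P v'" "u < u'" "\<not> agree J Q u Q u'" for u u' v v'
    by (rule matched_less[OF mQP that(5-8,1-4)])
  obtain v0 where v0: "v0 \<in> {-r..r}" "agree J P u Q v0" using ex[OF u] ..
  show ?thesis
  proof (cases "is_root J P u")
    case True
    then show ?thesis using v0 root[OF u v0] by (auto simp: agree_insert)
  next
    case False
    let ?L = "{z. is_root J P z \<and> -r \<le> z \<and> z < u}" and ?U = "{z. is_root J P z \<and> u < z \<and> z \<le> r}"
    have u': "-r < u" "u < r" using u False ends by (auto simp: order_le_less)
    have finL: "finite ?L" and finU: "finite ?U"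
      by (rule finite_subset[OF _ finite_is_root[OF fin, of P]]; blast)+
    have neL: "?L \<noteq> {}" and neU: "?U \<noteq> {}" using u' ends r by auto
    define z1 z2 where "z1 = Max ?L" and "z2 = Min ?U"
    have z1: "is_root J P z1" "-r \<le> z1" "z1 < u" using Max_in[OF finL neL] by (auto simp: z1_def)
    have z2: "is_root J P z2" "z2 \<le> r" "u < z2" using Min_in[OF finU neU] by (auto simp: z2_def)
    have nroot: "\<not> is_root J P x" if "z1 < x" "x < z2" for x
    proof
      assume R: "is_root J P x"
      consider "x < u" | "x = u" | "u < x" by linarith
      then show False
      proof cases
        case 1
        then have "x \<le> z1" using Max_ge[OF finL, of x] R z1 that by (auto simp: z1_def)
        with that show False by simp
      next
        case 2 then show False using R False by simp
      next
        case 3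
        then have "z2 \<le> x" using Min_le[OF finU, of x] R z2 that by (auto simp: z2_def)
        with that show False by simp
      qed
    qed
    have z1r: "z1 \<in> {-r..r}" and z2r: "z2 \<in> {-r..r}" using z1 z2 u' by auto
    obtain w1 where w1: "w1 \<in> {-r..r}" "agree J P z1 Q w1" using ex[OF z1r] ..
    obtain w2 where w2: "w2 \<in> {-r..r}" "agree J P z2 Q w2" using ex[OF z2r] ..
    have nag: "\<not> agree J P z P u \<and> \<not> agree J P u P z" if "is_root J P z" for z
      using that False unfolding is_root_def agree_def by (metis sgn_0_0)
    have w1v: "w1 < v0" using ordP[OF z1r u w1(1) v0(1) w1(2) v0(2) z1(3)] nag[OF z1(1)] by simp
    have vw2: "v0 < w2" using ordP[OF u z2r v0(1) w2(1) v0(2) w2(2) z2(3)] nag[OF z2(1)] by simp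
    \<comment> \<open>A root of \<open>Q\<close> here would be matched with a root of
      \<open>P\<close> strictly between \<open>z1\<close> and \<open>z2\<close>: by uniqueness of
      roots its sign vector differs from those of \<open>w1\<close> and \<open>w2\<close>, so the
      order is preserved.\<close>
    have nrootQ: "\<not> is_root J Q x" if x: "w1 < x" "x < w2" for x
    proof
      assume R: "is_root J Q x"
      have xr: "x \<in> {-r..r}" using x w1 w2 by auto
      obtain z where z: "z \<in> {-r..r}" "agree J Q x P z" using exQ[OF xr] ..
      have Rz: "is_root J P z" by (rule is_root_agree[OF mQP r z(2) R])
      have n1: "\<not> agree J Q w1 Q x" "\<not> agree J Q x Q w2"
        using is_root_unique[OF cQ _ _ _ _ R, of w1] is_root_unique[OF cQ _ _ _ _ R, of w2]
          x xr w1(1) w2(1) agree_sym by fastforce+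
      have "z1 < z" using ordQ[OF w1(1) xr z1r z(1) agree_sym[OF w1(2)] z(2) x(1) n1(1)] .
      moreover have "z < z2" using ordQ[OF xr w2(1) z(1) z2r z(2) agree_sym[OF w2(2)] x(2) n1(2)] .
      ultimately show False using nroot Rz by blast
    qed
    have cellQ: "agree J Q v0 Q x" if "w1 < x" "x < w2" for x
      unfolding agree_def
    proof
      fix j assume "j \<in> J"
      show "sgn (poly (Q j) v0) = sgn (poly (Q j) x)"
        by (rule poly_sgn_const[OF w1v vw2 that]) (use nrootQ \<open>j \<in> J\<close> in \<open>auto simp: is_root_def\<close>)
    qed
    have s1: "sgn (poly (P A) z1) = sgn (poly (Q A) w1)" by (rule root[OF z1r w1 z1(1)])
    have s2: "sgn (poly (P A) z2) = sgn (poly (Q A) w2)" by (rule root[OF z2r w2 z2(1)])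
    have dsgn: "sgn (poly (pderiv (P A)) x) = sgn (poly (pderiv (P A)) u)" if "z1 < x" "x < z2" for x
      by (rule poly_sgn_const[OF that z1(3) z2(3)]) (use nroot d in \<open>force simp: is_root_def\<close>)
    consider "poly (pderiv (P A)) u = 0" | "0 < poly (pderiv (P A)) u" | "poly (pderiv (P A)) u < 0" by linarith
    then have "\<exists>w. w1 < w \<and> w < w2 \<and> sgn (poly (Q A) w) = sgn (poly (P A) u)"
    proof cases
      \<comment> \<open>\<open>u\<close> is not a root, so the derivative vanishes at
        \<open>u\<close> only as the zero polynomial; then \<open>P A\<close> and \<open>Q A\<close>
        are constants, and their signs already agree at \<open>z1\<close> and
        \<open>w1\<close>.\<close>
      case 1
      then have P0: "P d = 0" using False d by (auto simp: is_root_def)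
      then have Q0: "Q d = 0" using matched_eq_0[OF mQP r d(1)] by simp
      obtain a where a: "P A = [:a:]" using P0 d(2) by (metis pderiv_iszero)
      obtain b where b: "Q A = [:b:]" using Q0 d(3) by (metis pderiv_iszero)
      show ?thesis using w1v vw2 s1 a b by auto
    next
      case 2
      have "0 < poly (pderiv (P A)) x" if "z1 < x" "x < z2" for x
        using dsgn[OF that] 2 by (auto simp: sgn_if split: if_splits)
      then have "poly (P A) z1 < poly (P A) u" "poly (P A) u < poly (P A) z2"
        using z1 z2 by (auto intro!: poly_strict_mono_on_interval)
      then show ?thesis using sgn_attained[OF _ _ w1v vw2 s1 s2] by blast
    next
      case 3
      have "0 < poly (pderiv (- P A)) x" if "z1 < x" "x < z2" for x
        using dsgn[OF that] 3 by (auto simp: sgn_if pderiv_minus split: if_splits)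
      then have "poly (- P A) z1 < poly (- P A) u" "poly (- P A) u < poly (- P A) z2"
        by - (rule poly_strict_mono_on_interval; use z1 z2 in force)+
      then have "\<exists>w. w1 < w \<and> w < w2 \<and> sgn (poly (- Q A) w) = sgn (poly (- P A) u)"
        using sgn_attained[of "- P A" z1 u z2 w1 v0 w2 "- Q A"] w1v vw2 s1 s2 by (simp add: sgn_minus)
      then show ?thesis by (simp add: sgn_minus)
    qed
    then obtain w where "w1 < w" "w < w2" "sgn (poly (Q A) w) = sgn (poly (P A) u)" by blast
    then show ?thesis using cellQ agree_trans[OF v0(2)] w1(1) w2(1)
      by (intro bexI[of _ w]) (auto simp: agree_insert)
  qed
qed

definition aligned :: "real \<Rightarrow> 'j set \<Rightarrow> ('j \<Rightarrow> real poly) \<Rightarrow> ('j \<Rightarrow> real poly) \<Rightarrow> bool" where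
  "aligned r J P Q \<longleftrightarrow> convex_cells r J P \<and> convex_cells r J Q \<and> matched r J P Q \<and> matched r J Q P"

lemma matched_insert:
  assumes r: "0 < r" and fin: "finite J"
    and ends: "is_root J P (-r)" "is_root J P r"
    and al: "aligned r J P Q"
    and d: "d \<in> J" "P d = pderiv (P A)" "Q d = pderiv (Q A)"
    and root: "\<And>u v. u \<in> {-r..r} \<Longrightarrow> v \<in> {-r..r} \<Longrightarrow> agree J P u Q v \<Longrightarrow> is_root J P u \<Longrightarrow>
       sgn (poly (P A) u) = sgn (poly (Q A) v)"
  shows "matched r (insert A J) P Q"
proof -
  have al': "convex_cells r J P" "convex_cells r J Q" "matched r J P Q" "matched r J Q P"
    using al by (auto simp: aligned_def)
  show ?thesis
    unfolding matched_def
  proof (intro conjI ballI impI)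
    show "\<exists>v\<in>{-r..r}. agree (insert A J) P u Q v" if "u \<in> {-r..r}" for u
      by (rule exists_on_cell[OF r fin ends al'(2,3,4) d root that])
    fix u u' v v' assume h: "u \<in> {-r..r}" "u' \<in> {-r..r}" "v \<in> {-r..r}" "v' \<in> {-r..r}"
      "agree (insert A J) P u Q v" "agree (insert A J) P u' Q v'" "u < u'" "\<not> agree (insert A J) P u P u'"
    show "v < v'"
    proof (cases "agree J P u P u'")
      case True
      then show ?thesis using order_on_cell[OF al'(1,2) d h(1-7)] h(8)
        by (simp add: agree_insert)
    next
      case False
      then show ?thesis using matched_less[OF al'(3) _ _ h(7) _ h(1-4)] h(5,6) by (simp add: agree_insert)
    qed
  qed
qed

lemma aligned_insert:
  assumes r: "0 < r" and fin: "finite J"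
    and ends: "is_root J P (-r)" "is_root J P r" "is_root J Q (-r)" "is_root J Q r"
    and al: "aligned r J P Q"
    and d: "d \<in> J" "P d = pderiv (P A)" "Q d = pderiv (Q A)"
    and root: "\<And>u v. u \<in> {-r..r} \<Longrightarrow> v \<in> {-r..r} \<Longrightarrow> agree J P u Q v \<Longrightarrow> is_root J P u \<Longrightarrow>
       sgn (poly (P A) u) = sgn (poly (Q A) v)"
  shows "aligned r (insert A J) P Q"
proof -
  have al': "convex_cells r J P" "convex_cells r J Q" "matched r J P Q" "matched r J Q P"
    using al by (auto simp: aligned_def)
  have m1: "matched r (insert A J) P Q" by (rule matched_insert[OF r fin ends(1,2) al d root])
  have m2: "matched r (insert A J) Q P"
  proof (rule matched_insert[OF r fin ends(3,4) _ d(1,3,2)])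
    show "aligned r J Q P" using al' by (simp add: aligned_def)
    \<comment> \<open>\<open>root\<close> speaks of roots of \<open>P\<close>; as a root of
      \<open>Q\<close> is matched only with roots of \<open>P\<close>, the condition is
      symmetric.\<close>
    fix u v assume h: "u \<in> {-r..r}" "v \<in> {-r..r}" "agree J Q u P v" "is_root J Q u"
    then have "is_root J P v" using is_root_agree[OF al'(4) r h(3,4)] by simp
    then show "sgn (poly (Q A) u) = sgn (poly (P A) v)" using root[OF h(2,1) agree_sym[OF h(3)]] by simp
  qed
  show ?thesis unfolding aligned_def using m1 m2 al' d convex_cells_insert by metis
qed

section \<open>Polynomials with coefficients in a ring of functions\<close>

definition function_ring :: "('p \<Rightarrow> real) set \<Rightarrow> bool" where
  "function_ring R \<longleftrightarrow> (\<forall>c. (\<lambda>_. c) \<in> R) \<and>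
     (\<forall>f\<in>R. \<forall>g\<in>R. (\<lambda>p. f p + g p) \<in> R \<and> (\<lambda>p. f p * g p) \<in> R)"

lemma function_ring_const: "function_ring R \<Longrightarrow> (\<lambda>_. c) \<in> R"
  and function_ring_add: "function_ring R \<Longrightarrow> f \<in> R \<Longrightarrow> g \<in> R \<Longrightarrow> (\<lambda>p. f p + g p) \<in> R"
  and function_ring_mult: "function_ring R \<Longrightarrow> f \<in> R \<Longrightarrow> g \<in> R \<Longrightarrow> (\<lambda>p. f p * g p) \<in> R"
  by (auto simp: function_ring_def)

lemma function_ring_diff:
  assumes "function_ring R" "f \<in> R" "g \<in> R" shows "(\<lambda>p. f p - g p) \<in> R"
  using function_ring_add[OF assms(1,2) function_ring_mult[OF assms(1) function_ring_const[OF assms(1), of "-1"] assms(3)]]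
  by simp

lemma function_ring_sum:
  assumes "function_ring R" "\<And>i. i \<in> A \<Longrightarrow> f i \<in> R" shows "(\<lambda>p. \<Sum>i\<in>A. f i p) \<in> R"
  using assms(2)
  by (induction A rule: infinite_finite_induct)
     (auto intro: function_ring_add[OF assms(1)] function_ring_const[OF assms(1)])

definition param_poly :: "('p \<Rightarrow> real) set \<Rightarrow> nat \<Rightarrow> ('p \<Rightarrow> real poly) \<Rightarrow> bool" where
  "param_poly R d F \<longleftrightarrow> (\<forall>p. degree (F p) \<le> d) \<and> (\<forall>i. (\<lambda>p. coeff (F p) i) \<in> R)"

definition truncate :: "nat \<Rightarrow> ('p \<Rightarrow> real poly) \<Rightarrow> 'p \<Rightarrow> real poly" where
  "truncate d F = (\<lambda>p. F p - monom (coeff (F p) d) d)"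

lemma param_poly_deriv:
  assumes "function_ring R" "param_poly R (Suc d) F" shows "param_poly R d (\<lambda>p. pderiv (F p))"
  unfolding param_poly_def
proof (intro conjI allI)
  show "degree (pderiv (F p)) \<le> d" for p
    using assms(2) by (simp add: param_poly_def degree_pderiv le_diff_conv)
  show "(\<lambda>p. coeff (pderiv (F p)) i) \<in> R" for i
    unfolding coeff_pderiv
    by (rule function_ring_mult[OF assms(1) function_ring_const[OF assms(1)]])
       (use assms(2) in \<open>simp add: param_poly_def\<close>)
qed

lemma param_poly_truncate:
  assumes "function_ring R" "param_poly R (Suc d) F" shows "param_poly R d (truncate (Suc d) F)"
  unfolding param_poly_def
proof (intro conjI allI)
  have c: "coeff (truncate (Suc d) F p) i = (if i = Suc d then 0 else coeff (F p) i)" for p i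
    by (simp add: truncate_def)
  show "degree (truncate (Suc d) F p) \<le> d" for p
  proof (rule degree_le, intro allI impI)
    fix i assume "d < i"
    moreover have "degree (F p) \<le> Suc d" using assms(2) by (simp add: param_poly_def)
    ultimately show "coeff (truncate (Suc d) F p) i = 0"
      unfolding c by (auto intro: coeff_eq_0)
  qed
  show "(\<lambda>p. coeff (truncate (Suc d) F p) i) \<in> R" for i
    unfolding c using assms function_ring_const[OF assms(1), of 0]
    by (cases "i = Suc d") (auto simp: param_poly_def)
qed

lemma param_poly_eval:
  assumes "function_ring R" "param_poly R d F" shows "(\<lambda>p. poly (F p) c) \<in> R"
proof -
  have "poly (F p) c = (\<Sum>i\<le>d. coeff (F p) i * c ^ i)" for p
  proof -
    have "degree (F p) \<le> d" using assms(2) by (simp add: param_poly_def)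
    then have "(\<Sum>i\<le>degree (F p). coeff (F p) i * c ^ i) = (\<Sum>i\<le>d. coeff (F p) i * c ^ i)"
      by (intro sum.mono_neutral_left) (auto simp: coeff_eq_0)
    then show ?thesis by (simp add: poly_altdef)
  qed
  moreover have "(\<lambda>p. \<Sum>i\<le>d. coeff (F p) i * c ^ i) \<in> R"
    by (intro function_ring_sum[OF assms(1)] function_ring_mult[OF assms(1)] function_ring_const[OF assms(1)])
       (use assms(2) in \<open>simp add: param_poly_def\<close>)
  ultimately show ?thesis by simp
qed

text \<open>Pseudo-division by \<open>Q\<close>, recorded through its effect at the roots of
  \<open>Q\<close>. The power of the leading coefficient replaces division, which a ring of
  functions does not allow; signs can still be compared where that coefficient is nonzero.\<close>

definition pseudo_rem :: "nat \<Rightarrow> ('p \<Rightarrow> real poly) \<Rightarrow> ('p \<Rightarrow> real poly) \<Rightarrow> ('p \<Rightarrow> real poly) \<Rightarrow> bool" where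
  "pseudo_rem d Q F S \<longleftrightarrow>
     (\<exists>m. \<forall>p x. poly (Q p) x = 0 \<longrightarrow> coeff (Q p) d ^ m * poly (F p) x = poly (S p) x)"

lemma pseudo_rem_exists:
  assumes R: "function_ring R" and Q: "param_poly R (Suc d) Q" and F: "param_poly R f F"
  shows "\<exists>S. param_poly R d S \<and> pseudo_rem (Suc d) Q F S"
  using F
proof (induction f arbitrary: F)
  case 0
  then have "param_poly R d F" by (auto simp: param_poly_def)
  then show ?case by (auto simp: pseudo_rem_def intro!: exI[of _ F] exI[of _ 0])
next
  case (Suc f)
  show ?case
  proof (cases "Suc f \<le> d")
    case True
    then have "param_poly R d F" using Suc.prems by (auto simp: param_poly_def intro: order_trans)
    then show ?thesis by (auto simp: pseudo_rem_def intro!: exI[of _ F] exI[of _ 0])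
  next
    case False
    \<comment> \<open>The leading terms cancel, the shift being
      \<open>Suc f - Suc d = f - d\<close>; at a root of \<open>Q\<close> the second summand
      vanishes.\<close>
    define F1 where "F1 = (\<lambda>p. smult (coeff (Q p) (Suc d)) (F p) -
        smult (coeff (F p) (Suc f)) (monom 1 (f - d) * Q p))"
    have c: "coeff (F1 p) i = coeff (Q p) (Suc d) * coeff (F p) i -
        coeff (F p) (Suc f) * (if i < f - d then 0 else coeff (Q p) (i - (f - d)))" for p i
      by (simp add: F1_def coeff_monom_mult)
    have R': "(\<lambda>p. coeff (F p) i) \<in> R" "(\<lambda>p. coeff (Q p) i) \<in> R" for i
      using Suc.prems Q by (auto simp: param_poly_def)
    have "param_poly R f F1"
      unfolding param_poly_def
    proof (intro conjI allI)
      show "(\<lambda>p. coeff (F1 p) i) \<in> R" for i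
        unfolding c by (intro function_ring_diff[OF R] function_ring_mult[OF R] R')
          (use R' function_ring_const[OF R] in \<open>cases "i < f - d"; simp\<close>)
      show "degree (F1 p) \<le> f" for p
      proof (rule degree_le, intro allI impI)
        fix i assume "f < i"
        have dF: "degree (F p) \<le> Suc f" and dQ: "degree (Q p) \<le> Suc d"
          using Suc.prems Q by (auto simp: param_poly_def)
        show "coeff (F1 p) i = 0"
        proof (cases "i = Suc f")
          case True
          then show ?thesis using False by (simp add: c Suc_diff_le)
        next
          case i: False
          then have "coeff (F p) i = 0" "coeff (Q p) (i - (f - d)) = 0"
            using \<open>f < i\<close> dF dQ False by (auto intro!: coeff_eq_0)
          then show ?thesis by (simp add: c)
        qed
      qed
    qed
    from Suc.IH[OF this] obtain S m where S: "param_poly R d S"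
      and m: "\<And>p x. poly (Q p) x = 0 \<Longrightarrow> coeff (Q p) (Suc d) ^ m * poly (F1 p) x = poly (S p) x"
      by (auto simp: pseudo_rem_def)
    have "coeff (Q p) (Suc d) ^ Suc m * poly (F p) x = poly (S p) x" if "poly (Q p) x = 0" for p x
      using m[OF that] that by (simp add: F1_def mult_ac)
    with S show ?thesis unfolding pseudo_rem_def by blast
  qed
qed

text \<open>
  The first component of an element of \<open>J\<close> is a formal degree; the leading coefficient may vanish for
  some parameters, which is why truncations are adjoined.
\<close>

definition closed_above :: "nat \<Rightarrow> (nat \<times> ('p \<Rightarrow> real poly)) set \<Rightarrow> bool" where
  "closed_above e J \<longleftrightarrow> (\<forall>d\<ge>e.
     (\<forall>F. (Suc d, F) \<in> J \<longrightarrow> (d, \<lambda>p. pderiv (F p)) \<in> J \<and> (d, truncate (Suc d) F) \<in> J) \<and>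
     (\<forall>f F Q. (f, F) \<in> J \<longrightarrow> (Suc d, Q) \<in> J \<longrightarrow> Suc d \<le> f \<longrightarrow>
        (\<exists>S. (d, S) \<in> J \<and> pseudo_rem (Suc d) Q F S)))"

text \<open>Downward induction on \<open>e\<close>. Closing at level \<open>e\<close> involves only
  members of formal degree above \<open>e\<close>, while everything adjoined has formal degree
  \<open>e\<close>; so the levels already treated stay closed and the family stays finite.\<close>

lemma closed_above_exists:
  assumes R: "function_ring R" and "e \<le> n"
    and "finite J" "\<And>d F. (d, F) \<in> J \<Longrightarrow> param_poly R d F \<and> d \<le> n"
  shows "\<exists>J'. J \<subseteq> J' \<and> finite J' \<and> (\<forall>(d, F)\<in>J'. param_poly R d F \<and> d \<le> n) \<and> closed_above e J'"
  using \<open>e \<le> n\<close>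
proof (induction rule: inc_induct)
  case base
  have "closed_above n J" unfolding closed_above_def using assms(4) by force
  then show ?case using assms(3,4) by blast
next
  case (step e)
  then obtain J1 where J1: "J \<subseteq> J1" "finite J1" "\<And>d F. (d, F) \<in> J1 \<Longrightarrow> param_poly R d F \<and> d \<le> n"
    and cl: "closed_above (Suc e) J1" by blast
  have "\<forall>X. \<exists>S. fst X \<in> J1 \<longrightarrow> (Suc e, snd X) \<in> J1 \<longrightarrow>
      param_poly R e S \<and> pseudo_rem (Suc e) (snd X) (snd (fst X)) S"
    using pseudo_rem_exists[OF R] J1(3) by (metis prod.collapse)
  then obtain S where S: "\<And>f F Q. (f, F) \<in> J1 \<Longrightarrow> (Suc e, Q) \<in> J1 \<Longrightarrow>
      param_poly R e (S ((f, F), Q)) \<and> pseudo_rem (Suc e) Q F (S ((f, F), Q))"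
    by (metis fst_conv snd_conv)
  define L where "L = snd ` {j\<in>J1. fst j = Suc e}"
  have L: "F \<in> L \<longleftrightarrow> (Suc e, F) \<in> J1" for F by (force simp: L_def)
  have finL: "finite L" using J1(2) by (simp add: L_def)
  define N where "N = (\<lambda>F p. pderiv (F p)) ` L \<union> truncate (Suc e) ` L \<union> S ` (J1 \<times> L)"
  define J2 where "J2 = J1 \<union> Pair e ` N"
  have N: "param_poly R e F" if "F \<in> N" for F
    using that S J1(3) L param_poly_deriv[OF R] param_poly_truncate[OF R] unfolding N_def by auto
  have old: "(f, F) \<in> J2 \<longleftrightarrow> (f, F) \<in> J1" if "e < f" for f F
    using that by (auto simp: J2_def)
  have "closed_above e J2"
    unfolding closed_above_def
  proof (intro allI impI)
    fix d assume "e \<le> d"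
    show "(\<forall>F. (Suc d, F) \<in> J2 \<longrightarrow> (d, \<lambda>p. pderiv (F p)) \<in> J2 \<and> (d, truncate (Suc d) F) \<in> J2) \<and>
     (\<forall>f F Q. (f, F) \<in> J2 \<longrightarrow> (Suc d, Q) \<in> J2 \<longrightarrow> Suc d \<le> f \<longrightarrow>
        (\<exists>S. (d, S) \<in> J2 \<and> pseudo_rem (Suc d) Q F S))"
    proof (intro conjI allI impI)
      fix F assume "(Suc d, F) \<in> J2"
      then have F: "(Suc d, F) \<in> J1" using old \<open>e \<le> d\<close> by simp
      have "(d, \<lambda>p. pderiv (F p)) \<in> J2 \<and> (d, truncate (Suc d) F) \<in> J2"
      proof (cases "d = e")
        case True with F L[of F] show ?thesis by (auto simp: J2_def N_def)
      next
        case False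
        then have "Suc e \<le> d" using \<open>e \<le> d\<close> by simp
        then show ?thesis using cl F unfolding closed_above_def J2_def by blast
      qed
      then show "(d, \<lambda>p. pderiv (F p)) \<in> J2" "(d, truncate (Suc d) F) \<in> J2" by auto
    next
      fix f F Q assume h: "(f, F) \<in> J2" "(Suc d, Q) \<in> J2" "Suc d \<le> f"
      then have FQ: "(f, F) \<in> J1" "(Suc d, Q) \<in> J1" using old \<open>e \<le> d\<close> by auto
      show "\<exists>S. (d, S) \<in> J2 \<and> pseudo_rem (Suc d) Q F S"
      proof (cases "d = e")
        case True
        then have "S ((f, F), Q) \<in> N" using FQ L[of Q] by (auto simp: N_def)
        then show ?thesis using True S[OF FQ(1), of Q] FQ(2) by (auto simp: J2_def)
      next
        case False
        then have "Suc e \<le> d" using \<open>e \<le> d\<close> by simp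
        then have "\<exists>S. (d, S) \<in> J1 \<and> pseudo_rem (Suc d) Q F S"
          using cl FQ h(3) unfolding closed_above_def by blast
        then show ?thesis by (auto simp: J2_def)
      qed
    qed
  qed
  moreover have "finite J2" using J1(2) finL by (simp add: J2_def N_def)
  moreover have "J \<subseteq> J2" using J1(1) by (auto simp: J2_def)
  moreover have "\<forall>(d, F)\<in>J2. param_poly R d F \<and> d \<le> n"
    using J1(3) N step.hyps by (auto simp: J2_def)
  ultimately show ?case by blast
qed

section \<open>Quantifier elimination by matching sign vectors\<close>

lemma aligned_ends:
  assumes r: "0 < r" and P: "\<And>j. j \<in> E \<Longrightarrow> P j = Q j" and E: "P ` E = {[:r, 1:], [:-r, 1:], 0}"
  shows "aligned r E P Q"
proof -
  have ag: "agree E P u P v \<longleftrightarrow> sgn (r + u) = sgn (r + v) \<and> sgn (u - r) = sgn (v - r)" for u v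
  proof -
    have "agree E P u P v \<longleftrightarrow> (\<forall>p\<in>P ` E. sgn (poly p u) = sgn (poly p v))" by (auto simp: agree_def)
    then show ?thesis unfolding E by (simp add: algebra_simps)
  qed
  have eq: "agree E Q u Q v = agree E P u P v" "agree E P u Q v = agree E P u P v"
    "agree E Q u P v = agree E P u P v" for u v
    using P by (auto simp: agree_def)
  have c: "convex_cells r E P" unfolding convex_cells_def ag
    using r by (auto simp: sgn_if split: if_splits)
  \<comment> \<open>The cells in \<open>[-r, r]\<close> are the two end points and the open interval
    between them, whatever the parameter.\<close>
  have ag': "agree E P u P v \<longleftrightarrow> (u = -r \<longleftrightarrow> v = -r) \<and> (u = r \<longleftrightarrow> v = r)"
    if "u \<in> {-r..r}" "v \<in> {-r..r}" for u v
    using that r unfolding ag by (auto simp: sgn_if)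
  have m: "matched r E P P" unfolding matched_def
  proof (intro conjI ballI impI)
    show "\<exists>v\<in>{-r..r}. agree E P u P v" if "u \<in> {-r..r}" for u using agree_refl that by blast
    fix u u' v v' assume h: "u \<in> {-r..r}" "u' \<in> {-r..r}" "v \<in> {-r..r}" "v' \<in> {-r..r}"
      "agree E P u P v" "agree E P u' P v'" "u < u'" "\<not> agree E P u P u'"
    have "(u = -r \<longleftrightarrow> v = -r) \<and> (u = r \<longleftrightarrow> v = r)" "(u' = -r \<longleftrightarrow> v' = -r) \<and> (u' = r \<longleftrightarrow> v' = r)"
      "u = -r \<or> u' = r" using h ag' by auto
    then show "v < v'" using h(1-4,7) by (cases "u = -r") auto
  qed
  have "convex_cells r E Q" using c unfolding convex_cells_def eq .
  moreover have "matched r E P Q" "matched r E Q P" using m unfolding matched_def eq by blast+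
  ultimately show ?thesis using c by (simp add: aligned_def)
qed

text \<open>Induction on the formal degree, members of one degree being added singly. The signs at
  roots that \<open>aligned_insert\<close> asks for come from pseudo-remainders: at a root of
  \<open>G\<close>, the value of \<open>F\<close> times a power of the leading coefficient of
  \<open>G\<close> is the value of a member of lower degree. \<open>E\<close> provides the end
  points as roots and the zero polynomial as derivative of constants.\<close>

lemma aligned_family:
  fixes J :: "(nat \<times> ('p \<Rightarrow> real poly)) set"
  assumes r: "0 < r" and fin: "finite J" and cl: "closed_above 0 J"
    and deg: "\<And>d F x. (d, F) \<in> J \<Longrightarrow> degree (F x) \<le> d"
    and lc: "\<And>d F. (d, F) \<in> J \<Longrightarrow> sgn (coeff (F p) d) = sgn (coeff (F q) d)"
    and ev: "\<And>d F c. (d, F) \<in> J \<Longrightarrow> c \<in> {r, -r} \<Longrightarrow> sgn (poly (F p) c) = sgn (poly (F q) c)"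
    and E_def: "E = {(1, \<lambda>_. [:r, 1:]), (1, \<lambda>_. [:-r, 1:]), (0, \<lambda>_. 0)}"
  shows "aligned r ({j\<in>J. fst j < d} \<union> E) (\<lambda>j. snd j p) (\<lambda>j. snd j q)"
proof (induction d)
  case 0
  have "aligned r E (\<lambda>j. snd j p) (\<lambda>j. snd j q)"
    by (rule aligned_ends[OF r]) (auto simp: E_def)
  then show ?case by simp
next
  case (Suc d)
  let ?P = "\<lambda>j :: nat \<times> ('p \<Rightarrow> real poly). snd j p" and ?Q = "\<lambda>j :: nat \<times> ('p \<Rightarrow> real poly). snd j q"
  let ?K = "{j\<in>J. fst j < d} \<union> E"
  have "aligned r (?K \<union> S) ?P ?Q" if "finite S" "S \<subseteq> {j\<in>J. fst j = d}" for S
    using that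
  proof (induction S rule: finite_induct)
    case empty then show ?case using Suc.IH by simp
  next
    case (insert A S)
    define K where "K = ?K \<union> S"
    obtain F where A: "A = (d, F)" "(d, F) \<in> J" using insert.prems by (cases A) auto
    have low: "(e, G) \<in> K" if "(e, G) \<in> J" "e < d" for e G using that by (auto simp: K_def)
    have Kd: "(e, G) \<in> J \<and> e \<le> d" if "(e, G) \<in> K" "(e, G) \<notin> E" for e G
      using that insert.prems by (auto simp: K_def)
    have EK: "E \<subseteq> K" by (auto simp: K_def)
    \<comment> \<open>Induction on the degree of \<open>G\<close>, which may equal \<open>d\<close>
      if \<open>G\<close> was added before \<open>F\<close>; the remainder has degree below that of
      \<open>G\<close>, hence below \<open>d\<close>, and so lies in \<open>K\<close>.\<close>
    have root1: "sgn (poly (F p) u) = sgn (poly (F q) v)"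
      if "agree K ?P u ?Q v" "(e, G) \<in> K" "(e, G) \<in> J" "e \<le> d" "G p \<noteq> 0" "poly (G p) u = 0" for e G u v
      using that(2-)
    proof (induction e arbitrary: G)
      case 0
      have "degree (G p) = 0" using deg[OF 0(2), of p] by simp
      then obtain a where "G p = [:a:]" by (rule degree_eq_zeroE)
      with 0 show ?case by simp
    next
      case (Suc e)
      show ?case
      proof (cases "coeff (G p) (Suc e) = 0")
        case True
        \<comment> \<open>Where the leading coefficient vanishes, \<open>G\<close> is replaced by
          its truncation, a member of lower formal degree with the same root.\<close>
        then have "truncate (Suc e) G p = G p" by (simp add: truncate_def)
        moreover have "(e, truncate (Suc e) G) \<in> J"
          using cl Suc.prems(2) unfolding closed_above_def by blast
        ultimately show ?thesis using Suc.IH[of "truncate (Suc e) G"] Suc.prems low by simp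
      next
        case False
        have "\<exists>S. (e, S) \<in> J \<and> pseudo_rem (Suc e) G F S"
          using cl A(2) Suc.prems(2,3) unfolding closed_above_def by blast
        then obtain S m where S: "(e, S) \<in> J"
          and m: "\<And>p x. poly (G p) x = 0 \<Longrightarrow> coeff (G p) (Suc e) ^ m * poly (F p) x = poly (S p) x"
          unfolding pseudo_rem_def by blast
        have SK: "(e, S) \<in> K" using low[OF S] Suc.prems(3) by simp
        have "poly (G q) v = 0"
          using agreeD[OF that(1) Suc.prems(1)] Suc.prems(5) by (simp add: sgn_zero_iff)
        from m[OF this] m[OF Suc.prems(5)] agreeD[OF that(1) SK]
        have "sgn (coeff (G p) (Suc e) ^ m * poly (F p) u) = sgn (coeff (G q) (Suc e) ^ m * poly (F q) v)"
          by simp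
        moreover have "sgn (coeff (G p) (Suc e)) = sgn (coeff (G q) (Suc e))" by (rule lc[OF Suc.prems(2)])
        moreover from this False have "coeff (G q) (Suc e) \<noteq> 0" by (metis sgn_zero_iff)
        ultimately show ?thesis using False by (simp add: sgn_mult power_sgn sgn_zero_iff)
      qed
    qed
    have "aligned r (insert A K) ?P ?Q"
    proof (rule aligned_insert[OF r])
      show "finite K" using fin insert.hyps(1) by (auto simp: K_def E_def)
      have *: "(1, \<lambda>_. [:r, 1:]) \<in> K" "(1, \<lambda>_. [:-r, 1:]) \<in> K" "(0, \<lambda>_. 0) \<in> K" using EK by (auto simp: E_def)
      show "is_root K ?P (- r)" "is_root K ?Q (- r)" unfolding is_root_def by (rule bexI[OF _ *(1)]; simp)+
      show "is_root K ?P r" "is_root K ?Q r" unfolding is_root_def by (rule bexI[OF _ *(2)]; simp)+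
      show "aligned r K ?P ?Q" unfolding K_def using insert by simp
      define D where "D = (if d = 0 then (0, \<lambda>_. 0) else (d - 1, \<lambda>x. pderiv (F x)))"
      show "D \<in> K"
      proof (cases d)
        case 0 then show ?thesis using * by (simp add: D_def)
      next
        case (Suc d')
        then have "(d', \<lambda>x. pderiv (F x)) \<in> J" using cl A(2) unfolding closed_above_def by blast
        then show ?thesis using low[of d'] Suc by (simp add: D_def)
      qed
      have "pderiv (F x) = 0" if "d = 0" for x
        using deg[OF A(2), of x] that by (simp add: pderiv_eq_0_iff)
      then show "?P D = pderiv (?P A)" "?Q D = pderiv (?Q A)" using A(1) by (auto simp: D_def)
      fix u v assume ag: "agree K ?P u ?Q v" and "is_root K ?P u" "u \<in> {-r..r}"
      then obtain e G where G: "(e, G) \<in> K" "G p \<noteq> 0" "poly (G p) u = 0" by (force simp: is_root_def)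
      show "sgn (poly (?P A) u) = sgn (poly (?Q A) v)"
      proof (cases "(e, G) \<in> E")
        case True
        \<comment> \<open>Members of \<open>E\<close> do not depend on the parameter, so agreement
          at a root forces \<open>v = u\<close>; the sign of \<open>F\<close> at the end points is
          given by \<open>ev\<close>.\<close>
        then have "(u = r \<or> u = -r) \<and> u = v"
          using G agreeD[OF ag G(1)] by (auto simp: E_def sgn_zero_iff)
        then show ?thesis using ev[OF A(2), of u] A(1) by auto
      next
        case False
        then show ?thesis using root1[OF ag G(1) _ _ G(2,3)] Kd[OF G(1)] A(1) by simp
      qed
    qed
    then show ?case by (simp add: K_def)
  qed
  from this[of "{j\<in>J. fst j = d}"] have "aligned r (?K \<union> {j\<in>J. fst j = d}) ?P ?Q" using fin by simp
  moreover have "?K \<union> {j\<in>J. fst j = d} = {j\<in>J. fst j < Suc d} \<union> E" by auto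
  ultimately show ?case by simp
qed

text \<open>A semantic form of elimination: the signs of \<open>G\<close> determine which sign
  vectors of \<open>\<F>\<close> occur on \<open>[-r, r]\<close>. \<open>G\<close> collects the
  formal leading coefficients and the end point values of a closed family containing
  \<open>\<F>\<close>. The bounded interval is the range of the last variable in a polydisc.\<close>

theorem real_quantifier_elimination:
  assumes R: "function_ring R" and r: "0 < r" and fin: "finite \<F>"
    and F: "\<And>F. F \<in> \<F> \<Longrightarrow> param_poly R n F"
  obtains G where "finite G" "G \<subseteq> R"
    "\<And>p q u. (\<And>g. g \<in> G \<Longrightarrow> sgn (g p) = sgn (g q)) \<Longrightarrow> u \<in> {-r..r} \<Longrightarrow>
       \<exists>v\<in>{-r..r}. \<forall>F\<in>\<F>. sgn (poly (F p) u) = sgn (poly (F q) v)"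
proof -
  have "\<exists>J'. Pair n ` \<F> \<subseteq> J' \<and> finite J' \<and> (\<forall>(d, F)\<in>J'. param_poly R d F \<and> d \<le> n) \<and> closed_above 0 J'"
    by (rule closed_above_exists[OF R]) (use fin F in auto)
  then obtain J where J: "Pair n ` \<F> \<subseteq> J" "finite J" "\<And>d F. (d, F) \<in> J \<Longrightarrow> param_poly R d F \<and> d \<le> n"
    "closed_above 0 J" by blast
  define G where "G = (\<lambda>(d, F) p. coeff (F p) d) ` J \<union> (\<lambda>(d, F) p. poly (F p) r) ` J \<union>
     (\<lambda>(d, F) p. poly (F p) (-r)) ` J"
  show thesis
  proof (rule that)
    show "finite G" using J(2) by (simp add: G_def)
    have "(\<lambda>p. coeff (F p) d) \<in> R" "(\<lambda>p. poly (F p) c) \<in> R" if "(d, F) \<in> J" for d F c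
      using J(3)[OF that] param_poly_eval[OF R] by (auto simp: param_poly_def)
    then show "G \<subseteq> R" by (auto simp: G_def)
    fix p q u assume g: "\<And>g. g \<in> G \<Longrightarrow> sgn (g p) = sgn (g q)" and u: "u \<in> {-r..r}"
    define E :: "(nat \<times> ('a \<Rightarrow> real poly)) set" where
      "E = {(1, \<lambda>_. [:r, 1:]), (1, \<lambda>_. [:-r, 1:]), (0, \<lambda>_. 0)}"
    have "aligned r ({j\<in>J. fst j < Suc n} \<union> E) (\<lambda>j. snd j p) (\<lambda>j. snd j q)"
    proof (rule aligned_family[OF r J(2,4) _ _ _ E_def])
      show "degree (F x) \<le> d" if "(d, F) \<in> J" for d F x using J(3)[OF that] by (simp add: param_poly_def)
      show "sgn (coeff (F p) d) = sgn (coeff (F q) d)" if "(d, F) \<in> J" for d F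
        by (rule g[of "\<lambda>p. coeff (F p) d"]) (use that in \<open>force simp: G_def\<close>)
      have "sgn (poly (F p) r) = sgn (poly (F q) r)" "sgn (poly (F p) (-r)) = sgn (poly (F q) (-r))"
        if "(d, F) \<in> J" for d F
        using g[of "\<lambda>p. poly (F p) r"] g[of "\<lambda>p. poly (F p) (-r)"] that by (force simp: G_def)+
      then show "sgn (poly (F p) c) = sgn (poly (F q) c)" if "(d, F) \<in> J" "c \<in> {r, -r}" for d F c
        using that by blast
    qed
    then obtain v where v: "v \<in> {-r..r}" and
      ag: "agree ({j\<in>J. fst j < Suc n} \<union> E) (\<lambda>j. snd j p) u (\<lambda>j. snd j q) v"
      using matched_ex u unfolding aligned_def by blast
    have "sgn (poly (F p) u) = sgn (poly (F q) v)" if "F \<in> \<F>" for F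
      using agreeD[OF ag, of "(n, F)"] that J(1) by auto
    with v show "\<exists>v\<in>{-r..r}. \<forall>F\<in>\<F>. sgn (poly (F p) u) = sgn (poly (F q) v)" by blast
  qed
qed

section \<open>Tangent vectors of subanalytic sets\<close>

text \<open>With no variable besides \<open>\<tau>\<close>, the coefficients are constants and an
  ordinary power series remains. All \<open>x\<close> with \<open>x \<tau> = t\<close> are covered
  because the other coordinates have no influence.\<close>

lemma pexp_single_sgn:
  assumes g: "pexp {\<tau>} \<rho> M g"
  shows "\<exists>s. \<forall>\<^sub>F t in at_right 0. \<forall>x. x \<tau> = t \<longrightarrow> sgn (g x) = s"
proof -
  let ?z = "\<lambda>_. 0 :: real"
  obtain a q where a: "\<And>e. pexp {} \<rho> (M / \<rho> \<tau> ^ e) (a e)"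
    and gx: "\<And>x. x \<in> polydisc {\<tau>} \<rho> \<Longrightarrow> ((\<lambda>j. a j x * x \<tau> ^ j) has_sum g x) UNIV"
    by (rule pexp_taylor[OF g finite.emptyI]) (simp, blast)
  have pos: "0 < \<rho> \<tau>" using pexp_pos[OF g] by simp
  have "a j (?z(\<tau> := u)) = a j ?z" for j u by (rule pexp_dep[OF a]) (auto simp: polydisc_def)
  then have "(\<lambda>j. a j ?z * u ^ j) sums g (?z(\<tau> := u))" if "\<bar>u\<bar> \<le> \<rho> \<tau>" for u
    using gx[of "?z(\<tau> := u)"] that by (simp add: polydisc_def has_sum_imp_sums)
  from power_series_eventually_sgn[OF pos this] obtain s where
    "\<forall>\<^sub>F t in at_right 0. sgn (g (?z(\<tau> := t))) = s" by blast
  moreover have "\<forall>\<^sub>F t in at_right 0. t < \<rho> \<tau>" by (rule order_tendstoD(2)[OF tendsto_ident_at pos])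
  moreover have "\<forall>\<^sub>F t in at_right (0::real). 0 < t" by (rule eventually_at_right_less)
  ultimately have "\<forall>\<^sub>F t in at_right 0. \<forall>x. x \<tau> = t \<longrightarrow> sgn (g x) = s"
  proof eventually_elim
    case (elim t)
    show ?case
    proof (intro allI impI)
      fix x assume "x \<tau> = t"
      then have "g x = g (?z(\<tau> := t))"
        by (intro pexp_dep[OF g]) (use elim in \<open>auto simp: polydisc_def\<close>)
      then show "sgn (g x) = s" using elim(1) by metis
    qed
  qed
  then show ?thesis ..
qed

text \<open>Pigeonhole: if each \<open>s\<close> failed for some \<open>\<epsilon>\<close>, then by
  monotonicity all would fail for a common smaller one.\<close>

lemma finite_choice_near_zero:
  assumes "finite S" and ex: "\<And>\<epsilon>::real. 0 < \<epsilon> \<Longrightarrow> \<exists>s\<in>S. Q \<epsilon> s"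
    and mono: "\<And>\<epsilon> \<epsilon>' s. Q \<epsilon> s \<Longrightarrow> \<epsilon> \<le> \<epsilon>' \<Longrightarrow> Q \<epsilon>' s"
  shows "\<exists>s\<in>S. \<forall>\<epsilon>>0. Q \<epsilon> s"
proof (rule ccontr)
  assume "\<not> ?thesis"
  then have "\<forall>s\<in>S. \<exists>\<epsilon>>0. \<not> Q \<epsilon> s" by blast
  from bchoice[OF this] obtain e where e: "\<And>s. s \<in> S \<Longrightarrow> 0 < e s \<and> \<not> Q (e s) s" by blast
  obtain d where "0 < d" "\<And>s. s \<in> S \<Longrightarrow> d \<le> e s"
    using finite_positive_lower_bound[OF assms(1), of e] e by blast
  then show False using ex[of d] mono e by blast
qed

text \<open>
  Induction on the number of variables other than \<open>\<tau>\<close>. Dividing by a power of \<open>\<tau>\<close> makes the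
  restriction to \<open>\<tau> = 0\<close> nontrivial, so that a linear change of the remaining variables achieves
  regularity in \<open>y\<close>; this is why \<open>\<tau>\<close> is kept until the end.
\<close>

theorem pexp_fibres_near_zero:
  fixes \<sigma> :: "(('i \<Rightarrow> real) \<Rightarrow> real) \<Rightarrow> real"
  assumes "finite K" "\<tau> \<notin> K" "finite G" "0 < d"
    and "\<And>g. g \<in> G \<Longrightarrow> \<exists>M. pexp (insert \<tau> K) (\<lambda>_. d) M g"
    and "\<And>\<epsilon>. 0 < \<epsilon> \<Longrightarrow>
      \<exists>x. 0 < x \<tau> \<and> x \<tau> < \<epsilon> \<and> (\<forall>i\<in>K. \<bar>x i\<bar> < \<epsilon>) \<and> (\<forall>g\<in>G. sgn (g x) = \<sigma> g)"
  shows "\<exists>\<delta>>0. \<forall>t. 0 < t \<and> t < \<delta> \<longrightarrow>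
      (\<exists>x\<in>polydisc (insert \<tau> K) (\<lambda>_. d). x \<tau> = t \<and> (\<forall>g\<in>G. sgn (g x) = \<sigma> g))"
  using assms
proof (induction K arbitrary: G d \<sigma> rule: finite_induct)
  case empty
  have "\<forall>g\<in>G. \<exists>s. \<forall>\<^sub>F t in at_right 0. \<forall>x. x \<tau> = t \<longrightarrow> sgn (g x) = s"
  proof
    fix g assume "g \<in> G"
    then obtain M where "pexp {\<tau>} (\<lambda>_. d) M g" using empty.prems(4) by blast
    then show "\<exists>s. \<forall>\<^sub>F t in at_right 0. \<forall>x. x \<tau> = t \<longrightarrow> sgn (g x) = s" by (rule pexp_single_sgn)
  qed
  from bchoice[OF this] obtain s where
    s: "\<And>g. g \<in> G \<Longrightarrow> \<forall>\<^sub>F t in at_right 0. \<forall>x. x \<tau> = t \<longrightarrow> sgn (g x) = s g" by blast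
  have "\<forall>\<^sub>F t in at_right 0. \<forall>g\<in>G. \<forall>x. x \<tau> = t \<longrightarrow> sgn (g x) = s g"
    using s empty.prems(2) by (simp add: eventually_ball_finite)
  moreover have "\<forall>\<^sub>F t in at_right 0. t < d"
    using order_tendstoD(2)[OF tendsto_ident_at empty.prems(3)] .
  ultimately have "\<forall>\<^sub>F t in at_right 0. (\<forall>g\<in>G. \<forall>x. x \<tau> = t \<longrightarrow> sgn (g x) = s g) \<and> t < d"
    by eventually_elim simp
  then obtain \<delta> where \<delta>: "0 < \<delta>" and
    sx: "\<And>t g x. 0 < t \<Longrightarrow> t < \<delta> \<Longrightarrow> t < d \<and> (g \<in> G \<longrightarrow> x \<tau> = t \<longrightarrow> sgn (g x) = s g)"
    unfolding eventually_at_right_field by blast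
  obtain x where "0 < x \<tau>" "x \<tau> < \<delta>" "\<forall>g\<in>G. sgn (g x) = \<sigma> g" using empty.prems(5)[OF \<delta>] by blast
  then have s\<sigma>: "s g = \<sigma> g" if "g \<in> G" for g using sx[of "x \<tau>" g x] that by simp
  show ?case
  proof (intro exI[of _ \<delta>] conjI allI impI)
    fix t assume t: "0 < t \<and> t < \<delta>"
    show "\<exists>x\<in>polydisc {\<tau>} (\<lambda>_. d). x \<tau> = t \<and> (\<forall>g\<in>G. sgn (g x) = \<sigma> g)"
    proof (intro bexI[of _ "\<lambda>_. t"] conjI ballI)
      show "sgn (g (\<lambda>_. t)) = \<sigma> g" if "g \<in> G" for g using sx[of t g "\<lambda>_. t"] t s\<sigma> that by simp
      show "(\<lambda>_. t) \<in> polydisc {\<tau>} (\<lambda>_. d)" using sx[of t g "\<lambda>_. t" for g] t by (simp add: polydisc_def less_imp_le)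
    qed simp
  qed (fact \<delta>)
next
  case (insert y K)
  let ?I = "insert \<tau> (insert y K)" and ?D = "\<lambda>_. d :: real" and ?z = "\<lambda>_. 0 :: real"
  have fin: "finite K" "finite (insert y K)" "finite (insert \<tau> K)" using insert.hyps by auto
  have \<tau>: "\<tau> \<notin> insert y K" "\<tau> \<noteq> y" "\<tau> \<notin> K" using insert.prems(1) by auto
  have y: "y \<notin> insert \<tau> K" using insert.hyps(2) \<tau> by auto
  have I: "insert y (insert \<tau> K) = ?I" by auto
  have d: "0 < d" by fact
  \<comment> \<open>Functions that vanish identically on the polydisc cannot be made regular in
    \<open>y\<close>; they are treated separately at the end.\<close>
  define Gn where "Gn = {g\<in>G. \<exists>x\<in>polydisc ?I ?D. g x \<noteq> 0}"
  have finG: "finite Gn" using insert.prems(2) by (simp add: Gn_def)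
  define factor where "factor = (\<lambda>g m h. (\<exists>N. pexp ?I ?D N h) \<and>
     (\<forall>x\<in>polydisc ?I ?D. g x = x \<tau> ^ m * h x) \<and> (\<exists>x\<in>polydisc ?I ?D. h (x(\<tau> := 0)) \<noteq> 0))"
  have "\<forall>g\<in>Gn. \<exists>m h. factor g m h"
  proof
    fix g assume "g \<in> Gn"
    then have "g \<in> G" and nz: "\<exists>x\<in>polydisc ?I ?D. g x \<noteq> 0" by (auto simp: Gn_def)
    then obtain M where M: "pexp ?I ?D M g" using insert.prems(4) by blast
    show "\<exists>m h. factor g m h"
    proof (rule pexp_factor_out[OF M fin(2) \<tau>(1) nz])
      fix m h N assume *: "pexp ?I ?D N h" "\<And>x. x \<in> polydisc ?I ?D \<Longrightarrow> g x = x \<tau> ^ m * h x"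
        "\<exists>x\<in>polydisc ?I ?D. h (x(\<tau> := 0)) \<noteq> 0"
      show ?thesis unfolding factor_def
        by (rule exI[of _ m], rule exI[of _ h], intro conjI ballI exI[of _ N] *)
    qed
  qed
  then obtain m h where "\<forall>g\<in>Gn. factor g (m g) (h g)" by metis
  then have hN: "\<And>g. g \<in> Gn \<Longrightarrow> \<exists>N. pexp ?I ?D N (h g)"
    and gh: "\<And>g x. g \<in> Gn \<Longrightarrow> x \<in> polydisc ?I ?D \<Longrightarrow> g x = x \<tau> ^ m g * h g x"
    and hnz: "\<And>g. g \<in> Gn \<Longrightarrow> \<exists>x\<in>polydisc ?I ?D. h g (x(\<tau> := 0)) \<noteq> 0"
    unfolding factor_def by blast+
  \<comment> \<open>A point of \<open>\<tau> = 0\<close> at which no \<open>h g\<close> vanishes;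
    the line through it is going to be the new \<open>y\<close>-axis. The bound \<open>d / 2\<close>
    leaves room for the linear change.\<close>
  have "\<exists>w. (\<forall>i\<in>insert y K. 0 < w i \<and> w i \<le> d / 2 \<and> w i \<le> d) \<and>
      (\<forall>f\<in>(\<lambda>g x. h g (x(\<tau> := 0))) ` Gn. f w \<noteq> 0)"
  proof (rule pexp_common_nonzero[OF fin(2) finite_imageI[OF finG]])
    fix f assume "f \<in> (\<lambda>g x. h g (x(\<tau> := 0))) ` Gn"
    then obtain g where g: "g \<in> Gn" "f = (\<lambda>x. h g (x(\<tau> := 0)))" by blast
    obtain N where N: "pexp ?I ?D N (h g)" using hN[OF g(1)] ..
    show "\<exists>M. pexp (insert y K) ?D M f" using pexp_set_zero[OF N fin(2)] g(2) by blast
    show "\<exists>x\<in>polydisc (insert y K) ?D. f x \<noteq> 0" using hnz[OF g(1)] g(2) by (auto simp: polydisc_def)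
  qed (use d in auto)
  then obtain w where w: "\<And>i. i \<in> insert y K \<Longrightarrow> 0 < w i \<and> w i \<le> d / 2"
    and hw: "\<And>g. g \<in> Gn \<Longrightarrow> h g (w(\<tau> := 0)) \<noteq> 0" by auto
  \<comment> \<open>\<open>L\<close> keeps \<open>\<tau>\<close> and maps the \<open>y\<close>-axis
    onto the line through \<open>w\<close>, with \<open>y = 1\<close> going to \<open>w\<close>.
    With radius 1 in \<open>y\<close> and \<open>d / 2\<close> elsewhere, as in
    \<open>\<rho>\<close>, it stays in the polydisc of radius \<open>d\<close>.\<close>
  define L where "L = (\<lambda>x i. if i = \<tau> then x \<tau> else if i = y then w y * x y else x i + w i * x y)"
  define \<rho> where "\<rho> = (\<lambda>_. d / 2)(y := 1)"
  have \<rho>: "0 < \<rho> i" for i using d by (simp add: \<rho>_def)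
  have \<rho>y: "\<rho> y = 1" by (simp add: \<rho>_def)
  have L_pd: "L x \<in> polydisc ?I ?D" if "x \<in> polydisc ?I \<rho>" for x
    unfolding polydisc_def
  proof (intro CollectI ballI)
    fix i assume i: "i \<in> ?I"
    have xy: "\<bar>x y\<bar> \<le> 1" and xi: "j \<in> ?I \<Longrightarrow> j \<noteq> y \<Longrightarrow> \<bar>x j\<bar> \<le> d / 2" for j
      using that by (auto simp: polydisc_def \<rho>_def)
    have wx: "\<bar>w j * x y\<bar> \<le> d / 2" if "j \<in> insert y K" for j
    proof -
      have "\<bar>w j * x y\<bar> = w j * \<bar>x y\<bar>" using w[OF that] by (simp add: abs_mult)
      also have "\<dots> \<le> d / 2 * 1" by (rule mult_mono) (use w[OF that] xy d in auto)
      finally show ?thesis by simp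
    qed
    show "\<bar>L x i\<bar> \<le> d"
      using i xi[of i] wx[of i] d \<tau> abs_triangle_ineq[of "x i" "w i * x y"] by (auto simp: L_def)
  qed
  have hL: "\<exists>N. pexp (insert y (insert \<tau> K)) \<rho> N (\<lambda>x. h g (L x))" if gGn: "g \<in> Gn" for g
  proof -
    obtain N where N: "pexp ?I ?D N (h g)" using hN[OF gGn] ..
    have "pexp ?I \<rho> d (\<lambda>x. L x i)" if i: "i \<in> ?I" for i
    proof -
      have v: "pexp ?I \<rho> (\<rho> j) (\<lambda>x. x j)" if "j \<in> ?I" for j by (rule pexp_var) (use that \<rho> fin in auto)
      consider "i = \<tau>" | "i = y" | "i \<noteq> \<tau>" "i \<noteq> y" "i \<in> K" using i by blast
      then show ?thesis
      proof cases
        case 1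
        have "pexp ?I \<rho> (\<rho> \<tau>) (\<lambda>x. x \<tau>)" by (rule v) simp
        then have "pexp ?I \<rho> d (\<lambda>x. x \<tau>)" by (rule pexp_mono) (use d \<tau> in \<open>simp add: \<rho>_def\<close>)
        then show ?thesis using 1 by (simp add: L_def)
      next
        case 2
        have "pexp ?I \<rho> (\<bar>w y\<bar> * \<rho> y) (\<lambda>x. w y * x y)" by (rule pexp_cmult[OF v]) simp
        then have "pexp ?I \<rho> d (\<lambda>x. w y * x y)" by (rule pexp_mono) (use w[of y] d \<rho>y in simp)
        then show ?thesis using 2 \<tau> by (simp add: L_def)
      next
        case 3
        have "pexp ?I \<rho> (\<rho> i + \<bar>w i\<bar> * \<rho> y) (\<lambda>x. x i + w i * x y)"
          by (intro pexp_add pexp_cmult v) (use 3 in auto)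
        then have "pexp ?I \<rho> d (\<lambda>x. x i + w i * x y)"
          by (rule pexp_mono) (use w[of i] d 3 in \<open>simp add: \<rho>_def\<close>)
        then show ?thesis using 3 by (simp add: L_def)
      qed
    qed
    from pexp_compose[OF N _ _ this] have "pexp ?I \<rho> N (\<lambda>x. h g (\<lambda>i. L x i))" using \<rho> fin by simp
    then show ?thesis unfolding I by auto
  qed
  have hL1: "h g (L (?z(y := 1))) \<noteq> 0" if gGn: "g \<in> Gn" for g
  proof -
    obtain N where N: "pexp ?I ?D N (h g)" using hN[OF gGn] ..
    have "?z(y := 1) \<in> polydisc ?I \<rho>" using d by (auto simp: polydisc_def \<rho>_def)
    from pexp_dep[OF N L_pd[OF this], of "w(\<tau> := 0)"] hw[OF that] \<tau> show ?thesis
      by (auto simp: L_def)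
  qed
  define weier where "weier = (\<lambda>\<delta> g c e r. (\<forall>j<e. \<exists>N. pexp (insert \<tau> K) (\<lambda>_. \<delta>) N (r j)) \<and>
    (\<forall>x\<in>polydisc ?I (\<lambda>_. \<delta>). sgn (h g (L x)) = sgn (c * (x y ^ e + (\<Sum>j<e. r j x * x y ^ j)))))"
  have "\<forall>g\<in>Gn. \<exists>c e r. \<forall>\<^sub>F \<delta> in at_right 0. weier \<delta> g c e r"
  proof
    fix g assume g: "g \<in> Gn"
    obtain N where N: "pexp (insert y (insert \<tau> K)) \<rho> N (\<lambda>x. h g (L x))" using hL[OF g] ..
    show "\<exists>c e r. \<forall>\<^sub>F \<delta> in at_right 0. weier \<delta> g c e r"
      unfolding weier_def by (rule pexp_weierstrass[OF N fin(3) y, of 1]) (use hL1[OF g] \<rho>y I in auto)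
  qed
  then obtain c e r where "\<forall>g\<in>Gn. \<forall>\<^sub>F \<delta> in at_right 0. weier \<delta> g (c g) (e g) (r g)" by metis
  then have "\<forall>\<^sub>F \<delta> in at_right 0. \<forall>g\<in>Gn. weier \<delta> g (c g) (e g) (r g)"
    by (rule eventually_ball_finite[OF finG])
  moreover have "\<forall>\<^sub>F \<delta> in at_right 0. 0 < \<delta> \<and> (\<forall>i\<in>?I. \<delta> \<le> \<rho> i)"
    by (rule eventually_at_right_0_le) (use fin \<rho> in auto)
  ultimately obtain \<delta> where "\<forall>g\<in>Gn. weier \<delta> g (c g) (e g) (r g)"
    and \<delta>: "0 < \<delta>" "\<And>i. i \<in> ?I \<Longrightarrow> \<delta> \<le> \<rho> i"
    using eventually_happens'[OF trivial_limit_at_right_real eventually_conj] by blast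
  then have rN: "\<And>g j. g \<in> Gn \<Longrightarrow> j < e g \<Longrightarrow> \<exists>N. pexp (insert \<tau> K) (\<lambda>_. \<delta>) N (r g j)"
    and sg: "\<And>g x. g \<in> Gn \<Longrightarrow> x \<in> polydisc ?I (\<lambda>_. \<delta>) \<Longrightarrow>
        sgn (h g (L x)) = sgn (c g * (x y ^ e g + (\<Sum>j<e g. r g j x * x y ^ j)))"
    unfolding weier_def by blast+
  have \<delta>\<rho>: "x \<in> polydisc ?I \<rho>" if "x \<in> polydisc ?I (\<lambda>_. \<delta>)" for x
    using that \<delta>(2) unfolding polydisc_def by (blast intro: order_trans)
  \<comment> \<open>The coefficients of the Weierstrass polynomials are expansions without
    \<open>y\<close>. These form a ring, so the functions produced by the elimination are again
    subject to the induction hypothesis.\<close>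
  define R where "R = {f. \<exists>N. pexp (insert \<tau> K) (\<lambda>_. \<delta>) N f}"
  have R: "function_ring R" unfolding function_ring_def R_def
    using pexp_const[of "insert \<tau> K" "\<lambda>_. \<delta>"] \<delta>(1) by (auto intro: pexp_add pexp_mult)
  define F where "F = (\<lambda>g p. smult (c g) (monom 1 (e g) + (\<Sum>j<e g. monom (r g j p) j)))"
  have Fpoly: "poly (F g p) u = c g * (u ^ e g + (\<Sum>j<e g. r g j p * u ^ j))" for g p u
    by (simp add: F_def poly_monom poly_sum)
  define n where "n = (\<Sum>g\<in>Gn. e g)"
  have "param_poly R n f" if "f \<in> F ` Gn" for f
  proof -
    obtain g where g: "g \<in> Gn" "f = F g" using \<open>f \<in> F ` Gn\<close> by blast
    have co: "coeff (f p) i = c g * ((if i = e g then 1 else 0) + (if i < e g then r g i p else 0))" for p i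
      by (simp add: g F_def coeff_sum)
    have "e g \<le> n" unfolding n_def by (rule member_le_sum[OF g(1)]) (use finG in auto)
    then have "degree (f p) \<le> n" for p by (intro degree_le) (auto simp: co)
    moreover have "(\<lambda>p. coeff (f p) i) \<in> R" for i
    proof (cases "i < e g")
      case True
      then have "r g i \<in> R" using rN[OF g(1)] by (simp add: R_def)
      then show ?thesis unfolding co using True function_ring_mult[OF R function_ring_const[OF R]] by simp
    next
      case False
      then show ?thesis unfolding co using function_ring_const[OF R] by simp
    qed
    ultimately show ?thesis by (simp add: param_poly_def)
  qed
  then obtain G' where G': "finite G'" "G' \<subseteq> R"
    and qe: "\<And>p q u. (\<And>g. g \<in> G' \<Longrightarrow> sgn (g p) = sgn (g q)) \<Longrightarrow> u \<in> {-\<delta>..\<delta>} \<Longrightarrow>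
       \<exists>v\<in>{-\<delta>..\<delta>}. \<forall>f\<in>F ` Gn. sgn (poly (f p) u) = sgn (poly (f q) v)"
    using real_quantifier_elimination[OF R \<delta>(1) finite_imageI[OF finG]] by metis
  define good where "good = (\<lambda>p. \<exists>u\<in>{-\<delta>..\<delta>}. \<forall>g\<in>Gn. sgn (poly (F g p) u) = \<sigma> g)"
  define near where "near = (\<lambda>(\<epsilon>::real) (p :: 'i \<Rightarrow> real). 0 < p \<tau> \<and> p \<tau> < \<epsilon> \<and> (\<forall>i\<in>K. \<bar>p i\<bar> < \<epsilon>))"
  have sgx: "sgn (g x) = sgn (h g x)" if "g \<in> Gn" "x \<in> polydisc ?I ?D" "0 < x \<tau>" for g x
    using gh[OF that(1,2)] that(3) by (simp add: sgn_mult power_sgn[symmetric])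
  have ex_good: "\<exists>p. near \<epsilon> p \<and> good p" if "0 < \<epsilon>" for \<epsilon>
  proof -
    \<comment> \<open>\<open>C\<close> bounds the growth under the inverse of \<open>L\<close>: the
      \<open>y\<close>-coordinate is divided by \<open>w y\<close>, and subtracting
      \<open>w i * u\<close> adds at most \<open>d / w y\<close> times the size of \<open>x\<close>.
      Hence \<open>\<eta>\<close> is the target size divided by \<open>C\<close>.\<close>
    define C where "C = 1 + 1 / w y + d / w y"
    have wy: "0 < w y" using w[of y] by simp
    have C: "1 \<le> C" "1 / w y \<le> C" "1 + d / w y \<le> C" using wy d by (auto simp: C_def)
    define \<eta> where "\<eta> = min (min \<epsilon> \<delta>) d / C"
    have \<eta>: "0 < \<eta>" "\<eta> * C \<le> \<epsilon>" "\<eta> * C \<le> \<delta>" "\<eta> * C \<le> d"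
      using that \<delta>(1) d C(1) by (auto simp: \<eta>_def)
    have \<eta>1: "\<eta> \<le> \<eta> * C" using \<eta>(1) C(1) by simp
    obtain x where x: "0 < x \<tau>" "x \<tau> < \<eta>" "\<forall>i\<in>insert y K. \<bar>x i\<bar> < \<eta>" "\<forall>g\<in>G. sgn (g x) = \<sigma> g"
      using insert.prems(5)[OF \<eta>(1)] by blast
    define u where "u = x y / w y"
    define p where "p = (\<lambda>i. if i = y then u else if i = \<tau> then x \<tau> else x i - w i * u)"
    have u: "\<bar>u\<bar> < \<eta> * (1 / w y)" using x(3) wy by (simp add: u_def field_simps)
    have u\<delta>: "\<bar>u\<bar> < \<delta>" using u mult_left_mono[OF C(2), of \<eta>] \<eta> by linarith
    have pK: "\<bar>p i\<bar> < \<eta> * C" if "i \<in> K" for i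
    proof -
      have wi: "0 < w i" "w i \<le> d" using w[of i] that d by auto
      have "\<bar>p i\<bar> \<le> \<bar>x i\<bar> + w i * \<bar>u\<bar>"
        using that y \<tau> insert.hyps(2) abs_triangle_ineq4[of "x i" "w i * u"] wi
        by (auto simp: p_def abs_mult)
      also have "\<dots> < \<eta> + d * (\<eta> * (1 / w y))"
      proof (rule add_less_le_mono)
        show "\<bar>x i\<bar> < \<eta>" using x(3) that by simp
        show "w i * \<bar>u\<bar> \<le> d * (\<eta> * (1 / w y))" by (rule mult_mono) (use wi u d in auto)
      qed
      also have "\<dots> = \<eta> * (1 + d / w y)" by (simp add: algebra_simps)
      also have "\<dots> \<le> \<eta> * C" using C(3) \<eta>(1) by simp
      finally show ?thesis .
    qed
    have p\<tau>: "p \<tau> = x \<tau>" and py: "p y = u" using \<tau> by (auto simp: p_def)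
    have "near \<epsilon> p"
      unfolding near_def
    proof (intro conjI ballI)
      show "0 < p \<tau>" "p \<tau> < \<epsilon>" using p\<tau> x(1,2) \<eta>(2) \<eta>1 by linarith+
      show "\<bar>p i\<bar> < \<epsilon>" if "i \<in> K" for i using pK[OF that] \<eta>(2) by simp
    qed
    have ppd: "p \<in> polydisc ?I (\<lambda>_. \<delta>)"
    proof -
      have "\<bar>p i\<bar> \<le> \<delta>" if i: "i \<in> ?I" for i
      proof -
        consider "i = \<tau>" | "i = y" | "i \<in> K" using i by blast
        then show ?thesis
        proof cases
          case 1
          have "\<bar>p \<tau>\<bar> \<le> \<delta>" using p\<tau> x(1,2) \<eta>(3) \<eta>1 by linarith
          then show ?thesis using 1 by simp
        next
          case 2 then show ?thesis using py u\<delta> by simp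
        next
          case 3 then show ?thesis using pK[of i] \<eta> by simp
        qed
      qed
      then show ?thesis by (simp add: polydisc_def)
    qed
    have xpd: "x \<in> polydisc ?I ?D"
    proof -
      have "\<bar>x i\<bar> \<le> d" if "i \<in> ?I" for i
      proof (cases "i = \<tau>")
        case True
        have "\<bar>x \<tau>\<bar> \<le> d" using x(1,2) \<eta>(4) \<eta>1 by linarith
        then show ?thesis using True by simp
      next
        case False
        then have "\<bar>x i\<bar> < \<eta>" using x(3) that by blast
        then show ?thesis using \<eta>(4) \<eta>1 by linarith
      qed
      then show ?thesis by (simp add: polydisc_def)
    qed
    have Lp: "L p i = x i" if "i \<in> ?I" for i
      using that \<tau> y wy by (auto simp: L_def p_def u_def)
    have "sgn (poly (F g p) u) = \<sigma> g" if g: "g \<in> Gn" for g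
    proof -
      obtain N where N: "pexp ?I ?D N (h g)" using hN[OF g] ..
      have "\<sigma> g = sgn (g x)" using x(4) g by (simp add: Gn_def)
      also have "\<dots> = sgn (h g x)" by (rule sgx[OF g xpd x(1)])
      also have "h g x = h g (L p)" by (rule pexp_dep[OF N xpd]) (simp add: Lp)
      also have "sgn (h g (L p)) = sgn (poly (F g p) u)" using sg[OF g ppd] by (simp add: Fpoly py)
      finally show ?thesis by simp
    qed
    then have "good p" unfolding good_def using u\<delta> by (intro bexI[of _ u]) auto
    with \<open>near \<epsilon> p\<close> show ?thesis by blast
  qed
  \<comment> \<open>The sign pattern on the eliminated family. Only finitely many are possible, so
    one is shared by good points arbitrarily close to the origin.\<close>
  define pat where "pat = (\<lambda>p. restrict (\<lambda>g. sgn (g p)) G')"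
  have "\<exists>s\<in>G' \<rightarrow>\<^sub>E {-1, 0, 1}. \<forall>\<epsilon>>0. \<exists>p. near \<epsilon> p \<and> good p \<and> pat p = s"
  proof (rule finite_choice_near_zero)
    show "finite (G' \<rightarrow>\<^sub>E {-1, 0, 1::real})" using G'(1) by (intro finite_PiE) auto
    fix \<epsilon> :: real assume "0 < \<epsilon>"
    then obtain p where "near \<epsilon> p" "good p" using ex_good by blast
    moreover have "pat p \<in> G' \<rightarrow>\<^sub>E {-1, 0, 1}" by (auto simp: pat_def sgn_if)
    ultimately show "\<exists>s\<in>G' \<rightarrow>\<^sub>E {-1, 0, 1}. \<exists>p. near \<epsilon> p \<and> good p \<and> pat p = s" by blast
  next
    fix \<epsilon> \<epsilon>' s assume "\<exists>p. near \<epsilon> p \<and> good p \<and> pat p = s" "\<epsilon> \<le> \<epsilon>'"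
    then show "\<exists>p. near \<epsilon>' p \<and> good p \<and> pat p = s"
    proof (elim exE conjE)
      fix p assume "near \<epsilon> p" "good p" "pat p = s"
      moreover from this \<open>\<epsilon> \<le> \<epsilon>'\<close> have "near \<epsilon>' p" by (force simp: near_def)
      ultimately show ?thesis by blast
    qed
  qed
  then obtain s where s: "\<And>\<epsilon>. 0 < \<epsilon> \<Longrightarrow> \<exists>p. near \<epsilon> p \<and> good p \<and> pat p = s" by blast
  have pats: "sgn (g p) = s g" if "pat p = s" "g \<in> G'" for p g using that by (auto simp: pat_def)
  \<comment> \<open>By \<open>qe\<close>, goodness depends on the sign pattern alone: a single good
    point with pattern \<open>s\<close> makes every point with this pattern good, in particular
    those from the induction hypothesis.\<close>
  obtain p0 where p0: "good p0" "pat p0 = s" using s[of 1] by auto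
  then obtain u0 where u0: "u0 \<in> {-\<delta>..\<delta>}" "\<And>g. g \<in> Gn \<Longrightarrow> sgn (poly (F g p0) u0) = \<sigma> g"
    by (auto simp: good_def)
  have "\<exists>\<delta>'>0. \<forall>t. 0 < t \<and> t < \<delta>' \<longrightarrow>
      (\<exists>x\<in>polydisc (insert \<tau> K) (\<lambda>_. \<delta>). x \<tau> = t \<and> (\<forall>g\<in>G'. sgn (g x) = s g))"
  proof (rule insert.IH[OF \<tau>(3) G'(1) \<delta>(1)])
    show "\<exists>M. pexp (insert \<tau> K) (\<lambda>_. \<delta>) M g" if "g \<in> G'" for g using that G'(2) by (auto simp: R_def)
    show "\<exists>x. 0 < x \<tau> \<and> x \<tau> < \<epsilon> \<and> (\<forall>i\<in>K. \<bar>x i\<bar> < \<epsilon>) \<and> (\<forall>g\<in>G'. sgn (g x) = s g)" if "0 < \<epsilon>" for \<epsilon>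
      using s[OF that] pats unfolding near_def by blast
  qed
  then obtain \<delta>' where \<delta>': "0 < \<delta>'" and fib: "\<And>t. 0 < t \<Longrightarrow> t < \<delta>' \<Longrightarrow>
      \<exists>x\<in>polydisc (insert \<tau> K) (\<lambda>_. \<delta>). x \<tau> = t \<and> (\<forall>g\<in>G'. sgn (g x) = s g)" by blast
  show ?case
  proof (intro exI[of _ \<delta>'] conjI allI impI)
    fix t assume t: "0 < t \<and> t < \<delta>'"
    then obtain p where p: "p \<in> polydisc (insert \<tau> K) (\<lambda>_. \<delta>)" "p \<tau> = t" "\<And>g. g \<in> G' \<Longrightarrow> sgn (g p) = s g"
      using fib by blast
    obtain v where v: "v \<in> {-\<delta>..\<delta>}" "\<And>g. g \<in> Gn \<Longrightarrow> sgn (poly (F g p0) u0) = sgn (poly (F g p) v)"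
      using qe[of p0 p u0] pats[OF p0(2)] p(3) u0(1) by auto
    define q where "q = p(y := v)"
    have qpd: "q \<in> polydisc ?I (\<lambda>_. \<delta>)" using p(1) v(1) by (auto simp: polydisc_def q_def)
    have Lq: "L q \<in> polydisc ?I ?D" by (rule L_pd[OF \<delta>\<rho>[OF qpd]])
    have Lqt: "L q \<tau> = t" using p(2) \<tau> by (simp add: L_def q_def)
    have "sgn (g (L q)) = \<sigma> g" if g: "g \<in> G" for g
    proof (cases "g \<in> Gn")
      case True
      have rq: "r g j q = r g j p" if j: "j < e g" for j
      proof -
        obtain N where N: "pexp (insert \<tau> K) (\<lambda>_. \<delta>) N (r g j)" using rN[OF True j] ..
        have "r g j p = r g j q" by (rule pexp_dep[OF N p(1)]) (use y in \<open>auto simp: q_def\<close>)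
        then show ?thesis ..
      qed
      have "sgn (g (L q)) = sgn (h g (L q))" by (rule sgx[OF True Lq]) (use Lqt t in simp)
      also have "\<dots> = sgn (poly (F g p) v)" using sg[OF True qpd] rq by (simp add: Fpoly q_def)
      also have "\<dots> = \<sigma> g" using v(2)[OF True] u0(2)[OF True] by simp
      finally show ?thesis .
    next
      case False
      \<comment> \<open>Since the prescribed sign is attained somewhere in the polydisc, an
        identically vanishing \<open>g\<close> has \<open>\<sigma> g = 0\<close>.\<close>
      then have z: "g x = 0" if "x \<in> polydisc ?I ?D" for x using g that by (auto simp: Gn_def)
      obtain x where "0 < x \<tau>" "x \<tau> < d" "\<forall>i\<in>insert y K. \<bar>x i\<bar> < d" "\<forall>g\<in>G. sgn (g x) = \<sigma> g"
        using insert.prems(5)[OF d] by blast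
      then have "x \<in> polydisc ?I ?D" "sgn (g x) = \<sigma> g" using g by (auto simp: polydisc_def intro: less_imp_le)
      then show ?thesis using z Lq by simp
    qed
    with Lq Lqt show "\<exists>x\<in>polydisc ?I ?D. x \<tau> = t \<and> (\<forall>g\<in>G. sgn (g x) = \<sigma> g)" by blast
  qed (fact \<delta>')
qed

text \<open>A solution exists, so \<open>E\<close> and \<open>P\<close> are disjoint; the sign
  vector with 0 on \<open>E\<close> and 1 elsewhere then expresses exactly these conditions.\<close>

lemma common_zeros_fibres:
  assumes "finite K" "\<tau> \<notin> K" "finite E" "finite P" "0 < d"
    and pexp: "\<And>g. g \<in> E \<union> P \<Longrightarrow> \<exists>M. pexp (insert \<tau> K) (\<lambda>_. d) M g"
    and ex: "\<And>\<epsilon>. 0 < \<epsilon> \<Longrightarrow>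
      \<exists>x. 0 < x \<tau> \<and> x \<tau> < \<epsilon> \<and> (\<forall>i\<in>K. \<bar>x i\<bar> < \<epsilon>) \<and> (\<forall>g\<in>E. g x = 0) \<and> (\<forall>g\<in>P. 0 < g x)"
  shows "\<exists>\<delta>>0. \<forall>t. 0 < t \<and> t < \<delta> \<longrightarrow>
      (\<exists>x\<in>polydisc (insert \<tau> K) (\<lambda>_. d). x \<tau> = t \<and> (\<forall>g\<in>E. g x = 0) \<and> (\<forall>g\<in>P. 0 < g x))"
proof -
  define \<sigma> :: "(('a \<Rightarrow> real) \<Rightarrow> real) \<Rightarrow> real" where "\<sigma> = (\<lambda>g. if g \<in> E then 0 else 1)"
  have \<sigma>: "(\<forall>g\<in>E. g x = 0) \<and> (\<forall>g\<in>P. 0 < g x) \<Longrightarrow> \<forall>g\<in>E \<union> P. sgn (g x) = \<sigma> g" for x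
    by (auto simp: \<sigma>_def)
  have disj: "g \<notin> E" if "g \<in> P" for g using ex[of 1] that by force
  have "\<exists>\<delta>>0. \<forall>t. 0 < t \<and> t < \<delta> \<longrightarrow>
      (\<exists>x\<in>polydisc (insert \<tau> K) (\<lambda>_. d). x \<tau> = t \<and> (\<forall>g\<in>E \<union> P. sgn (g x) = \<sigma> g))"
  proof (rule pexp_fibres_near_zero[OF assms(1,2) _ assms(5) pexp])
    show "finite (E \<union> P)" using assms(3,4) by simp
    show "\<exists>x. 0 < x \<tau> \<and> x \<tau> < \<epsilon> \<and> (\<forall>i\<in>K. \<bar>x i\<bar> < \<epsilon>) \<and> (\<forall>g\<in>E \<union> P. sgn (g x) = \<sigma> g)"
      if "0 < \<epsilon>" for \<epsilon>
      using ex[OF that] \<sigma> by blast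
  qed
  moreover have "(\<forall>g\<in>E. g x = 0) \<and> (\<forall>g\<in>P. 0 < g x)" if "\<forall>g\<in>E \<union> P. sgn (g x) = \<sigma> g" for x
  proof (intro conjI ballI)
    show "g x = 0" if "g \<in> E" for g
    proof -
      have "sgn (g x) = \<sigma> g" using \<open>\<forall>g\<in>E \<union> P. sgn (g x) = \<sigma> g\<close> that by blast
      then show ?thesis using that by (simp add: \<sigma>_def sgn_zero_iff)
    qed
    show "0 < g x" if "g \<in> P" for g
    proof -
      have "sgn (g x) = 1" using \<open>\<forall>g\<in>E \<union> P. sgn (g x) = \<sigma> g\<close> that disj by (simp add: \<sigma>_def)
      then show ?thesis by (simp add: sgn_1_pos)
    qed
  qed
  ultimately show ?thesis by meson
qed

section \<open>Analytic functions and boxes in the product topology\<close>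

lemma real_analytic_at_pexp:
  assumes "finite I" "real_analytic_at I f a"
  shows "\<exists>r>0. \<forall>d. 0 < d \<and> d < r \<longrightarrow> (\<exists>M. pexp I (\<lambda>_. d) M (\<lambda>x. f (\<lambda>i\<in>I. a i + x i)))"
proof -
  obtain r c where r: "0 < r" and f: "\<And>x. x \<in> topspace (powertop_real I) \<Longrightarrow> (\<forall>i\<in>I. \<bar>x i - a i\<bar> < r) \<Longrightarrow>
      ((\<lambda>\<alpha>. c \<alpha> * (\<Prod>i\<in>I. (x i - a i) ^ \<alpha> i)) has_sum f x) (I \<rightarrow>\<^sub>E UNIV)"
    using assms(2) unfolding real_analytic_at_def by blast
  have sum: "((\<lambda>\<alpha>. c \<alpha> * monomial I \<alpha> x) has_sum f (\<lambda>i\<in>I. a i + x i)) (I \<rightarrow>\<^sub>E UNIV)"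
    if "\<forall>i\<in>I. \<bar>x i\<bar> < r" for x
    using f[of "\<lambda>i\<in>I. a i + x i"] that by (simp add: monomial_def)
  show ?thesis
  proof (rule exI[of _ r], intro conjI allI impI r)
    fix d assume d: "0 < d \<and> d < r"
    \<comment> \<open>Convergence at the corner \<open>(d, ..., d)\<close> of the polydisc is
      unconditional, hence absolute, which makes the norm for radius \<open>d\<close>
      finite.\<close>
    have "(\<lambda>\<alpha>. c \<alpha> * monomial I \<alpha> (\<lambda>_. d)) summable_on (I \<rightarrow>\<^sub>E UNIV)"
      using sum[of "\<lambda>_. d"] d by (auto simp: summable_on_def)
    then have "(\<lambda>\<alpha>. norm (c \<alpha> * monomial I \<alpha> (\<lambda>_. d))) summable_on (I \<rightarrow>\<^sub>E UNIV)"
      by (rule summable_on_iff_abs_summable_on_real[THEN iffD1])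
    moreover have "norm (c \<alpha> * monomial I \<alpha> (\<lambda>_. d)) = \<bar>c \<alpha>\<bar> * monomial I \<alpha> (\<lambda>_. d)" for \<alpha>
      using d monomial_nonneg[of I "\<lambda>_. d" \<alpha>] by (simp add: abs_mult)
    ultimately obtain M where
      M: "((\<lambda>\<alpha>. \<bar>c \<alpha>\<bar> * monomial I \<alpha> (\<lambda>_. d)) has_sum M) (I \<rightarrow>\<^sub>E UNIV)"
      by (auto simp: summable_on_def)
    have "pexp I (\<lambda>_. d) M (\<lambda>x. f (\<lambda>i\<in>I. a i + x i))"
    proof (rule pexpI_countable[OF _ _ M order_refl])
      show "countable (I \<rightarrow>\<^sub>E (UNIV :: nat set))" using assms(1) by (intro countable_PiE) auto
      show "((\<lambda>\<alpha>. c \<alpha> * monomial I \<alpha> x) has_sum f (\<lambda>i\<in>I. a i + x i)) (I \<rightarrow>\<^sub>E UNIV)"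
        if "x \<in> polydisc I (\<lambda>_. d)" for x
        by (rule sum) (use that d in \<open>force simp: polydisc_def\<close>)
    qed (use d in auto)
    then show "\<exists>M. pexp I (\<lambda>_. d) M (\<lambda>x. f (\<lambda>i\<in>I. a i + x i))" ..
  qed
qed

text \<open>Stated with cluster points rather than subsequences because it is also applied in an
  uncountable product, where a sequence in a compact set need not have a convergent
  subsequence.\<close>

lemma compactin_cluster_point:
  assumes K: "compactin T K" and z: "\<And>k::nat. z k \<in> K"
  shows "\<exists>a\<in>K. \<forall>W. openin T W \<and> a \<in> W \<longrightarrow> (\<exists>\<^sub>F k in sequentially. z k \<in> W)"
proof (rule ccontr)
  assume *: "\<not> ?thesis"
  let ?W = "{W. openin T W \<and> (\<forall>\<^sub>F k in sequentially. z k \<notin> W)}"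
  have "K \<subseteq> \<Union>?W"
  proof
    fix a assume "a \<in> K"
    then obtain W where "openin T W" "a \<in> W" "\<not> (\<exists>\<^sub>F k in sequentially. z k \<in> W)" using * by auto
    then show "a \<in> \<Union>?W" by (intro UnionI[of W]) (auto simp: not_frequently)
  qed
  then have "\<exists>F. finite F \<and> F \<subseteq> ?W \<and> K \<subseteq> \<Union>F" by (intro compactinD[OF K]) auto
  then obtain F where F: "finite F" "F \<subseteq> ?W" "K \<subseteq> \<Union>F" by (elim exE conjE)
  have "\<forall>\<^sub>F k in sequentially. \<forall>W\<in>F. z k \<notin> W"
  proof (rule eventually_ball_finite[OF F(1)], intro ballI)
    fix W assume "W \<in> F"
    then have "W \<in> ?W" by (rule subsetD[OF F(2)])
    then show "\<forall>\<^sub>F k in sequentially. z k \<notin> W" by simp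
  qed
  then obtain k where "\<forall>W\<in>F. z k \<notin> W" unfolding eventually_sequentially by blast
  then have "z k \<notin> \<Union>F" by simp
  then show False using z[of k] F(3) by (meson subsetD)
qed

lemma openin_powertop_real_box:
  assumes "finite I" "a \<in> topspace (powertop_real I)"
  shows "openin (powertop_real I) {x \<in> topspace (powertop_real I). \<forall>i\<in>I. \<bar>x i - a i\<bar> < e}"
proof -
  have "{x \<in> topspace (powertop_real I). \<forall>i\<in>I. \<bar>x i - a i\<bar> < e} = (\<Pi>\<^sub>E i\<in>I. ball (a i) e)"
    by (auto simp: PiE_iff dist_real_def abs_minus_commute extensional_def)
  then show ?thesis using assms(1) by (simp add: openin_PiE)
qed

lemma openin_powertop_real_contains_box:
  assumes "finite I" "openin (powertop_real I) U" "a \<in> U"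
  shows "\<exists>r>0. \<forall>x\<in>topspace (powertop_real I). (\<forall>i\<in>I. \<bar>x i - a i\<bar> < r) \<longrightarrow> x \<in> U"
proof -
  have "\<exists>V. finite {i \<in> I. V i \<noteq> topspace euclideanreal} \<and> (\<forall>i\<in>I. openin euclideanreal (V i)) \<and>
      a \<in> PiE I V \<and> PiE I V \<subseteq> U"
    by (rule bspec[OF assms(2)[unfolded openin_product_topology_alt] assms(3)])
  then obtain V where V: "\<And>i. i \<in> I \<Longrightarrow> open (V i)" "a \<in> PiE I V" "PiE I V \<subseteq> U"
    unfolding open_openin[symmetric] by blast
  have "\<forall>i\<in>I. \<exists>e>0. ball (a i) e \<subseteq> V i"
    using V(1,2) by (meson PiE_mem open_contains_ball)
  from bchoice[OF this] obtain e where e: "\<And>i. i \<in> I \<Longrightarrow> 0 < e i \<and> ball (a i) (e i) \<subseteq> V i" by blast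
  obtain r where r: "0 < r" "\<And>i. i \<in> I \<Longrightarrow> r \<le> e i"
    using finite_positive_lower_bound[OF assms(1), of e] e by blast
  have "x \<in> U" if x: "x \<in> topspace (powertop_real I)" "\<forall>i\<in>I. \<bar>x i - a i\<bar> < r" for x
  proof -
    have "x i \<in> V i" if "i \<in> I" for i
    proof -
      have "x i \<in> ball (a i) (e i)" using x(2) that r(2)[OF that] by (force simp: dist_real_def)
      then show ?thesis using e[OF that] by blast
    qed
    then have "x \<in> PiE I V" using x(1) by (auto simp: PiE_iff)
    then show ?thesis using V(3) by blast
  qed
  then show ?thesis using r(1) by blast
qed

section \<open>Tangent vectors at all small scales\<close>

lemma tangent_vector_in_cone:
  fixes x0 v :: "'a::real_inner"
  assumes v: "v \<in> tangent_cone X x0" "v \<noteq> 0" and c: "0 \<le> c" "c < 1"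
  obtains x where "\<And>k. x k \<in> X" "x \<longlonglongrightarrow> x0"
    "\<And>k::nat. 0 < (x k - x0) \<bullet> (v /\<^sub>R norm v)"
    "\<And>k. c * (norm (x k - x0))\<^sup>2 < ((x k - x0) \<bullet> (v /\<^sub>R norm v))\<^sup>2"
proof -
  obtain x t where x: "\<And>i. x i \<in> X - {x0}" "x \<longlonglongrightarrow> x0" and t: "\<And>i::nat. 0 < t i"
    and lim: "(\<lambda>i. (1 / t i) *\<^sub>R (x i - x0)) \<longlonglongrightarrow> v"
    using v(1) unfolding tangent_cone_def by blast
  define u where "u = v /\<^sub>R norm v"
  define w where "w = (\<lambda>i. (1 / t i) *\<^sub>R (x i - x0))"
  have w: "w \<longlonglongrightarrow> v" using lim by (simp add: w_def)
  have xw: "x i - x0 = t i *\<^sub>R w i" for i using t[of i] by (simp add: w_def)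
  have vu: "v \<bullet> u = norm v" using v(2) by (simp add: u_def power2_norm_eq_inner[symmetric] power2_eq_square)
  have nv: "0 < norm v" using v(2) by simp
  have "(\<lambda>i. w i \<bullet> u) \<longlonglongrightarrow> norm v" using tendsto_inner[OF w tendsto_const[of u]] vu by simp
  then have 1: "\<forall>\<^sub>F i in sequentially. 0 < w i \<bullet> u" using order_tendstoD(1) nv by blast
  \<comment> \<open>Squares make the cone a polynomial condition. As \<open>u\<close> is the unit
    vector of \<open>v\<close>, the limit is \<open>(1 - c) * (norm v)\<^sup>2\<close>, which is
    positive, so the strict inequality holds eventually.\<close>
  have "(\<lambda>i. (w i \<bullet> u)\<^sup>2 - c * (norm (w i))\<^sup>2) \<longlonglongrightarrow> (v \<bullet> u)\<^sup>2 - c * (norm v)\<^sup>2"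
    by (intro tendsto_intros w)
  moreover have "0 < (v \<bullet> u)\<^sup>2 - c * (norm v)\<^sup>2" using vu c nv by simp
  ultimately have 2: "\<forall>\<^sub>F i in sequentially. 0 < (w i \<bullet> u)\<^sup>2 - c * (norm (w i))\<^sup>2"
    using order_tendstoD(1) by blast
  obtain N where N: "\<And>i. N \<le> i \<Longrightarrow> 0 < w i \<bullet> u \<and> 0 < (w i \<bullet> u)\<^sup>2 - c * (norm (w i))\<^sup>2"
    using eventually_conj[OF 1 2] unfolding eventually_sequentially by blast
  show thesis
  proof (rule that[of "\<lambda>k. x (k + N)"])
    show "x (k + N) \<in> X" for k using x(1) by blast
    show "(\<lambda>k. x (k + N)) \<longlonglongrightarrow> x0" using x(2) by (rule LIMSEQ_ignore_initial_segment)
    show "0 < (x (k + N) - x0) \<bullet> (v /\<^sub>R norm v)" for k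
      using N[of "k + N"] t[of "k + N"] unfolding u_def[symmetric] xw by simp
    show "c * (norm (x (k + N) - x0))\<^sup>2 < ((x (k + N) - x0) \<bullet> (v /\<^sub>R norm v))\<^sup>2" for k
    proof -
      have "0 < (t (k + N))\<^sup>2 * ((w (k + N) \<bullet> u)\<^sup>2 - c * (norm (w (k + N)))\<^sup>2)"
        using N[of "k + N"] t[of "k + N"] by simp
      then show ?thesis unfolding u_def[symmetric] xw
        by (simp add: power_mult_distrib algebra_simps)
    qed
  qed
qed

text \<open>Points of \<open>X\<close> in a cone around \<open>u\<close> are lifted to
  \<open>A\<close>, and \<open>Inr m\<close> is added as a coordinate for their height over
  \<open>x0\<close> in direction \<open>u\<close>. The lifts cluster at a point \<open>a\<close>,
  around which the fibre theorem supplies a point for every small height.\<close>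

lemma subanalytic_tangent_unit:
  fixes X :: "(real ^ 'n::finite) set"
  assumes X: "subanalytic X" and v: "v \<in> tangent_cone X x0" "v \<noteq> 0" and \<epsilon>: "0 < \<epsilon>"
  shows "\<exists>\<delta>>0. \<forall>t. 0 < t \<and> t < \<delta> \<longrightarrow> (\<exists>p\<in>X. norm (p - x0 - t *\<^sub>R (v /\<^sub>R norm v)) \<le> \<epsilon> * t)"
proof -
  define u where "u = v /\<^sub>R norm v"
  have uu: "u \<bullet> u = 1" using v(2) by (simp add: u_def power2_norm_eq_inner[symmetric] field_simps power2_eq_square)
  \<comment> \<open>For \<open>q\<close> of height \<open>t\<close>, the squared distance from
    \<open>q\<close> to \<open>t u\<close> is \<open>(norm q)\<^sup>2 - t\<^sup>2\<close>; it is
    below \<open>(\<epsilon> t)\<^sup>2\<close> exactly if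
    \<open>c * (norm q)\<^sup>2 < t\<^sup>2\<close> with this \<open>c\<close>.\<close>
  define c where "c = 1 / (1 + \<epsilon>\<^sup>2)"
  have c: "0 \<le> c" "c < 1" using \<epsilon> by (auto simp: c_def divide_less_eq add_pos_pos)
  obtain U m A where U: "open U" "x0 \<in> U" and A: "semianalytic (UNIV <+> {..<m}) A"
    and cpt: "compactin (powertop_real (UNIV <+> {..<m})) (powertop_real (UNIV <+> {..<m}) closure_of A)"
    and XU: "X \<inter> U = base_proj ` A"
    using X unfolding subanalytic_def by meson
  define I :: "('n + nat) set" where "I = UNIV <+> {..<m}"
  define T where "T = powertop_real I"
  have finI: "finite I" by (simp add: I_def)
  have \<tau>: "Inr m \<notin> I" by (auto simp: I_def)
  have InlI: "Inl i \<in> I" for i by (auto simp: I_def)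
  obtain x where x: "\<And>k. x k \<in> X" "x \<longlonglongrightarrow> x0" "\<And>k::nat. 0 < (x k - x0) \<bullet> u"
    "\<And>k. c * (norm (x k - x0))\<^sup>2 < ((x k - x0) \<bullet> u)\<^sup>2"
    unfolding u_def by (rule tangent_vector_in_cone[OF v c]) blast
  obtain N where N: "\<And>k. N \<le> k \<Longrightarrow> x k \<in> U"
    using topological_tendstoD[OF x(2) U] unfolding eventually_sequentially by blast
  have "\<exists>z\<in>A. base_proj z = x (k + N)" for k using x(1)[of "k + N"] N[of "k + N"] XU by force
  then obtain z where z: "\<And>k. z k \<in> A" "\<And>k. base_proj (z k) = x (k + N)" by metis
  have Atop: "A \<subseteq> topspace T" using A by (simp add: semianalytic_def T_def I_def)
  have zcl: "z k \<in> T closure_of A" for k using z(1) closure_of_subset[OF Atop] by blast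
  \<comment> \<open>The lifts lie in a compact set and so cluster at some \<open>a\<close>, possibly
    outside \<open>A\<close>; the semianalytic description is available there too.\<close>
  have "\<exists>a\<in>T closure_of A. \<forall>W. openin T W \<and> a \<in> W \<longrightarrow> (\<exists>\<^sub>F k in sequentially. z k \<in> W)"
    by (rule compactin_cluster_point[OF cpt[folded I_def, folded T_def] zcl])
  then obtain a where a: "a \<in> T closure_of A"
    and "\<forall>W. openin T W \<and> a \<in> W \<longrightarrow> (\<exists>\<^sub>F k in sequentially. z k \<in> W)" ..
  then have cluster: "\<exists>\<^sub>F k in sequentially. z k \<in> W" if "openin T W" "a \<in> W" for W
    using that by simp
  have atop: "a \<in> topspace T" using a by (rule subsetD[OF closure_of_subset_topspace])
  have "\<exists>U D. openin T U \<and> a \<in> U \<and> finite D \<and>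
        (\<forall>(E, P)\<in>D. finite E \<and> finite P \<and> (\<forall>f \<in> E \<union> P. real_analytic_on I f U)) \<and>
        A \<inter> U = (\<Union>(E, P)\<in>D. {x\<in>U. (\<forall>f\<in>E. f x = 0) \<and> (\<forall>g\<in>P. 0 < g x)})"
    using A atop unfolding semianalytic_def T_def I_def by blast
  then obtain V D where V: "openin T V" "a \<in> V" and D: "finite D"
    and Dfin0: "\<forall>(E, P)\<in>D. finite E \<and> finite P \<and> (\<forall>f \<in> E \<union> P. real_analytic_on I f V)"
    and AV: "A \<inter> V = (\<Union>(E, P)\<in>D. {x\<in>V. (\<forall>f\<in>E. f x = 0) \<and> (\<forall>g\<in>P. 0 < g x)})"
    by (elim exE conjE)
  have Dfin: "finite E \<and> finite P \<and> (\<forall>f\<in>E \<union> P. real_analytic_on I f V)" if "(E, P) \<in> D" for E P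
    using bspec[OF Dfin0 that] by simp
  obtain r where r: "0 < r" and box: "\<And>x. x \<in> topspace T \<Longrightarrow> (\<forall>i\<in>I. \<bar>x i - a i\<bar> < r) \<Longrightarrow> x \<in> V"
    using openin_powertop_real_contains_box[OF finI V[unfolded T_def]] unfolding T_def by blast
  \<comment> \<open>Finitely many pairs describe \<open>A\<close> near \<open>a\<close>; one of them
    is satisfied by lifts arbitrarily close to \<open>a\<close> and of arbitrarily small
    height.\<close>
  define Q where "Q = (\<lambda>\<epsilon> EP. \<exists>k. (\<forall>i\<in>I. \<bar>z k i - a i\<bar> < \<epsilon>) \<and> (x (k + N) - x0) \<bullet> u < \<epsilon> \<and>
     (\<forall>f\<in>fst EP. f (z k) = (0::real)) \<and> (\<forall>g\<in>snd EP. 0 < (g (z k) :: real)))"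
  have "\<exists>EP\<in>D. \<forall>\<epsilon>>0. Q \<epsilon> EP"
  proof (rule finite_choice_near_zero[OF D])
    fix e :: real assume e: "0 < e"
    define e' where "e' = min e r"
    have "\<exists>\<^sub>F k in sequentially. z k \<in> {x \<in> topspace T. \<forall>i\<in>I. \<bar>x i - a i\<bar> < e'}"
    proof (rule cluster)
      show "openin T {x \<in> topspace T. \<forall>i\<in>I. \<bar>x i - a i\<bar> < e'}"
        using openin_powertop_real_box[OF finI] atop unfolding T_def by blast
      have "0 < e'" using e r by (simp add: e'_def)
      then show "a \<in> {x \<in> topspace T. \<forall>i\<in>I. \<bar>x i - a i\<bar> < e'}" using atop by simp
    qed
    moreover have "\<forall>\<^sub>F k in sequentially. (x (k + N) - x0) \<bullet> u < e"
    proof -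
      have "(\<lambda>k. (x (k + N) - x0) \<bullet> u) \<longlonglongrightarrow> (x0 - x0) \<bullet> u"
        by (intro tendsto_intros LIMSEQ_ignore_initial_segment x(2))
      then show ?thesis using order_tendstoD(2) e by force
    qed
    ultimately have "\<exists>\<^sub>F k in sequentially. z k \<in> {x \<in> topspace T. \<forall>i\<in>I. \<bar>x i - a i\<bar> < e'} \<and>
       (x (k + N) - x0) \<bullet> u < e" by (rule frequently_eventually_frequently)
    then obtain k where k: "z k \<in> topspace T" "\<forall>i\<in>I. \<bar>z k i - a i\<bar> < e'" "(x (k + N) - x0) \<bullet> u < e"
      using frequently_ex by blast
    have "z k \<in> V" using box[OF k(1)] k(2) by (auto simp: e'_def)
    then have "z k \<in> A \<inter> V" using z(1) by blast
    then obtain E P where EP: "(E, P) \<in> D" "\<forall>f\<in>E. f (z k) = 0" "\<forall>g\<in>P. 0 < g (z k)"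
      unfolding AV by auto
    have "Q e (E, P)" unfolding Q_def
      using EP(2,3) k(2,3) by (intro exI[of _ k]) (simp add: e'_def)
    with EP(1) show "\<exists>EP\<in>D. Q e EP" ..
  next
    fix e e' EP assume "Q e EP" "e \<le> e'"
    then obtain k where "\<forall>i\<in>I. \<bar>z k i - a i\<bar> < e" "(x (k + N) - x0) \<bullet> u < e"
      "\<forall>f\<in>fst EP. f (z k) = 0" "\<forall>g\<in>snd EP. 0 < g (z k)" unfolding Q_def by blast
    then show "Q e' EP" unfolding Q_def using \<open>e \<le> e'\<close> by (intro exI[of _ k]) force
  qed
  then obtain E P where EP: "(E, P) \<in> D" and Qe: "\<And>e. 0 < e \<Longrightarrow> Q e (E, P)"
    unfolding Bex_def split_paired_Ex by blast
  have fin: "finite E" "finite P" using Dfin[OF EP] by auto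
  \<comment> \<open>Translation of the origin to \<open>a\<close>; restricting to \<open>I\<close>
    yields a point of the ambient space of \<open>A\<close> and discards the height
    coordinate.\<close>
  define sh where "sh = (\<lambda>x. \<lambda>i\<in>I. a i + x i)"
  have "\<forall>f\<in>E \<union> P. \<exists>r>0. \<forall>d. 0 < d \<and> d < r \<longrightarrow> (\<exists>M. pexp I (\<lambda>_. d) M (\<lambda>x. f (sh x)))"
    unfolding sh_def using real_analytic_at_pexp[OF finI] Dfin[OF EP] V(2) by (auto simp: real_analytic_on_def)
  from bchoice[OF this] obtain rf where rf: "\<And>f. f \<in> E \<union> P \<Longrightarrow> 0 < rf f"
    "\<And>f d. f \<in> E \<union> P \<Longrightarrow> 0 < d \<Longrightarrow> d < rf f \<Longrightarrow> \<exists>M. pexp I (\<lambda>_. d) M (\<lambda>x. f (sh x))" by blast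
  obtain d0 where d0: "0 < d0" "\<And>f. f \<in> E \<union> P \<Longrightarrow> d0 \<le> rf f"
    using finite_positive_lower_bound[of "E \<union> P" rf] fin rf(1) by blast
  define d where "d = min d0 r / 2"
  have d: "0 < d" "d < d0" "d < r" using d0(1) r by (auto simp: d_def)
  define Y where "Y = (\<lambda>(i::'n) (x :: 'n + nat \<Rightarrow> real). a (Inl i) + x (Inl i) - x0 $ i)"
  \<comment> \<open>\<open>ft = 0\<close> will say that the coordinate \<open>Inr m\<close> is the
    height, and \<open>fc > 0\<close> that the point lies in the cone.\<close>
  define ft where "ft = (\<lambda>x. x (Inr m) - (\<Sum>i\<in>UNIV. Y i x * u $ i))"
  define fc where "fc = (\<lambda>x. (x (Inr m))\<^sup>2 - c * (\<Sum>i\<in>UNIV. (Y i x)\<^sup>2))"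
  have bsh: "base_proj (sh x) - x0 = (\<chi> i. Y i x)" for x
    by (simp add: base_proj_def sh_def Y_def vec_eq_iff InlI)
  have ft: "ft x = x (Inr m) - (base_proj (sh x) - x0) \<bullet> u" for x
    by (simp add: bsh ft_def inner_vec_def)
  have fc: "fc x = (x (Inr m))\<^sup>2 - c * (norm (base_proj (sh x) - x0))\<^sup>2" for x
    unfolding bsh fc_def power2_norm_eq_inner inner_vec_def by (simp add: power2_eq_square)
  let ?J = "insert (Inr m) I" and ?d = "\<lambda>_. d"
  define E' where "E' = insert ft ((\<lambda>f x. f (sh x)) ` E)"
  define P' where "P' = insert fc ((\<lambda>f x. f (sh x)) ` P)"
  have "\<exists>\<delta>>0. \<forall>t. 0 < t \<and> t < \<delta> \<longrightarrow>
      (\<exists>x\<in>polydisc ?J ?d. x (Inr m) = t \<and> (\<forall>g\<in>E'. g x = 0) \<and> (\<forall>g\<in>P'. 0 < g x))"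
  proof (rule common_zeros_fibres[OF finI \<tau> _ _ d(1)])
    show "finite E'" "finite P'" using fin by (auto simp: E'_def P'_def)
    have var: "pexp ?J ?d d (\<lambda>x. x j)" if "j \<in> ?J" for j
      using pexp_var[of ?J ?d j] that finI d(1) by simp
    have const: "pexp ?J ?d \<bar>b\<bar> (\<lambda>_. b)" for b by (rule pexp_const) (rule d(1))
    have Yp: "\<exists>M. pexp ?J ?d M (Y i)" for i
      unfolding Y_def
      by (rule exI, rule pexp_diff[OF pexp_add[OF const var] const]) (simp add: InlI)
    then obtain MY where MY: "\<And>i. pexp ?J ?d (MY i) (Y i)" by metis
    have "pexp ?J ?d (d + (\<Sum>i\<in>UNIV. MY i * \<bar>u $ i\<bar>)) ft"
      unfolding ft_def by (intro pexp_diff pexp_sum pexp_mult MY const var) (use d(1) in auto)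
    moreover have "pexp ?J ?d (d ^ 2 + \<bar>c\<bar> * (\<Sum>i\<in>UNIV. MY i ^ 2)) fc"
      unfolding fc_def by (intro pexp_diff pexp_cmult pexp_sum pexp_power MY var) (use d(1) in auto)
    moreover have "\<exists>M. pexp ?J ?d M (\<lambda>x. f (sh x))" if f: "f \<in> E \<union> P" for f
    proof -
      obtain M where "pexp I ?d M (\<lambda>x. f (sh x))" using rf(2)[OF f d(1)] d(2) d0(2)[OF f] by force
      then have "pexp ?J ?d M (\<lambda>x. f (sh x))" by (rule pexp_superset) (use finI d(1) in auto)
      then show ?thesis ..
    qed
    ultimately show "\<exists>M. pexp ?J ?d M g" if "g \<in> E' \<union> P'" for g
      using that unfolding E'_def P'_def by blast
    fix e :: real assume "0 < e"
    from Qe[OF this] obtain k where k: "\<forall>i\<in>I. \<bar>z k i - a i\<bar> < e" "(x (k + N) - x0) \<bullet> u < e"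
      "\<forall>f\<in>E. f (z k) = 0" "\<forall>g\<in>P. 0 < g (z k)" by (auto simp: Q_def)
    define y where "y = (\<lambda>i. if i = Inr m then (x (k + N) - x0) \<bullet> u else z k i - a i)"
    have "z k \<in> topspace T" using z(1) Atop by blast
    then have "sh y = z k" using \<tau>
      by (auto simp: sh_def y_def fun_eq_iff T_def PiE_iff extensional_def restrict_def)
    then have "(\<forall>g\<in>E'. g y = 0) \<and> (\<forall>g\<in>P'. 0 < g y)"
      using k(3,4) z(2)[of k] x(4)[of "k + N"] by (auto simp: E'_def P'_def ft fc) (simp_all add: y_def)
    moreover have "0 < y (Inr m)" "y (Inr m) < e" using x(3) k(2) by (auto simp: y_def)
    moreover have "\<forall>i\<in>I. \<bar>y i\<bar> < e" using k(1) \<tau> by (auto simp: y_def)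
    ultimately show "\<exists>x. 0 < x (Inr m) \<and> x (Inr m) < e \<and> (\<forall>i\<in>I. \<bar>x i\<bar> < e) \<and>
        (\<forall>g\<in>E'. g x = 0) \<and> (\<forall>g\<in>P'. 0 < g x)" by blast
  qed
  then obtain \<delta> where \<delta>: "0 < \<delta>" and fib: "\<And>t. 0 < t \<Longrightarrow> t < \<delta> \<Longrightarrow>
      \<exists>x\<in>polydisc ?J ?d. x (Inr m) = t \<and> (\<forall>g\<in>E'. g x = 0) \<and> (\<forall>g\<in>P'. 0 < g x)" by blast
  show ?thesis unfolding u_def[symmetric]
  proof (rule exI[of _ \<delta>], intro conjI allI impI \<delta>)
    fix t assume t: "0 < t \<and> t < \<delta>"
    then obtain y where y: "y \<in> polydisc ?J ?d" "y (Inr m) = t" "\<forall>g\<in>E'. g y = 0" "\<forall>g\<in>P'. 0 < g y"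
      using fib by blast
    have top: "sh y \<in> topspace T" by (simp add: sh_def T_def)
    have "\<forall>i\<in>I. \<bar>sh y i - a i\<bar> < r" using y(1) d(3) by (force simp: sh_def polydisc_def)
    then have "sh y \<in> V" by (rule box[OF top])
    moreover have "(\<forall>f\<in>E. f (sh y) = 0) \<and> (\<forall>g\<in>P. 0 < g (sh y))" using y(3,4) by (auto simp: E'_def P'_def)
    ultimately have "sh y \<in> A \<inter> V" unfolding AV using EP by blast
    then have pX: "base_proj (sh y) \<in> X" using XU by blast
    define q where "q = base_proj (sh y) - x0"
    have qu: "q \<bullet> u = t" using y(2,3) by (simp add: E'_def ft q_def)
    have "c * (norm q)\<^sup>2 < t\<^sup>2" using y(2,4) by (simp add: P'_def fc q_def)
    then have "(norm q)\<^sup>2 < (1 + \<epsilon>\<^sup>2) * t\<^sup>2"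
      unfolding c_def by (simp add: divide_less_eq add_pos_nonneg mult.commute)
    moreover have "(norm (q - t *\<^sub>R u))\<^sup>2 = (norm q)\<^sup>2 - t\<^sup>2"
      unfolding power2_norm_eq_inner
      using qu uu by (simp add: inner_diff_left inner_diff_right inner_commute[of u q] power2_eq_square)
    ultimately have "(norm (q - t *\<^sub>R u))\<^sup>2 \<le> (\<epsilon> * t)\<^sup>2" by (simp add: power_mult_distrib algebra_simps)
    then have "norm (q - t *\<^sub>R u) \<le> \<epsilon> * t" by (rule power2_le_imp_le) (use \<epsilon> t in auto)
    then show "\<exists>p\<in>X. norm (p - x0 - t *\<^sub>R u) \<le> \<epsilon> * t" using pX by (auto simp: q_def)
  qed
qed

theorem subanalytic_tangent_approx:
  fixes X :: "(real ^ 'n::finite) set"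
  assumes X: "subanalytic X" and v: "v \<in> tangent_cone X x0" "v \<noteq> 0" and \<epsilon>: "0 < \<epsilon>"
  shows "\<exists>\<delta>>0. \<forall>t. 0 < t \<and> t < \<delta> \<longrightarrow> (\<exists>p\<in>X. norm (p - x0 - t *\<^sub>R v) \<le> \<epsilon> * t)"
proof -
  have nv: "0 < norm v" using v(2) by simp
  obtain \<delta> where \<delta>: "0 < \<delta>" and *: "\<And>t. 0 < t \<Longrightarrow> t < \<delta> \<Longrightarrow>
      \<exists>p\<in>X. norm (p - x0 - t *\<^sub>R (v /\<^sub>R norm v)) \<le> \<epsilon> / norm v * t"
    using subanalytic_tangent_unit[OF X v, of "\<epsilon> / norm v"] \<epsilon> nv by auto
  have "\<exists>p\<in>X. norm (p - x0 - t *\<^sub>R v) \<le> \<epsilon> * t" if "0 < t" "t < \<delta> / norm v" for t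
    using *[of "t * norm v"] that nv by (simp add: field_simps)
  then show ?thesis using \<delta> nv by (intro exI[of _ "\<delta> / norm v"]) auto
qed

section \<open>Blowing up a bi-Lipschitz map\<close>

text \<open>Dividing by the square root of the distance makes any sequence that tends to
  \<open>x0\<close> represent 0. The vector 0 needs its own criterion because the cone is empty when
  \<open>x0\<close> is isolated.\<close>

lemma zero_in_tangent_cone_iff:
  fixes x0 :: "'a::real_normed_vector"
  shows "0 \<in> tangent_cone X x0 \<longleftrightarrow> x0 islimpt X"
proof
  assume "0 \<in> tangent_cone X x0"
  then show "x0 islimpt X" unfolding tangent_cone_def islimpt_sequential by blast
next
  assume "x0 islimpt X"
  then obtain f where f: "\<And>n::nat. f n \<in> X - {x0}" "f \<longlonglongrightarrow> x0" unfolding islimpt_sequential by blast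
  define t where "t = (\<lambda>n. sqrt (norm (f n - x0)))"
  have pos: "0 < t n" for n using f(1)[of n] by (simp add: t_def)
  have "norm ((1 / t n) *\<^sub>R (f n - x0)) = t n" for n
  proof -
    have "norm (f n - x0) = t n * t n" by (simp add: t_def)
    then show ?thesis using pos[of n] by simp
  qed
  moreover have "t \<longlonglongrightarrow> sqrt (norm (x0 - x0))" unfolding t_def by (intro tendsto_intros f(2))
  ultimately have "(\<lambda>n. norm ((1 / t n) *\<^sub>R (f n - x0))) \<longlonglongrightarrow> 0" by simp
  then have "(\<lambda>n. (1 / t n) *\<^sub>R (f n - x0)) \<longlonglongrightarrow> 0" by (rule tendsto_norm_zero_cancel)
  then show "0 \<in> tangent_cone X x0" unfolding tangent_cone_def using f pos by blast
qed

text \<open>As \<open>s\<close> tends to infinity, \<open>y n\<close> tends to \<open>y0\<close>;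
  since \<open>w \<noteq> 0\<close>, the points differ from \<open>y0\<close> from some index on, as
  the tangent cone demands.\<close>

lemma tangent_coneI:
  fixes y0 :: "'a::real_normed_vector"
  assumes y: "\<And>n::nat. y n \<in> Y" and s: "filterlim s at_top sequentially"
    and lim: "(\<lambda>n. s n *\<^sub>R (y n - y0)) \<longlonglongrightarrow> w" and w: "w \<noteq> 0"
  shows "w \<in> tangent_cone Y y0"
proof -
  have inv: "(\<lambda>n. inverse (s n)) \<longlonglongrightarrow> 0" by (rule tendsto_inverse_0_at_top[OF s])
  have spos: "\<forall>\<^sub>F n in sequentially. 0 < s n" using s by (simp add: filterlim_at_top_dense)
  have "(\<lambda>n. inverse (s n) *\<^sub>R (s n *\<^sub>R (y n - y0))) \<longlonglongrightarrow> 0 *\<^sub>R w" by (intro tendsto_intros inv lim)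
  moreover have "\<forall>\<^sub>F n in sequentially. inverse (s n) *\<^sub>R (s n *\<^sub>R (y n - y0)) = y n - y0"
    using spos by (rule eventually_mono) simp
  ultimately have "(\<lambda>n. y n - y0) \<longlonglongrightarrow> 0" using tendsto_cong by force
  then have yl: "y \<longlonglongrightarrow> y0" by (simp add: LIM_zero_iff)
  have "\<forall>\<^sub>F n in sequentially. s n *\<^sub>R (y n - y0) \<noteq> 0" using lim w by (rule tendsto_imp_eventually_ne)
  with spos have "\<forall>\<^sub>F n in sequentially. 0 < s n \<and> y n \<noteq> y0" by eventually_elim auto
  then obtain N where N: "\<And>n. N \<le> n \<Longrightarrow> 0 < s n \<and> y n \<noteq> y0" unfolding eventually_sequentially by blast
  have "(\<lambda>n. (1 / (1 / s (n + N))) *\<^sub>R (y (n + N) - y0)) \<longlonglongrightarrow> w"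
    using LIMSEQ_ignore_initial_segment[OF lim, of N] by simp
  then show ?thesis unfolding tangent_cone_def using y N yl
    by (intro CollectI exI[of _ "\<lambda>n. y (n + N)"] exI[of _ "\<lambda>n. 1 / s (n + N)"])
       (auto intro: LIMSEQ_ignore_initial_segment)
qed

text \<open>\<open>\<xi> k\<close> nearly minimises the error at scale \<open>1 / (k + 1)\<close>,
  with slack \<open>1 / (k + 1)\<close> as the infimum may not be attained. One choice per scale
  serves all \<open>\<epsilon>\<close> at once because the infima tend to 0. For
  \<open>v = 0\<close> membership in the closure is enough.\<close>

lemma realizing_sequence:
  fixes x0 v :: "'a::real_normed_vector"
  assumes U: "open U" "x0 \<in> U" and cl: "x0 \<in> closure X"
    and ap: "v = 0 \<or> (\<forall>\<epsilon>>0. \<exists>\<delta>>0. \<forall>t. 0 < t \<and> t < \<delta> \<longrightarrow> (\<exists>p\<in>X. norm (p - x0 - t *\<^sub>R v) \<le> \<epsilon> * t))"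
  shows "\<exists>\<xi>. (\<forall>k. \<xi> k \<in> X \<inter> U) \<and> (\<lambda>k. real (Suc k) *\<^sub>R (\<xi> k - x0)) \<longlonglongrightarrow> v"
proof -
  define e where "e = (\<lambda>k p. norm (real (Suc k) *\<^sub>R (p - x0) - v))"
  define E where "E = (\<lambda>k. INF p\<in>X \<inter> U. e k p)"
  have ne: "X \<inter> U \<noteq> {}" using U cl by (auto simp: closure_iff_nhds_not_empty)
  have bdd: "bdd_below (e k ` (X \<inter> U))" for k by (rule bdd_belowI[of _ 0]) (auto simp: e_def)
  have "\<exists>p\<in>X \<inter> U. e k p < E k + 1 / real (Suc k)" for k
    using cInf_lessD[of "e k ` (X \<inter> U)" "E k + 1 / real (Suc k)"] ne by (auto simp: E_def)
  then obtain \<xi> where \<xi>: "\<And>k. \<xi> k \<in> X \<inter> U" "\<And>k. e k (\<xi> k) < E k + 1 / real (Suc k)" by metis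
  have ap': "\<exists>\<delta>>0. \<forall>t. 0 < t \<and> t < \<delta> \<longrightarrow> (\<exists>p\<in>X. norm (p - x0 - t *\<^sub>R v) \<le> \<epsilon> * t)" if "0 < \<epsilon>" for \<epsilon>
  proof (cases "v = 0")
    case True
    have "\<exists>p\<in>X. norm (p - x0 - t *\<^sub>R v) \<le> \<epsilon> * t" if t: "0 < t" for t
    proof -
      have "0 < \<epsilon> * t" using t \<open>0 < \<epsilon>\<close> by simp
      then obtain p where "p \<in> X" "dist p x0 < \<epsilon> * t" using cl unfolding closure_approachable by blast
      then show ?thesis using True by (intro bexI[of _ p]) (auto simp: dist_norm)
    qed
    then show ?thesis by (intro exI[of _ 1]) auto
  qed (use ap that in auto)
  obtain r where r: "0 < r" "ball x0 r \<subseteq> U" using U open_contains_ball by blast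
  have evE: "\<forall>\<^sub>F k in sequentially. E k \<le> \<epsilon>" if \<epsilon>: "0 < \<epsilon>" for \<epsilon>
  proof -
    obtain \<delta> where \<delta>: "0 < \<delta>" "\<And>t. 0 < t \<Longrightarrow> t < \<delta> \<Longrightarrow> \<exists>p\<in>X. norm (p - x0 - t *\<^sub>R v) \<le> \<epsilon> * t"
      using ap'[OF \<epsilon>] by blast
    have lim: "(\<lambda>k. 1 / real (Suc k)) \<longlonglongrightarrow> 0" by (rule LIMSEQ_Suc[OF lim_1_over_n])
    have "(\<lambda>k. 1 / real (Suc k) * (\<epsilon> + norm v)) \<longlonglongrightarrow> 0 * (\<epsilon> + norm v)" by (intro tendsto_intros lim)
    then have "\<forall>\<^sub>F k in sequentially. 1 / real (Suc k) * (\<epsilon> + norm v) < r"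
      using order_tendstoD(2) r(1) by force
    moreover have "\<forall>\<^sub>F k in sequentially. 1 / real (Suc k) < \<delta>" using order_tendstoD(2)[OF lim \<delta>(1)] .
    ultimately show ?thesis
    proof eventually_elim
      case (elim k)
      define t where "t = 1 / real (Suc k)"
      have t: "0 < t" "t < \<delta>" "real (Suc k) * t = 1" using elim(2) by (auto simp: t_def)
      obtain p where p: "p \<in> X" "norm (p - x0 - t *\<^sub>R v) \<le> \<epsilon> * t" using \<delta>(2)[OF t(1,2)] by blast
      have "norm (p - x0) \<le> norm (p - x0 - t *\<^sub>R v) + norm (t *\<^sub>R v)"
        using norm_triangle_ineq[of "p - x0 - t *\<^sub>R v" "t *\<^sub>R v"] by simp
      also have "\<dots> \<le> t * (\<epsilon> + norm v)" using p(2) t(1) by (simp add: algebra_simps)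
      also have "\<dots> < r" using elim(1) by (simp add: t_def)
      finally have "p \<in> U" using r(2) by (auto simp: dist_norm norm_minus_commute)
      have "real (Suc k) *\<^sub>R (p - x0) - v = real (Suc k) *\<^sub>R (p - x0 - t *\<^sub>R v)"
        using t(3) by (simp add: scaleR_diff_right)
      then have "e k p = real (Suc k) * norm (p - x0 - t *\<^sub>R v)" by (simp add: e_def)
      also have "\<dots> \<le> real (Suc k) * (\<epsilon> * t)" using p(2) by (intro mult_left_mono) auto
      also have "\<dots> = \<epsilon>" using t(3) by (simp add: mult.left_commute)
      finally have "e k p \<le> \<epsilon>" .
      moreover have "E k \<le> e k p" unfolding E_def using \<open>p \<in> U\<close> p(1) by (intro cINF_lower bdd) auto
      ultimately show ?case by simp
    qed
  qed
  have "(\<lambda>k. e k (\<xi> k)) \<longlonglongrightarrow> 0"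
  proof (rule tendstoI)
    fix \<epsilon> :: real assume \<epsilon>: "0 < \<epsilon>"
    have "\<forall>\<^sub>F k in sequentially. 1 / real (Suc k) < \<epsilon> / 2"
      using order_tendstoD(2)[OF LIMSEQ_Suc[OF lim_1_over_n], of "\<epsilon> / 2"] \<epsilon> by simp
    moreover have "\<forall>\<^sub>F k in sequentially. E k \<le> \<epsilon> / 2" by (rule evE) (use \<epsilon> in simp)
    ultimately show "\<forall>\<^sub>F k in sequentially. dist (e k (\<xi> k)) 0 < \<epsilon>"
    proof (eventually_elim)
      case (elim k)
      have "0 \<le> e k (\<xi> k)" by (simp add: e_def)
      then show ?case using elim \<xi>(2)[of k] by (simp add: dist_real_def)
    qed
  qed
  then have "(\<lambda>k. real (Suc k) *\<^sub>R (\<xi> k - x0) - v) \<longlonglongrightarrow> 0"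
    unfolding e_def by (rule tendsto_norm_zero_cancel)
  then have "(\<lambda>k. real (Suc k) *\<^sub>R (\<xi> k - x0)) \<longlonglongrightarrow> v" by (simp add: LIM_zero_iff)
  then show ?thesis using \<xi>(1) by blast
qed

section \<open>Limits of rescaled bi-Lipschitz maps\<close>

definition bilipschitz_between :: "real \<Rightarrow> 'a::real_normed_vector set \<Rightarrow> ('a \<Rightarrow> 'b::real_normed_vector) \<Rightarrow> bool" where
  "bilipschitz_between K S h \<longleftrightarrow> 0 < K \<and>
     (\<forall>x\<in>S. \<forall>y\<in>S. norm (h x - h y) \<le> K * norm (x - y) \<and> norm (x - y) \<le> K * norm (h x - h y))"

lemma bilipschitz_between_inj_on:
  assumes "bilipschitz_between K S h" shows "inj_on h S"
proof (rule inj_onI)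
  fix x y assume "x \<in> S" "y \<in> S" "h x = h y"
  then have "norm (x - y) \<le> K * norm (h x - h y)" using assms unfolding bilipschitz_between_def by blast
  then show "x = y" using \<open>h x = h y\<close> by simp
qed

lemma filterlim_real_Suc_strict_mono:
  "strict_mono r \<Longrightarrow> filterlim (\<lambda>n. real (Suc (r n))) at_top sequentially"
  by (intro filterlim_compose[OF filterlim_real_sequentially] filterlim_compose[OF filterlim_Suc]
      filterlim_subseq)

text \<open>Both inequalities are homogeneous, so they survive scaling by \<open>s n\<close> and
  passage to the limit. For \<open>v = 0\<close> they force \<open>w = 0\<close>, which later proves
  surjectivity.\<close>

lemma bilipschitz_between_limit:
  assumes h: "bilipschitz_between K S h" and pq: "\<And>n::nat. p n \<in> S" "\<And>n. q n \<in> S"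
    and lim: "(\<lambda>n. s n *\<^sub>R (p n - q n)) \<longlonglongrightarrow> v" "(\<lambda>n. s n *\<^sub>R (h (p n) - h (q n))) \<longlonglongrightarrow> w"
  shows "norm w \<le> K * norm v" "norm v \<le> K * norm w"
proof -
  have b: "norm (h (p n) - h (q n)) \<le> K * norm (p n - q n)" "norm (p n - q n) \<le> K * norm (h (p n) - h (q n))" for n
    using h pq unfolding bilipschitz_between_def by auto
  show "norm w \<le> K * norm v"
  proof (rule LIMSEQ_le[OF tendsto_norm[OF lim(2)] tendsto_mult_left[OF tendsto_norm[OF lim(1)]]], intro exI allI impI)
    show "norm (s n *\<^sub>R (h (p n) - h (q n))) \<le> K * norm (s n *\<^sub>R (p n - q n))" for n
      using mult_left_mono[OF b(1), of "\<bar>s n\<bar>"] by (simp add: mult.left_commute)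
  qed
  show "norm v \<le> K * norm w"
  proof (rule LIMSEQ_le[OF tendsto_norm[OF lim(1)] tendsto_mult_left[OF tendsto_norm[OF lim(2)]]], intro exI allI impI)
    show "norm (s n *\<^sub>R (p n - q n)) \<le> K * norm (s n *\<^sub>R (h (p n) - h (q n)))" for n
      using mult_left_mono[OF b(2), of "\<bar>s n\<bar>"] by (simp add: mult.left_commute)
  qed
qed

lemma blowup_limit:
  assumes h: "bilipschitz_between K (insert x0 S) h" "h x0 = y0" "\<And>x. x \<in> S \<Longrightarrow> h x \<in> Y"
    and \<xi>: "\<And>k. \<xi> k \<in> S" "(\<lambda>k. real (Suc k) *\<^sub>R (\<xi> k - x0)) \<longlonglongrightarrow> v"
    and r: "strict_mono r" "(\<lambda>n. real (Suc (r n)) *\<^sub>R (h (\<xi> (r n)) - y0)) \<longlonglongrightarrow> w"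
  shows "norm w \<le> K * norm v" "norm v \<le> K * norm w" "v \<noteq> 0 \<Longrightarrow> w \<in> tangent_cone Y y0"
proof -
  have v: "(\<lambda>n. real (Suc (r n)) *\<^sub>R (\<xi> (r n) - x0)) \<longlonglongrightarrow> v"
    using LIMSEQ_subseq_LIMSEQ[OF \<xi>(2) r(1)] by (simp add: comp_def)
  note L = bilipschitz_between_limit[OF h(1) _ _ v r(2)[folded h(2)]]
  show "norm w \<le> K * norm v" and vw: "norm v \<le> K * norm w" using L \<xi>(1) by auto
  show "w \<in> tangent_cone Y y0" if "v \<noteq> 0"
  proof (rule tangent_coneI[OF _ filterlim_real_Suc_strict_mono[OF r(1)] r(2)])
    show "h (\<xi> (r n)) \<in> Y" for n using h(3) \<xi>(1) by blast
    show "w \<noteq> 0" using vw that by auto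
  qed
qed

lemma islimpt_bilipschitz:
  assumes h: "bilipschitz_between K (insert x0 (X \<inter> U)) h" "h x0 = y0" "\<And>x. x \<in> X \<inter> U \<Longrightarrow> h x \<in> Y"
    and U: "open U" "x0 \<in> U" and lp: "x0 islimpt X"
  shows "y0 islimpt Y"
proof -
  have "x0 islimpt X \<inter> U" unfolding islimpt_def
  proof (intro allI impI)
    fix T assume "x0 \<in> T" "open T"
    then have "x0 \<in> T \<inter> U" "open (T \<inter> U)" using U by auto
    then obtain y where "y \<in> X" "y \<in> T \<inter> U" "y \<noteq> x0" using lp unfolding islimpt_def by blast
    then show "\<exists>y\<in>X \<inter> U. y \<in> T \<and> y \<noteq> x0" by blast
  qed
  then obtain f where f: "\<And>n::nat. f n \<in> X \<inter> U - {x0}" "f \<longlonglongrightarrow> x0" unfolding islimpt_sequential by blast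
  have b: "norm (h (f n) - y0) \<le> K * norm (f n - x0)" "norm (f n - x0) \<le> K * norm (h (f n) - y0)" for n
    using h(1,2) f(1)[of n] unfolding bilipschitz_between_def by auto
  have "h (f n) \<in> Y - {y0}" for n using h(3) f(1)[of n] b(2)[of n] by auto
  moreover have "(\<lambda>n. h (f n)) \<longlonglongrightarrow> y0"
  proof -
    have "(\<lambda>n. K * norm (f n - x0)) \<longlonglongrightarrow> K * norm (x0 - x0)" by (intro tendsto_intros f(2))
    then have "(\<lambda>n. K * norm (f n - x0)) \<longlonglongrightarrow> 0" by simp
    then have "(\<lambda>n. h (f n) - y0) \<longlonglongrightarrow> 0"
      by (rule Lim_null_comparison[OF always_eventually[OF allI[OF b(1)]]])
    then show ?thesis by (simp add: LIM_zero_iff)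
  qed
  ultimately show ?thesis unfolding islimpt_sequential by (intro exI[of _ "\<lambda>n. h (f n)"]) blast
qed

text \<open>Tychonoff's theorem gives one cluster point of the whole family. The subsequence
  \<open>r\<close> depends on the pair \<open>i\<close>, \<open>j\<close>; pairs suffice, because
  the Lipschitz bounds and the inverse relation each compare two values.\<close>

lemma cluster_of_bounded_functions:
  fixes \<Phi> :: "nat \<Rightarrow> 'i \<Rightarrow> 'a::euclidean_space"
  assumes "\<And>i k. norm (\<Phi> k i) \<le> B i"
  obtains a where "\<And>i j. \<exists>r. strict_mono r \<and> (\<lambda>n. \<Phi> (r n) i) \<longlonglongrightarrow> a i \<and> (\<lambda>n. \<Phi> (r n) j) \<longlonglongrightarrow> a j"
proof -
  let ?T = "product_topology (\<lambda>_. euclidean) (UNIV :: 'i set) :: ('i \<Rightarrow> 'a) topology"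
  have "compactin ?T (\<Pi>\<^sub>E i\<in>UNIV. cball 0 (B i))" by (simp add: compactin_PiE)
  moreover have "\<Phi> k \<in> (\<Pi>\<^sub>E i\<in>UNIV. cball 0 (B i))" for k using assms by (simp add: PiE_iff)
  ultimately have "\<exists>a\<in>\<Pi>\<^sub>E i\<in>UNIV. cball 0 (B i). \<forall>W. openin ?T W \<and> a \<in> W \<longrightarrow> (\<exists>\<^sub>F k in sequentially. \<Phi> k \<in> W)"
    by (rule compactin_cluster_point)
  then obtain a where "\<forall>W. openin ?T W \<and> a \<in> W \<longrightarrow> (\<exists>\<^sub>F k in sequentially. \<Phi> k \<in> W)" ..
  then have a: "\<exists>\<^sub>F k in sequentially. \<Phi> k \<in> W" if "openin ?T W" "a \<in> W" for W
    using that by simp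
  have opn: "openin ?T {f. f i \<in> V}" if "open V" for i V
    using openin_continuous_map_preimage[OF continuous_map_product_projection[of i UNIV "\<lambda>_. euclidean"], of V] that
    by simp
  have "\<exists>r. strict_mono r \<and> (\<lambda>n. \<Phi> (r n) i) \<longlonglongrightarrow> a i \<and> (\<lambda>n. \<Phi> (r n) j) \<longlonglongrightarrow> a j" for i j
  proof -
    define P where "P = (\<lambda>n k. dist (\<Phi> k i) (a i) < 1 / real (Suc n) \<and> dist (\<Phi> k j) (a j) < 1 / real (Suc n))"
    have ex: "\<exists>k>m. P n k" for m n
    proof -
      let ?W = "{f. f i \<in> ball (a i) (1 / real (Suc n))} \<inter> {f. f j \<in> ball (a j) (1 / real (Suc n))}"
      have "\<exists>\<^sub>F k in sequentially. \<Phi> k \<in> ?W" by (rule a[OF openin_Int[OF opn[OF open_ball] opn[OF open_ball]]]) simp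
      then obtain k where "k > m" "\<Phi> k \<in> ?W" unfolding frequently_sequentially
        by (meson Suc_le_lessD)
      then show ?thesis by (auto simp: P_def dist_commute)
    qed
    have "\<exists>r. \<forall>n. P n (r n) \<and> r n < r (Suc n)"
      by (rule dependent_nat_choice) (use ex in auto)
    then obtain r where r: "\<And>n. P n (r n)" "\<And>n. r n < r (Suc n)" by blast
    have lim: "(\<lambda>n. 1 / real (Suc n)) \<longlonglongrightarrow> 0" by (rule LIMSEQ_Suc[OF lim_1_over_n])
    have "(\<lambda>n. dist (\<Phi> (r n) i) (a i)) \<longlonglongrightarrow> 0" "(\<lambda>n. dist (\<Phi> (r n) j) (a j)) \<longlonglongrightarrow> 0"
      by (rule tendsto_sandwich[OF _ _ tendsto_const lim]; use r(1) in \<open>auto simp: P_def intro!: always_eventually less_imp_le\<close>)+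
    then have "(\<lambda>n. \<Phi> (r n) i) \<longlonglongrightarrow> a i" "(\<lambda>n. \<Phi> (r n) j) \<longlonglongrightarrow> a j"
      using tendsto_dist_iff by blast+
    then show ?thesis using r(2) strict_mono_Suc_iff by blast
  qed
  then show thesis by (rule that)
qed

lemma bounded_blowup:
  assumes h: "bilipschitz_between K (insert x0 S) h" "h x0 = y0"
    and \<xi>: "\<And>k. \<xi> k \<in> S" "(\<lambda>k. real (Suc k) *\<^sub>R (\<xi> k - x0)) \<longlonglongrightarrow> v"
  shows "\<exists>B. \<forall>k. norm (real (Suc k) *\<^sub>R (h (\<xi> k) - y0)) \<le> B"
proof -
  obtain B where B: "\<And>k. norm (real (Suc k) *\<^sub>R (\<xi> k - x0)) \<le> B"
    using convergent_imp_Bseq[OF convergentI[OF \<xi>(2)]] by (auto simp: Bseq_def)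
  have "norm (real (Suc k) *\<^sub>R (h (\<xi> k) - y0)) \<le> K * B" for k
  proof -
    have "norm (h (\<xi> k) - y0) \<le> K * norm (\<xi> k - x0)"
      using h \<xi>(1)[of k] unfolding bilipschitz_between_def by auto
    then have "norm (real (Suc k) *\<^sub>R (h (\<xi> k) - y0)) \<le> K * norm (real (Suc k) *\<^sub>R (\<xi> k - x0))"
      using mult_left_mono[of _ _ "real (Suc k)"] by (fastforce simp: mult.left_commute)
    also have "\<dots> \<le> K * B" using B h(1) by (intro mult_left_mono) (auto simp: bilipschitz_between_def)
    finally show ?thesis .
  qed
  then show ?thesis by blast
qed

text \<open>\<open>H v\<close> is the cluster value of the blow-ups of \<open>h\<close> along
  \<open>\<xi> v\<close>. Blow-ups of the inverse \<open>g\<close> along \<open>\<eta> w\<close>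
  belong to the same family, so that a common subsequence relates a value of \<open>H\<close> to a
  value of its inverse.\<close>

lemma bilipschitz_tangent_cones:
  fixes X Y :: "'a::euclidean_space set"
  assumes h: "bilipschitz_between K (insert x0 (X \<inter> U)) h" "h x0 = y0" "h ` (X \<inter> U) = Y \<inter> V"
    and U: "open U" "x0 \<in> U" and V: "open V" "y0 \<in> V"
    and \<xi>: "\<And>v. v \<in> tangent_cone X x0 \<Longrightarrow>
      (\<forall>k. \<xi> v k \<in> X \<inter> U) \<and> (\<lambda>k. real (Suc k) *\<^sub>R (\<xi> v k - x0)) \<longlonglongrightarrow> v"
    and \<eta>: "\<And>w. w \<in> tangent_cone Y y0 \<Longrightarrow>
      (\<forall>k. \<eta> w k \<in> Y \<inter> V) \<and> (\<lambda>k. real (Suc k) *\<^sub>R (\<eta> w k - y0)) \<longlonglongrightarrow> w"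
  shows "\<exists>H. H ` tangent_cone X x0 = tangent_cone Y y0 \<and> H 0 = 0 \<and>
    bilipschitz_between K (insert 0 (tangent_cone X x0)) H"
proof -
  let ?CX = "tangent_cone X x0" and ?CY = "tangent_cone Y y0"
  have K: "0 < K" using h(1) by (simp add: bilipschitz_between_def)
  have hb: "norm (h x - h y) \<le> K * norm (x - y)" "norm (x - y) \<le> K * norm (h x - h y)"
    if "x \<in> insert x0 (X \<inter> U)" "y \<in> insert x0 (X \<inter> U)" for x y
    using h(1) that unfolding bilipschitz_between_def by blast+
  have inj: "inj_on h (insert x0 (X \<inter> U))"
    by (rule bilipschitz_between_inj_on[OF h(1)])
  define g where "g = inv_into (insert x0 (X \<inter> U)) h"
  have gh: "g (h x) = x" if "x \<in> insert x0 (X \<inter> U)" for x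
    unfolding g_def by (rule inv_into_f_f[OF inj that])
  have gY: "g y \<in> X \<inter> U \<and> h (g y) = y" if "y \<in> Y \<inter> V" for y
  proof -
    have "y \<in> h ` (X \<inter> U)" using that h(3) by simp
    then obtain x where x: "x \<in> X \<inter> U" "y = h x" by (elim imageE)
    then show ?thesis using gh[of x] by simp
  qed
  have gy0: "g y0 = x0" using gh[of x0] h(2) by simp
  have gi: "g y \<in> insert x0 (X \<inter> U) \<and> h (g y) = y" if "y \<in> insert y0 (Y \<inter> V)" for y
  proof (cases "y = y0")
    case True then show ?thesis using gy0 h(2) by simp
  next
    case False then show ?thesis using that gY[of y] by simp
  qed
  have g: "bilipschitz_between K (insert y0 (Y \<inter> V)) g"
    unfolding bilipschitz_between_def
  proof (intro conjI ballI K)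
    fix y z assume y: "y \<in> insert y0 (Y \<inter> V)" and z: "z \<in> insert y0 (Y \<inter> V)"
    show "norm (g y - g z) \<le> K * norm (y - z)" "norm (y - z) \<le> K * norm (g y - g z)"
      using hb[OF conjunct1[OF gi[OF y]] conjunct1[OF gi[OF z]]] gi[OF y] gi[OF z] by auto
  qed
  have hY: "h x \<in> Y" if "x \<in> X \<inter> U" for x using h(3) that by blast
  have gX: "g y \<in> X" if "y \<in> Y \<inter> V" for y using gY[OF that] by blast
  \<comment> \<open>The sum type joins both kinds of blow-up; the value 0 outside the cones keeps
    the family bounded at every index.\<close>
  define \<Phi> where "\<Phi> = (\<lambda>k i. case i of
      Inl v \<Rightarrow> if v \<in> ?CX then real (Suc k) *\<^sub>R (h (\<xi> v k) - y0) else 0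
    | Inr w \<Rightarrow> if w \<in> ?CY then real (Suc k) *\<^sub>R (g (\<eta> w k) - x0) else 0)"
  have \<Phi>l: "\<Phi> k (Inl v) = real (Suc k) *\<^sub>R (h (\<xi> v k) - y0)" if "v \<in> ?CX" for k v
    using that by (simp add: \<Phi>_def)
  have \<Phi>r: "\<Phi> k (Inr w) = real (Suc k) *\<^sub>R (g (\<eta> w k) - x0)" if "w \<in> ?CY" for k w
    using that by (simp add: \<Phi>_def)
  have "\<exists>B. \<forall>k. norm (\<Phi> k i) \<le> B" for i
  proof (cases i)
    case (Inl v)
    show ?thesis
    proof (cases "v \<in> ?CX")
      case True
      then show ?thesis using bounded_blowup[OF h(1,2), of "\<xi> v" v] \<xi>[OF True] Inl \<Phi>l by simp
    qed (auto simp: Inl \<Phi>_def)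
  next
    case (Inr w)
    show ?thesis
    proof (cases "w \<in> ?CY")
      case True
      then show ?thesis using bounded_blowup[OF g gy0, of "\<eta> w" w] \<eta>[OF True] Inr \<Phi>r by simp
    qed (auto simp: Inr \<Phi>_def)
  qed
  then obtain B where "\<And>i k. norm (\<Phi> k i) \<le> B i" by metis
  then obtain a where a: "\<And>i j. \<exists>r. strict_mono r \<and> (\<lambda>n. \<Phi> (r n) i) \<longlonglongrightarrow> a i \<and> (\<lambda>n. \<Phi> (r n) j) \<longlonglongrightarrow> a j"
    using cluster_of_bounded_functions[of \<Phi> B] by blast
  have zero: "0 \<in> ?CX \<longleftrightarrow> 0 \<in> ?CY"
    unfolding zero_in_tangent_cone_iff
    using islimpt_bilipschitz[OF h(1,2) hY U] islimpt_bilipschitz[OF g gy0 gX V] by blast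
  have A: "norm (a (Inl v)) \<le> K * norm v" "norm v \<le> K * norm (a (Inl v))" "a (Inl v) \<in> ?CY" if v: "v \<in> ?CX" for v
  proof -
    obtain r where r: "strict_mono r" "(\<lambda>n. \<Phi> (r n) (Inl v)) \<longlonglongrightarrow> a (Inl v)" using a by blast
    note L = blowup_limit[OF h(1,2) hY _ _ r(1) r(2)[unfolded \<Phi>l[OF v]], of v]
    show 1: "norm (a (Inl v)) \<le> K * norm v" "norm v \<le> K * norm (a (Inl v))" using L \<xi>[OF v] by blast+
    show "a (Inl v) \<in> ?CY"
    proof (cases "v = 0")
      case True then show ?thesis using 1 v zero by simp
    next
      case False then show ?thesis using L(3) \<xi>[OF v] by blast
    qed
  qed
  have A': "a (Inr w) \<in> ?CX" if w: "w \<in> ?CY" for w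
  proof -
    obtain r where r: "strict_mono r" "(\<lambda>n. \<Phi> (r n) (Inr w)) \<longlonglongrightarrow> a (Inr w)" using a by blast
    note L = blowup_limit[OF g gy0 gX _ _ r(1) r(2)[unfolded \<Phi>r[OF w]], of w]
    show ?thesis
    proof (cases "w = 0")
      case True
      then have "norm (a (Inr w)) \<le> 0" using L(1) \<eta>[OF w] by simp
      then show ?thesis using w zero True by simp
    next
      case False then show ?thesis using L(3) \<eta>[OF w] by blast
    qed
  qed
  have \<xi>r: "(\<lambda>n. real (Suc (r n)) *\<^sub>R (\<xi> v (r n) - x0)) \<longlonglongrightarrow> v" if "v \<in> ?CX" "strict_mono r" for v r
    using LIMSEQ_subseq_LIMSEQ[OF conjunct2[OF \<xi>[OF that(1)]] that(2)] by (simp add: comp_def)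
  have dist: "norm (a (Inl v) - a (Inl v')) \<le> K * norm (v - v') \<and> norm (v - v') \<le> K * norm (a (Inl v) - a (Inl v'))"
    if v: "v \<in> ?CX" "v' \<in> ?CX" for v v'
  proof -
    obtain r where r: "strict_mono r" "(\<lambda>n. \<Phi> (r n) (Inl v)) \<longlonglongrightarrow> a (Inl v)"
      "(\<lambda>n. \<Phi> (r n) (Inl v')) \<longlonglongrightarrow> a (Inl v')" using a by blast
    have "(\<lambda>n. real (Suc (r n)) *\<^sub>R (\<xi> v (r n) - x0) - real (Suc (r n)) *\<^sub>R (\<xi> v' (r n) - x0)) \<longlonglongrightarrow> v - v'"
      by (intro tendsto_diff \<xi>r v r(1))
    then have lim: "(\<lambda>n. real (Suc (r n)) *\<^sub>R (\<xi> v (r n) - \<xi> v' (r n))) \<longlonglongrightarrow> v - v'"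
      by (simp add: scaleR_diff_right)
    have "(\<lambda>n. \<Phi> (r n) (Inl v) - \<Phi> (r n) (Inl v')) \<longlonglongrightarrow> a (Inl v) - a (Inl v')"
      by (intro tendsto_diff r)
    then have "(\<lambda>n. real (Suc (r n)) *\<^sub>R (h (\<xi> v (r n)) - h (\<xi> v' (r n)))) \<longlonglongrightarrow> a (Inl v) - a (Inl v')"
      by (simp add: \<Phi>l v scaleR_diff_right)
    from bilipschitz_between_limit[OF h(1) _ _ lim this] show ?thesis using \<xi>[OF v(1)] \<xi>[OF v(2)] by blast
  qed
  have surj: "a (Inl (a (Inr w))) = w" if w: "w \<in> ?CY" for w
  proof -
    \<comment> \<open>Along \<open>r\<close> both \<open>\<xi> v\<close> and
      \<open>g (\<eta> w)\<close> have the blow-up \<open>v\<close>; hence the blow-ups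
      \<open>a (Inl v)\<close> and \<open>w\<close> of their images under \<open>h\<close>
      coincide.\<close>
    define v where "v = a (Inr w)"
    have v: "v \<in> ?CX" unfolding v_def by (rule A'[OF w])
    obtain r where r: "strict_mono r" "(\<lambda>n. \<Phi> (r n) (Inl v)) \<longlonglongrightarrow> a (Inl v)"
      "(\<lambda>n. \<Phi> (r n) (Inr w)) \<longlonglongrightarrow> v"
      unfolding v_def using a by blast
    have "(\<lambda>n. real (Suc (r n)) *\<^sub>R (\<eta> w (r n) - y0)) \<longlonglongrightarrow> w"
      using LIMSEQ_subseq_LIMSEQ[OF conjunct2[OF \<eta>[OF w]] r(1)] by (simp add: comp_def)
    then have "(\<lambda>n. \<Phi> (r n) (Inl v) - real (Suc (r n)) *\<^sub>R (\<eta> w (r n) - y0)) \<longlonglongrightarrow> a (Inl v) - w"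
      by (intro tendsto_diff r(2))
    moreover have gk: "g (\<eta> w k) \<in> X \<inter> U" "h (g (\<eta> w k)) = \<eta> w k" for k using gY \<eta>[OF w] by blast+
    ultimately have lh: "(\<lambda>n. real (Suc (r n)) *\<^sub>R (h (\<xi> v (r n)) - h (g (\<eta> w (r n))))) \<longlonglongrightarrow> a (Inl v) - w"
      by (simp add: \<Phi>l v scaleR_diff_right)
    have "(\<lambda>n. real (Suc (r n)) *\<^sub>R (\<xi> v (r n) - x0) - \<Phi> (r n) (Inr w)) \<longlonglongrightarrow> v - v"
      by (intro tendsto_diff \<xi>r v r)
    then have "(\<lambda>n. real (Suc (r n)) *\<^sub>R (\<xi> v (r n) - g (\<eta> w (r n)))) \<longlonglongrightarrow> 0"
      by (simp add: \<Phi>r w scaleR_diff_right)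
    from bilipschitz_between_limit(1)[OF h(1) _ _ this lh] have "norm (a (Inl v) - w) \<le> K * norm (0::'a)"
      using gk \<xi>[OF v] by blast
    then show ?thesis by (simp add: v_def)
  qed
  \<comment> \<open>The default gives \<open>H 0 = 0\<close> when 0 is not a tangent vector;
    otherwise the norm bound does.\<close>
  define H where "H = (\<lambda>v. if v \<in> ?CX then a (Inl v) else 0)"
  have "H ` ?CX = ?CY"
  proof
    show "H ` ?CX \<subseteq> ?CY" using A(3) by (auto simp: H_def)
    show "?CY \<subseteq> H ` ?CX"
    proof
      fix w assume w: "w \<in> ?CY"
      have "w = H (a (Inr w))" using surj[OF w] A'[OF w] by (simp add: H_def)
      then show "w \<in> H ` ?CX" using A'[OF w] by blast
    qed
  qed
  moreover have H0: "H 0 = 0" using A(1)[of 0] by (simp add: H_def)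
  moreover have "bilipschitz_between K (insert 0 ?CX) H"
    unfolding bilipschitz_between_def
  proof (intro conjI ballI K)
    have Hv: "H v = a (Inl v)" if "v \<in> ?CX" for v using that by (simp add: H_def)
    fix x y assume xy: "x \<in> insert 0 ?CX" "y \<in> insert 0 ?CX"
    then consider "x \<in> ?CX" "y \<in> ?CX" | "x = 0" "y \<in> ?CX" | "x \<in> ?CX" "y = 0" | "x = 0" "y = 0" by blast
    then have "norm (H x - H y) \<le> K * norm (x - y) \<and> norm (x - y) \<le> K * norm (H x - H y)"
    proof cases
      case 1 then show ?thesis using dist[of x y] Hv by simp
    next
      case 2 then show ?thesis using A(1,2)[of y] Hv[of y] H0 by simp
    next
      case 3 then show ?thesis using A(1,2)[of x] Hv[of x] H0 by simp
    qed simp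
    then show "norm (H x - H y) \<le> K * norm (x - y)" "norm (x - y) \<le> K * norm (H x - H y)" by auto
  qed
  ultimately show ?thesis by blast
qed

theorem theorem2p2:
  fixes X Y :: "(real ^ 'n::finite) set" and x0 y0 :: "real ^ 'n"
  assumes "subanalytic X" and "subanalytic Y"
    and "x0 \<in> closure X" and "y0 \<in> closure Y"
    and "germs_bilipschitz_homeomorphic X x0 Y y0"
  shows "germs_bilipschitz_homeomorphic (tangent_cone X x0) 0 (tangent_cone Y y0) 0"
proof -
  obtain U V h where UV: "open U" "x0 \<in> U" "open V" "y0 \<in> V"
    and h: "bilipschitz_homeo ((X \<inter> U) \<union> {x0}) ((Y \<inter> V) \<union> {y0}) h" "h x0 = y0" "h ` (X \<inter> U) = Y \<inter> V"
    using assms(5) unfolding germs_bilipschitz_homeomorphic_def by blast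
  obtain K where K: "0 < K" "\<And>x y. x \<in> (X \<inter> U) \<union> {x0} \<Longrightarrow> y \<in> (X \<inter> U) \<union> {x0} \<Longrightarrow>
      (1 / K) * norm (x - y) \<le> norm (h x - h y) \<and> norm (h x - h y) \<le> K * norm (x - y)"
    using h(1) unfolding bilipschitz_homeo_def by blast
  have hb: "bilipschitz_between K (insert x0 (X \<inter> U)) h"
    unfolding bilipschitz_between_def using K by (force simp: field_simps)
  have "\<forall>v\<in>tangent_cone X x0. \<exists>\<xi>. (\<forall>k. \<xi> k \<in> X \<inter> U) \<and> (\<lambda>k. real (Suc k) *\<^sub>R (\<xi> k - x0)) \<longlonglongrightarrow> v"
    using subanalytic_tangent_approx[OF assms(1)] by (intro ballI realizing_sequence UV assms(3)) blast
  from bchoice[OF this] obtain \<xi> where \<xi>: "\<And>v. v \<in> tangent_cone X x0 \<Longrightarrow>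
      (\<forall>k. \<xi> v k \<in> X \<inter> U) \<and> (\<lambda>k. real (Suc k) *\<^sub>R (\<xi> v k - x0)) \<longlonglongrightarrow> v" by blast
  have "\<forall>v\<in>tangent_cone Y y0. \<exists>\<xi>. (\<forall>k. \<xi> k \<in> Y \<inter> V) \<and> (\<lambda>k. real (Suc k) *\<^sub>R (\<xi> k - y0)) \<longlonglongrightarrow> v"
    using subanalytic_tangent_approx[OF assms(2)] by (intro ballI realizing_sequence UV assms(4)) blast
  from bchoice[OF this] obtain \<eta> where \<eta>: "\<And>w. w \<in> tangent_cone Y y0 \<Longrightarrow>
      (\<forall>k. \<eta> w k \<in> Y \<inter> V) \<and> (\<lambda>k. real (Suc k) *\<^sub>R (\<eta> w k - y0)) \<longlonglongrightarrow> w" by blast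
  obtain H where H: "H ` tangent_cone X x0 = tangent_cone Y y0" "H 0 = 0"
    "bilipschitz_between K (insert 0 (tangent_cone X x0)) H"
    using bilipschitz_tangent_cones[OF hb h(2,3) UV \<xi> \<eta>] by blast
  have Hb: "norm (H x - H y) \<le> K * norm (x - y)" "norm (x - y) \<le> K * norm (H x - H y)"
    if "x \<in> tangent_cone X x0 \<union> {0}" "y \<in> tangent_cone X x0 \<union> {0}" for x y
    using H(3) that unfolding bilipschitz_between_def by blast+
  have "bij_betw H (tangent_cone X x0 \<union> {0}) (tangent_cone Y y0 \<union> {0})"
  proof (rule bij_betw_imageI)
    show "inj_on H (tangent_cone X x0 \<union> {0})" using bilipschitz_between_inj_on[OF H(3)] by simp
    show "H ` (tangent_cone X x0 \<union> {0}) = tangent_cone Y y0 \<union> {0}" using H(1,2) by auto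
  qed
  then have "bilipschitz_homeo (tangent_cone X x0 \<inter> UNIV \<union> {0}) (tangent_cone Y y0 \<inter> UNIV \<union> {0}) H"
    unfolding bilipschitz_homeo_def using Hb K(1)
    by (auto intro!: exI[of _ K] simp: divide_le_eq mult.commute simp del: Un_insert_right)
  \<comment> \<open>\<open>H\<close> is bi-Lipschitz on the entire cone, so the whole space serves
    as neighbourhood on both sides.\<close>
  then show ?thesis
    unfolding germs_bilipschitz_homeomorphic_def using H(1,2)
    by (intro exI[of _ UNIV] exI[of _ H]) auto
qed

end
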